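(* Let $V = (V_x)_{x \in X}$ be a Borel field of separable Banach spaces. Consider on $B(V) = (B(V_x))_{x\in X}$ the unique standard Borel structure such that $\pi : B(V)\to X$ and $B(V)\times_\pi V\to V : (T,v)\mapsto T(v)$ are Borel. Let $\operatorname{Isom} V = (\operatorname{Isom} V_x)_{x\in X}$. 1. $\operatorname{Isom} V$ is a Borel subset of $B(V)$. The restricted Borel structure on $\operatorname{Isom} V$ is the unique standard Borel structure on $\operatorname{Isom} V$ such that the maps $\pi : \operatorname{Isom} V \to X$ and $\operatorname{Isom} V \times_\pi V \to V : (\alpha,v) \mapsto \alpha(v)$ are Borel. Then composition $\operatorname{Isom} V\times_\pi\operatorname{Isom} V\to\operatorname{Isom} V$ and inverse $\operatorname{Isom} V\to\operatorname{Isom} V$ are Borel maps. 2. For every $\sigma$-finite measure on $X$, $\operatorname{Isom} V$ is a measured field of Polish groups. 3. There are examples of Borel fields $V$ of separable Banach spaces for which $\operatorname{Isom} V$ is not a Borel field of Polish groups, because there is no dense sequence of Borel sections $X \to \operatorname{Isom} V$.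
   Context: Conventions. A standard Borel space is a measurable space isomorphic to a Borel subset of a Polish space. Product spaces carry the product $\sigma$-algebra and subsets the restricted $\sigma$-algebra. For a family of sets $V = (V_x)_{x\in X}$, the symbol $V$ also denotes the disjoint union of the $V_x$, and $\pi : V \to X$ is the map with $\pi(v) = x$ for $v \in V_x$. For two families over $X$, $V \times_\pi W = \{(v,w) \in V \times W \mid \pi(v)=\pi(w)\}$. A section is a map $\varphi : X \to V$ with $\varphi(x)\in V_x$ for all $x$. A sequence of Borel sections $\varphi_n : X \to V$ is dense if $\{\varphi_n(x) \mid n\in\mathbb{N}\}$ is dense in $V_x$ for every $x\in X$. For a separable Banach space $E$, $\operatorname{Isom} E$ is the group of bijective isometric linear maps $E\to E$; with the strong operator topology it is a Polish group. $B(E)$ is the space of bounded linear operators on $E$. (It is a fact that there is exactly one standard Borel structure on $B(V)$ as described in the claim.) A Borel field of separable Banach spaces (complex scalars) consists of a standard Borel space $X$, a family $V=(V_x)_{x\in X}$ of separable Banach spaces and a standard Borel structure on $V$ such that $\pi : V\to X$, the norm $V\to[0,+\infty)$, the addition $V\times_\pi V\to V$ and the scalar multiplication $\mathbb{C}\times V\to V$ are Borel, and there is a (norm) dense sequence of Borel sections $X\to V$. A Borel field of Polish spaces consists of a standard Borel space $X$, a family $V=(V_x)_{x\in X}$ of Polish spaces and a standard Borel structure on $V$ such that: (1) $\pi : V\to X$ is Borel; (2) there is a Borel map $d : V\times_\pi V\to[0,+\infty)$ whose restriction to each $V_x\times V_x$ is a separable complete metric inducing the topology of $V_x$; (3) there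 is a dense sequence of Borel sections $X\to V$. A Borel field of Polish groups consists of a standard Borel space $X$, a family $G=(G_x)_{x\in X}$ of Polish groups and a standard Borel structure on $G$ such that $G$ is a Borel field of Polish spaces and the maps $X\to G : x\mapsto e_x$ (unit of $G_x$), $G\to G : g\mapsto g^{-1}$ and $G\times_\pi G\to G : (g,h)\mapsto gh$ are Borel. A measured field of Polish groups consists of a standard Borel space $X$ with a $\sigma$-finite measure $\mu$, a family $G=(G_x)_{x\in X}$ of Polish groups and a standard Borel structure on $G$ such that $\pi : G\to X$ is Borel and there is a $\mu$-conull Borel set $X_0\subset X$ with $(G_x)_{x\in X_0}$ a Borel field of Polish groups. *)

theory Defs
  imports
    "HOL-Analysis.Analysis"
    "HOL-Algebra.Module"
    "HOL-Algebra.Bij"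
    "HOL-Algebra.Algebraic_Closure_Type"
begin

no_notation
  Polynomials.var ("X\<index>") and
  eq_closure_of ("closure'_of\<index>")

text \<open>
  Measurable spaces are values of type \<^typ>\<open>'a measure\<close>, of which only \<^const>\<open>space\<close> and
  \<^const>\<open>sets\<close> matter, unless the measure is explicitly mentioned. Two Borel structures
  \<open>M\<close>, \<open>N\<close> are therefore the same iff \<open>sets M = sets N\<close>.

  A family of sets over \<open>X\<close> is a function \<open>S\<close> on the points of \<open>X\<close>. Its disjoint union is
  \<open>Sigma (space X) S\<close>, the map \<open>\<pi>\<close> is \<^const>\<open>fst\<close>, and a section \<open>\<phi>\<close> is given by its fibre
  components, so that as a map into the disjoint union it is \<open>\<lambda>x. (x, \<phi> x)\<close>.
\<close>

section \<open>Standard Borel and Polish spaces\<close>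

definition polish_space_on :: "'a topology \<Rightarrow> bool" where
  "polish_space_on T \<longleftrightarrow> separable_space T \<and> completely_metrizable_space T"

definition borel_sigma :: "'a topology \<Rightarrow> 'a measure" where
  "borel_sigma T = sigma (topspace T) {U. openin T U}"

text \<open>
  A Polish space has at most continuum many points, so it is homeomorphic to one whose points
  are real numbers (with an arbitrary topology, unrelated to the usual one). Letting \<open>T\<close> range
  over topologies on sets of reals is thus no restriction.
\<close>

definition standard_borel :: "'a measure \<Rightarrow> bool" where
  "standard_borel M \<longleftrightarrow>
    (\<exists>(T :: real topology) B f g.
       polish_space_on T \<and> B \<in> sets (borel_sigma T) \<and>
       f \<in> M \<rightarrow>\<^sub>M restrict_space (borel_sigma T) B \<and>
       g \<in> restrict_space (borel_sigma T) B \<rightarrow>\<^sub>M M \<and>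
       (\<forall>a\<in>space M. g (f a) = a) \<and> (\<forall>b\<in>B. f (g b) = b))"

definition fiber_prod ::
  "('x \<times> 'a) measure \<Rightarrow> ('x \<times> 'b) measure \<Rightarrow> (('x \<times> 'a) \<times> ('x \<times> 'b)) measure" where
  "fiber_prod M N = restrict_space (M \<Otimes>\<^sub>M N) {p. fst (fst p) = fst (snd p)}"

text \<open>\<^const>\<open>Metric_space\<close> asks for symmetry and nonnegativity also outside the carrier.\<close>

definition restrict_dist :: "'a set \<Rightarrow> ('a \<Rightarrow> 'a \<Rightarrow> real) \<Rightarrow> 'a \<Rightarrow> 'a \<Rightarrow> real" where
  "restrict_dist S d = (\<lambda>v w. if v \<in> S \<and> w \<in> S then d v w else 0)"

section \<open>Separable Banach spaces and operators\<close>

text \<open>The fields \<^const>\<open>mult\<close> and \<^const>\<open>one\<close> inherited from the library record are unused.\<close>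

record 'v cnormed_space = "(complex, 'v) module" +
  vnorm :: "'v \<Rightarrow> real"

definition norm_dist :: "'v cnormed_space \<Rightarrow> 'v \<Rightarrow> 'v \<Rightarrow> real" where
  "norm_dist E = restrict_dist (carrier E) (\<lambda>v w. vnorm E (v \<ominus>\<^bsub>E\<^esub> w))"

definition norm_topology :: "'v cnormed_space \<Rightarrow> 'v topology" where
  "norm_topology E = Metric_space.mtopology (carrier E) (norm_dist E)"

definition separable_banach_space :: "'v cnormed_space \<Rightarrow> bool" where
  "separable_banach_space E \<longleftrightarrow>
    Module.module (ring_of_type_algebra :: complex ring) E \<and>
    (\<forall>v\<in>carrier E. 0 \<le> vnorm E v \<and> (vnorm E v = 0 \<longleftrightarrow> v = \<zero>\<^bsub>E\<^esub>)) \<and>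
    (\<forall>c. \<forall>v\<in>carrier E. vnorm E (c \<odot>\<^bsub>E\<^esub> v) = cmod c * vnorm E v) \<and>
    (\<forall>v\<in>carrier E. \<forall>w\<in>carrier E. vnorm E (v \<oplus>\<^bsub>E\<^esub> w) \<le> vnorm E v + vnorm E w) \<and>
    Metric_space.mcomplete (carrier E) (norm_dist E) \<and>
    separable_space (norm_topology E)"

text \<open>Operators are extensional functions, so that equal operators are equal as functions.\<close>

definition linear_ops :: "'v cnormed_space \<Rightarrow> ('v \<Rightarrow> 'v) set" where
  "linear_ops E = {T \<in> carrier E \<rightarrow>\<^sub>E carrier E.
     (\<forall>v\<in>carrier E. \<forall>w\<in>carrier E. T (v \<oplus>\<^bsub>E\<^esub> w) = T v \<oplus>\<^bsub>E\<^esub> T w) \<and>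
     (\<forall>c. \<forall>v\<in>carrier E. T (c \<odot>\<^bsub>E\<^esub> v) = c \<odot>\<^bsub>E\<^esub> T v)}"

definition bounded_ops :: "'v cnormed_space \<Rightarrow> ('v \<Rightarrow> 'v) set" where
  "bounded_ops E =
    {T \<in> linear_ops E. \<exists>C. \<forall>v\<in>carrier E. vnorm E (T v) \<le> C * vnorm E v}"

definition isometries :: "'v cnormed_space \<Rightarrow> ('v \<Rightarrow> 'v) set" where
  "isometries E =
    {T \<in> linear_ops E. bij_betw T (carrier E) (carrier E) \<and>
       (\<forall>v\<in>carrier E. vnorm E (T v) = vnorm E v)}"

definition isom_group :: "'v cnormed_space \<Rightarrow> ('v \<Rightarrow> 'v) monoid" where
  "isom_group E = BijGroup (carrier E)\<lparr>carrier := isometries E\<rparr>"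

text \<open>The strong operator topology is the topology of pointwise norm convergence.\<close>

definition isom_topology :: "'v cnormed_space \<Rightarrow> ('v \<Rightarrow> 'v) topology" where
  "isom_topology E =
    subtopology (product_topology (\<lambda>v. norm_topology E) (carrier E)) (isometries E)"

section \<open>Borel fields\<close>

definition dense_borel_sections ::
  "'x measure \<Rightarrow> ('x \<Rightarrow> 'a topology) \<Rightarrow> ('x \<times> 'a) measure \<Rightarrow> (nat \<Rightarrow> 'x \<Rightarrow> 'a) \<Rightarrow> bool" where
  "dense_borel_sections X T M \<phi> \<longleftrightarrow>
    (\<forall>n. (\<lambda>x. (x, \<phi> n x)) \<in> X \<rightarrow>\<^sub>M M) \<and>
    (\<forall>x\<in>space X. T x closure_of range (\<lambda>n. \<phi> n x) = topspace (T x))"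

definition borel_field_banach ::
  "'x measure \<Rightarrow> ('x \<Rightarrow> 'v cnormed_space) \<Rightarrow> ('x \<times> 'v) measure \<Rightarrow> bool" where
  "borel_field_banach X V MV \<longleftrightarrow>
    standard_borel X \<and>
    (\<forall>x\<in>space X. separable_banach_space (V x)) \<and>
    standard_borel MV \<and> space MV = Sigma (space X) (\<lambda>x. carrier (V x)) \<and>
    fst \<in> MV \<rightarrow>\<^sub>M X \<and>
    (\<lambda>(x, v). vnorm (V x) v) \<in> MV \<rightarrow>\<^sub>M borel \<and>
    (\<lambda>((x, v), (y, w)). (x, v \<oplus>\<^bsub>V x\<^esub> w)) \<in> fiber_prod MV MV \<rightarrow>\<^sub>M MV \<and>
    (\<lambda>(c, (x, v)). (x, c \<odot>\<^bsub>V x\<^esub> v)) \<in> (borel :: complex measure) \<Otimes>\<^sub>M MV \<rightarrow>\<^sub>M MV \<and>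
    (\<exists>\<phi>. dense_borel_sections X (\<lambda>x. norm_topology (V x)) MV \<phi>)"

definition borel_field_polish ::
  "'x measure \<Rightarrow> ('x \<Rightarrow> 'a topology) \<Rightarrow> ('x \<times> 'a) measure \<Rightarrow> bool" where
  "borel_field_polish X T M \<longleftrightarrow>
    standard_borel X \<and>
    (\<forall>x\<in>space X. polish_space_on (T x)) \<and>
    standard_borel M \<and> space M = Sigma (space X) (\<lambda>x. topspace (T x)) \<and>
    fst \<in> M \<rightarrow>\<^sub>M X \<and>
    (\<exists>d. d \<in> fiber_prod M M \<rightarrow>\<^sub>M (borel :: real measure) \<and>
      (\<forall>x\<in>space X.
        let dx = restrict_dist (topspace (T x)) (\<lambda>v w. d ((x, v), (x, w))) in
        Metric_space (topspace (T x)) dx \<and>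
        Metric_space.mcomplete (topspace (T x)) dx \<and>
        Metric_space.mtopology (topspace (T x)) dx = T x)) \<and>
    (\<exists>\<phi>. dense_borel_sections X T M \<phi>)"

definition polish_group :: "'a monoid \<Rightarrow> 'a topology \<Rightarrow> bool" where
  "polish_group G T \<longleftrightarrow>
    group G \<and> topspace T = carrier G \<and> polish_space_on T \<and>
    continuous_map (prod_topology T T) T (\<lambda>(g, h). g \<otimes>\<^bsub>G\<^esub> h) \<and>
    continuous_map T T (\<lambda>g. inv\<^bsub>G\<^esub> g)"

definition borel_field_polish_groups ::
  "'x measure \<Rightarrow> ('x \<Rightarrow> 'a monoid) \<Rightarrow> ('x \<Rightarrow> 'a topology) \<Rightarrow> ('x \<times> 'a) measure \<Rightarrow> bool" where
  "borel_field_polish_groups X G T M \<longleftrightarrow>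
    (\<forall>x\<in>space X. polish_group (G x) (T x)) \<and>
    borel_field_polish X T M \<and>
    (\<lambda>x. (x, \<one>\<^bsub>G x\<^esub>)) \<in> X \<rightarrow>\<^sub>M M \<and>
    (\<lambda>(x, g). (x, inv\<^bsub>G x\<^esub> g)) \<in> M \<rightarrow>\<^sub>M M \<and>
    (\<lambda>((x, g), (y, h)). (x, g \<otimes>\<^bsub>G x\<^esub> h)) \<in> fiber_prod M M \<rightarrow>\<^sub>M M"

definition measured_field_polish_groups ::
  "'x measure \<Rightarrow> ('x \<Rightarrow> 'a monoid) \<Rightarrow> ('x \<Rightarrow> 'a topology) \<Rightarrow> ('x \<times> 'a) measure \<Rightarrow> bool" where
  "measured_field_polish_groups \<mu> G T M \<longleftrightarrow>
    standard_borel \<mu> \<and> sigma_finite_measure \<mu> \<and>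
    (\<forall>x\<in>space \<mu>. polish_group (G x) (T x)) \<and>
    standard_borel M \<and> space M = Sigma (space \<mu>) (\<lambda>x. carrier (G x)) \<and>
    fst \<in> M \<rightarrow>\<^sub>M \<mu> \<and>
    (\<exists>X0\<in>sets \<mu>. space \<mu> - X0 \<in> null_sets \<mu> \<and>
      borel_field_polish_groups (restrict_space \<mu> X0) G T
        (restrict_space M {p. fst p \<in> X0}))"

text \<open>
  \<open>M\<close> is a standard Borel structure on the family \<open>S\<close> of sets of operators of the spaces \<open>V x\<close>,
  for which the projection and the evaluation map are Borel.
\<close>

definition operator_borel_structure ::
  "'x measure \<Rightarrow> ('x \<times> 'v) measure \<Rightarrow> ('x \<Rightarrow> ('v \<Rightarrow> 'v) set) \<Rightarrow> ('x \<times> ('v \<Rightarrow> 'v)) measure \<Rightarrow> bool"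
where
  "operator_borel_structure X MV S M \<longleftrightarrow>
    standard_borel M \<and> space M = Sigma (space X) S \<and>
    fst \<in> M \<rightarrow>\<^sub>M X \<and>
    (\<lambda>((x, T), (y, v)). (x, T v)) \<in> fiber_prod M MV \<rightarrow>\<^sub>M MV"

definition isom_total :: "'x measure \<Rightarrow> ('x \<Rightarrow> 'v cnormed_space) \<Rightarrow> ('x \<times> ('v \<Rightarrow> 'v)) set" where
  "isom_total X V = Sigma (space X) (\<lambda>x. isometries (V x))"

end

theory Submission
  imports Defs "HOL-Complex_Analysis.Great_Picard"
begin

text \<open>
  Countably many Borel sets that separate the points of a standard Borel space generate its
  \<open>\<sigma>\<close>-algebra (Lusin's separation theorem). For a Borel structure on \<open>Isom V\<close>, the sets
  \<open>{\<alpha>. \<parallel>\<alpha> (\<phi> n) - \<phi> m\<parallel> < 1/k}\<close> together with the preimages of a separating sequence in \<open>X\<close> are such a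
  family: this yields uniqueness, and it reduces the measurability of composition and inverse to
  that of the evaluation map. Almost everywhere on \<open>X\<close>, dense Borel sections are obtained by
  measurable selection from the basic open sets of the strong operator topology.

  For the counterexample, attach to a graph on \<open>\<nat>\<close> the Banach space with norm
  \<open>\<parallel>v\<parallel> = sup (\<Sum>t\<in>C. \<bar>v t\<bar>)\<close>, where \<open>C\<close> ranges over the finite cliques. For a tree \<open>T\<close> take as vertices
  the elements of the inverse system of the \<open>\<int>/2\<close>-vector spaces spanned by the levels of \<open>T\<close>, and
  join two vertices if one is the image of the other. The elements \<open>0\<close> of all levels form an
  infinite clique that contains the vertex \<open>0\<close> of level \<open>0\<close>, whereas an infinite clique through the
  other vertex of level \<open>0\<close> yields an infinite branch of \<open>T\<close>. Translation by a branch is an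
  automorphism of the graph that exchanges these two vertices. Conversely, an isometry that
  approximately exchanges them maps the copy of \<open>\<ell>\<^sup>1\<close> on the first clique in such a way that there is
  an infinite clique through the second vertex. With dense Borel sections, the set of trees with
  an infinite branch would therefore be Borel.
\<close>

section \<open>Souslin schemes\<close>

text \<open>An isometry of a clique space need not come from an automorphism of the graph, and dense
  sections only approximate a given isometry. The counterexample therefore needs a conclusion that
  survives both and is drawn from the norm alone: an approximate exchange of two unit vectors
  already forces an infinite clique. A bound \<open>< 1 / 10\<close> on a distance is open in the
  strong operator topology, so it cannot tell a dense sequence from the whole group; the constant
  only has to be small enough for the mass estimates. A branch of a tree need not give a symmetry of
  the tree. In the linearised levels over Z/2 it is a coherent sequence of vectors, and these act by
  translations. The base is the Baire space, and the tree of \<open>x\<close> searches for a witness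
  that \<open>x\<close> lies in the analytic set with code \<open>x\<close>: a diagonal argument
  then yields the non-Borel set directly. In the positive part the obstacle is that a Borel
  structure on operators is given only through the evaluation map; it is Lusin's theorem that makes
  countably many evaluations generate it.\<close>

abbreviation agree :: "nat \<Rightarrow> (nat \<Rightarrow> nat) \<Rightarrow> (nat \<Rightarrow> nat) \<Rightarrow> bool" where
  "agree n z w \<equiv> \<forall>i<n. w i = z i"

definition baire_closed :: "(nat \<Rightarrow> nat) set \<Rightarrow> bool" where
  "baire_closed F \<longleftrightarrow> (\<forall>z. (\<forall>n. \<exists>w\<in>F. agree n z w) \<longrightarrow> z \<in> F)"

definition baire_cont :: "'a topology \<Rightarrow> (nat \<Rightarrow> nat) set \<Rightarrow> ((nat \<Rightarrow> nat) \<Rightarrow> 'a) \<Rightarrow> bool" where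
  "baire_cont T F g \<longleftrightarrow>
    (\<forall>U. openin T U \<longrightarrow> (\<forall>z\<in>F. g z \<in> U \<longrightarrow> (\<exists>n. \<forall>w\<in>F. agree n z w \<longrightarrow> g w \<in> U)))"

text \<open>These are the analytic sets. Codes range over a closed set of the Baire space instead of
  all of it, so that the empty set is covered and sums and fibre products of codings are again
  codings.\<close>

definition souslin :: "'a topology \<Rightarrow> 'a set \<Rightarrow> bool" where
  "souslin T S \<longleftrightarrow> S \<subseteq> topspace T \<and> (\<exists>F g. baire_closed F \<and> baire_cont T F g \<and> g ` F = S)"

lemma baire_contD:
  "baire_cont T F g \<Longrightarrow> openin T U \<Longrightarrow> z \<in> F \<Longrightarrow> g z \<in> U \<Longrightarrow>
    \<exists>n. \<forall>w\<in>F. agree n z w \<longrightarrow> g w \<in> U"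
  unfolding baire_cont_def by simp

lemma baire_closedD: "baire_closed F \<Longrightarrow> (\<And>n. \<exists>w\<in>F. agree n z w) \<Longrightarrow> z \<in> F"
  unfolding baire_closed_def by simp

text \<open>The columns identify the Baire space with its countable power; one point thus carries
  countably many codes at once.\<close>

definition col :: "(nat \<Rightarrow> nat) \<Rightarrow> nat \<Rightarrow> nat \<Rightarrow> nat" where
  "col z m = (\<lambda>i. z (prod_encode (m, i)))"

text \<open>The first \<open>n\<close> entries of a column sit at finitely many positions of the
  whole sequence: taking columns is continuous.\<close>

lemma agree_col: "\<exists>N. \<forall>z w. agree N z w \<longrightarrow> agree n (col z m) (col w m)"
proof -
  have "finite ((\<lambda>i. prod_encode (m, i)) ` {..<n})" by auto
  then obtain N where "\<forall>k\<in>(\<lambda>i. prod_encode (m, i)) ` {..<n}. k < N"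
    using finite_nat_set_iff_bounded by blast
  then show ?thesis by (intro exI[of _ N]) (auto simp: col_def)
qed

lemma col_surj: "\<exists>z. \<forall>m. col z m = y m"
  by (rule exI[of _ "\<lambda>k. case prod_decode k of (m, i) \<Rightarrow> y m i"]) (auto simp: col_def)

definition shift :: "(nat \<Rightarrow> nat) \<Rightarrow> nat \<Rightarrow> nat" where
  "shift z = (\<lambda>i. z (Suc i))"

lemma agree_shift: "agree (Suc n) z w \<Longrightarrow> w 0 = z 0 \<and> agree n (shift z) (shift w)"
  by (auto simp: shift_def)

lemma shift_case_nat [simp]: "shift (case_nat a z) = z"
  by (auto simp: shift_def)

text \<open>The disjoint sum of the \<open>F n\<close>: the entry \<open>z 0\<close> names the
  summand and the rest of \<open>z\<close> is a code in it. The name stays readable from the code,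
  which later decides membership in Borel sets.\<close>

lemma baire_sum:
  fixes F :: "nat \<Rightarrow> (nat \<Rightarrow> nat) set"
  assumes cl: "\<And>n. baire_closed (F n)" and ct: "\<And>n. baire_cont T (F n) (g n)"
  defines "F' \<equiv> {z. shift z \<in> F (z 0)}" and "g' \<equiv> \<lambda>z. g (z 0) (shift z)"
  shows "baire_closed F'" "baire_cont T F' g'" "g' ` {z\<in>F'. P (z 0)} = (\<Union>n\<in>Collect P. g n ` F n)"
proof -
  show "baire_closed F'"
    unfolding baire_closed_def
  proof safe
    fix z assume z: "\<forall>n. \<exists>w\<in>F'. agree n z w"
    have "\<exists>w\<in>F (z 0). agree n (shift z) w" for n
    proof -
      obtain w where "w \<in> F'" "agree (Suc n) z w" using z by blast
      then show ?thesis using agree_shift[of n z w]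
        unfolding F'_def by (metis (no_types, lifting) mem_Collect_eq)
    qed
    then show "z \<in> F'" using baire_closedD[OF cl] unfolding F'_def by blast
  qed
  show "baire_cont T F' g'"
    unfolding baire_cont_def
  proof safe
    fix U z assume U: "openin T U" and z: "z \<in> F'" "g' z \<in> U"
    then have zU: "shift z \<in> F (z 0)" "g (z 0) (shift z) \<in> U" by (auto simp: F'_def g'_def)
    from baire_contD[OF ct[of "z 0"] U, OF zU(1), OF zU(2)]
    obtain n where n: "\<forall>w\<in>F (z 0). agree n (shift z) w \<longrightarrow> g (z 0) w \<in> U" ..
    have "g' w \<in> U" if w: "w \<in> F'" "agree (Suc n) z w" for w
    proof -
      have 0: "w 0 = z 0" and "agree n (shift z) (shift w)" using agree_shift[OF w(2)] by auto
      moreover have "shift w \<in> F (z 0)" using w(1) unfolding F'_def by (simp add: 0)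
      ultimately show ?thesis unfolding g'_def 0 using n by blast
    qed
    then show "\<exists>n. \<forall>w\<in>F'. agree n z w \<longrightarrow> g' w \<in> U" by blast
  qed
  show "g' ` {z\<in>F'. P (z 0)} = (\<Union>n\<in>Collect P. g n ` F n)"
  proof safe
    fix z assume "z \<in> F'" "P (z 0)"
    then show "g' z \<in> (\<Union>n\<in>Collect P. g n ` F n)" unfolding F'_def g'_def by auto
  next
    fix n z assume "P n" "z \<in> F n"
    then show "g n z \<in> g' ` {z\<in>F'. P (z 0)}"
      by (intro image_eqI[of _ _ "case_nat n z"]) (auto simp: F'_def g'_def)
  qed
qed

lemma souslin_Union:
  assumes "\<And>n::nat. souslin T (S n)"
  shows "souslin T (\<Union>n. S n)"
proof -
  have "\<forall>n. \<exists>F g. baire_closed F \<and> baire_cont T F g \<and> g ` F = S n" "\<And>n. S n \<subseteq> topspace T"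
    using assms unfolding souslin_def by blast+
  then obtain F g where Fg: "\<And>n. baire_closed (F n)" "\<And>n. baire_cont T (F n) (g n)"
      "\<And>n. g n ` F n = S n"
    by metis
  show ?thesis
    unfolding souslin_def
    using baire_sum(1,2)[of F T g] baire_sum(3)[of F T g "\<lambda>_. True"] Fg \<open>\<And>n. S n \<subseteq> topspace T\<close>
    by (intro conjI UN_least exI[of _ "{z. shift z \<in> F (z 0)}"] exI[of _ "\<lambda>z. g (z 0) (shift z)"]) auto
qed

text \<open>All columns of a code are codes of one and the same point. This condition is closed
  because distinct points of a Hausdorff space have disjoint neighbourhoods, and finitely many
  entries keep the values in them.\<close>

lemma baire_fibre_product:
  fixes F :: "nat \<Rightarrow> (nat \<Rightarrow> nat) set"
  assumes T: "Hausdorff_space T" and cl: "\<And>n. baire_closed (F n)"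
    and ct: "\<And>n. baire_cont T (F n) (g n)" and top: "\<And>n. g n ` F n \<subseteq> topspace T"
  defines "F' \<equiv> {z. \<forall>n. col z n \<in> F n \<and> g n (col z n) = g 0 (col z 0)}"
    and "g' \<equiv> \<lambda>z. g 0 (col z 0)"
  shows "baire_closed F'" "baire_cont T F' g'" "g' ` F' = (\<Inter>n. g n ` F n)"
proof -
  show "baire_closed F'"
    unfolding baire_closed_def
  proof safe
    fix z assume z: "\<forall>n. \<exists>w\<in>F'. agree n z w"
    have F: "col z m \<in> F m" for m
    proof -
      have "\<exists>w\<in>F m. agree n (col z m) w" for n
      proof -
        obtain N where N: "\<And>z w. agree N z w \<longrightarrow> agree n (col z m) (col w m)"
          using agree_col[of n m] by blast
        obtain w where "w \<in> F'" "agree N z w" using z by blast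
        then have "col w m \<in> F m" unfolding F'_def by simp
        with N \<open>agree N z w\<close> show ?thesis by blast
      qed
      then show ?thesis by (rule baire_closedD[OF cl])
    qed
    have "g m (col z m) = g 0 (col z 0)" for m
    proof (rule ccontr)
      assume "g m (col z m) \<noteq> g 0 (col z 0)"
      moreover have "g m (col z m) \<in> topspace T" "g 0 (col z 0) \<in> topspace T"
        using F[of m] F[of 0] top[of m] top[of 0] by auto
      ultimately have "\<exists>U V. openin T U \<and> openin T V \<and> g m (col z m) \<in> U \<and> g 0 (col z 0) \<in> V \<and> disjnt U V"
        using T unfolding Hausdorff_space_def by simp
      then obtain U V where UV: "openin T U" "openin T V" "g m (col z m) \<in> U"
          "g 0 (col z 0) \<in> V" "disjnt U V"
        by (elim exE conjE)
      from baire_contD[OF ct[of m] UV(1), OF F[of m], OF UV(3)]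
      obtain n1 where n1: "\<forall>w\<in>F m. agree n1 (col z m) w \<longrightarrow> g m w \<in> U" ..
      from baire_contD[OF ct[of 0] UV(2), OF F[of 0], OF UV(4)]
      obtain n2 where n2: "\<forall>w\<in>F 0. agree n2 (col z 0) w \<longrightarrow> g 0 w \<in> V" ..
      obtain N1 where N1: "\<And>z w. agree N1 z w \<Longrightarrow> agree n1 (col z m) (col w m)"
        using agree_col[of n1 m] by blast
      obtain N2 where N2: "\<And>z w. agree N2 z w \<Longrightarrow> agree n2 (col z 0) (col w 0)"
        using agree_col[of n2 0] by blast
      \<comment> \<open>The common initial segment is long enough for both columns, so the one value
        that \<open>w\<close> codes would lie in two disjoint open sets.\<close>
      obtain w where w: "w \<in> F'" "agree (max N1 N2) z w" using z by blast
      have "agree n1 (col z m) (col w m)" "agree n2 (col z 0) (col w 0)"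
        using N1[of z w] N2[of z w] w(2) by auto
      moreover have "col w m \<in> F m" "col w 0 \<in> F 0" using w(1) unfolding F'_def by auto
      ultimately have "g m (col w m) \<in> U" "g 0 (col w 0) \<in> V"
        using n1 n2 by blast+
      moreover have "g m (col w m) = g 0 (col w 0)" using w(1) unfolding F'_def by simp
      ultimately show False using UV(5) unfolding disjnt_def by auto
    qed
    then show "z \<in> F'" unfolding F'_def using F by simp
  qed
  show "baire_cont T F' g'"
    unfolding baire_cont_def
  proof safe
    fix U z assume U: "openin T U" and z: "z \<in> F'" "g' z \<in> U"
    then have zU: "col z 0 \<in> F 0" "g 0 (col z 0) \<in> U" by (auto simp: F'_def g'_def)
    from baire_contD[OF ct[of 0] U, OF zU(1), OF zU(2)]
    obtain n where n: "\<forall>w\<in>F 0. agree n (col z 0) w \<longrightarrow> g 0 w \<in> U" ..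
    obtain N where N: "\<And>z w. agree N z w \<Longrightarrow> agree n (col z 0) (col w 0)"
      using agree_col[of n 0] by blast
    have "g' w \<in> U" if "w \<in> F'" "agree N z w" for w
      unfolding g'_def by (rule n[rule_format]) (use that N in \<open>auto simp: F'_def\<close>)
    then show "\<exists>n. \<forall>w\<in>F'. agree n z w \<longrightarrow> g' w \<in> U" by blast
  qed
  show "g' ` F' = (\<Inter>n. g n ` F n)"
  proof safe
    fix z n assume "z \<in> F'"
    then show "g' z \<in> g n ` F n" unfolding F'_def g'_def by (metis (mono_tags, lifting) image_eqI mem_Collect_eq)
  next
    fix y assume y: "y \<in> (\<Inter>n. g n ` F n)"
    then have "\<forall>n. \<exists>z. z \<in> F n \<and> y = g n z" by blast
    then obtain zs where zs: "\<And>n. zs n \<in> F n" "\<And>n. y = g n (zs n)" by metis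
    obtain z where "\<forall>m. col z m = zs m" using col_surj by blast
    then show "y \<in> g' ` F'"
      using zs by (intro image_eqI[of _ _ z]) (auto simp: F'_def g'_def)
  qed
qed

lemma souslin_Inter:
  assumes T: "Hausdorff_space T" and "\<And>n::nat. souslin T (S n)"
  shows "souslin T (\<Inter>n. S n)"
proof -
  have "\<forall>n. \<exists>F g. baire_closed F \<and> baire_cont T F g \<and> g ` F = S n" and top: "\<And>n. S n \<subseteq> topspace T"
    using assms(2) unfolding souslin_def by blast+
  then obtain F g where Fg: "\<And>n. baire_closed (F n)" "\<And>n. baire_cont T (F n) (g n)"
      "\<And>n. g n ` F n = S n"
    by metis
  let ?F = "{z. \<forall>n. col z n \<in> F n \<and> g n (col z n) = g 0 (col z 0)}"
  let ?g = "\<lambda>z. g 0 (col z 0)"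
  have "baire_closed ?F" "baire_cont T ?F ?g" "?g ` ?F = (\<Inter>n. g n ` F n)"
    by (intro baire_fibre_product T Fg; use Fg(3) top in auto)+
  then have "\<exists>F g. baire_closed F \<and> baire_cont T F g \<and> g ` F = (\<Inter>n. S n)" using Fg(3) by (intro exI[of _ ?F] exI[of _ ?g]) auto
  then show ?thesis unfolding souslin_def using top by blast
qed

text \<open>Points are coded by fast Cauchy sequences from a countable dense set.\<close>

lemma souslin_closedin:
  assumes T: "polish_space_on T" and S: "closedin T S"
  shows "souslin T S"
proof (cases "topspace T = {}")
  case True
  then have "S = {}" using closedin_subset[OF S] by auto
  then show ?thesis
    unfolding souslin_def by (intro conjI exI[of _ "{}"]) (auto simp: baire_closed_def baire_cont_def)
next
  case False
  obtain M d where Md: "Metric_space M d" "Metric_space.mcomplete M d" "T = Metric_space.mtopology M d"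
    using T unfolding polish_space_on_def completely_metrizable_space_def by blast
  interpret Metric_space M d by fact
  obtain C where C: "countable C" "C \<subseteq> M" "mtopology closure_of C = M"
    using T unfolding polish_space_on_def separable_space_def Md(3) by auto
  have "C \<noteq> {}" using C(3) False by (auto simp: Md(3))
  define q where "q = from_nat_into C"
  have q: "range q = C" unfolding q_def using range_from_nat_into[OF \<open>C \<noteq> {}\<close> C(1)] .
  then have qM [simp]: "q n \<in> M" for n using C by auto
  have dense: "\<exists>n. d (q n) x < e" if "x \<in> M" "e > 0" for x e
  proof -
    have "x \<in> mtopology closure_of C" using C that by auto
    then obtain y where "y \<in> C" "y \<in> mball x e" using \<open>e > 0\<close> unfolding metric_closure_of by blast
    then show ?thesis using q by (metis in_mball commute rangeE)
  qed
  \<comment> \<open>Each inequality involves two entries only, so the fast Cauchy codes form a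
    closed set.\<close>
  define F0 where "F0 = {z::nat\<Rightarrow>nat. \<forall>n. d (q (z n)) (q (z (Suc n))) \<le> (1/2)^n}"
  \<comment> \<open>The tail of the geometric series bounds the distance to the limit. The rate is
    the same for all codes, which makes the limit a continuous function of the code.\<close>
  define L where "L z = (SOME l. l \<in> M \<and> (\<forall>n. d (q (z n)) l \<le> 2 * (1/2)^n))" for z
  have L: "L z \<in> M" "d (q (z n)) (L z) \<le> 2 * (1/2)^n" if z: "z \<in> F0" for z n
  proof -
    \<comment> \<open>Partial sums of the geometric series; the subtracted remainder is what makes
      the induction go through.\<close>
    have step: "d (q (z n)) (q (z (n + k))) \<le> 2 * (1/2)^n - 2 * (1/2)^(n+k)" for n k
    proof (induction k)
      case (Suc k)
      have "d (q (z n)) (q (z (n + Suc k))) \<le> d (q (z n)) (q (z (n + k))) + d (q (z (n+k))) (q (z (n + Suc k)))"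
        by (rule triangle) auto
      also have "\<dots> \<le> (2 * (1/2)^n - 2 * (1/2)^(n+k)) + (1/2)^(n+k)"
        using z Suc unfolding F0_def by (intro add_mono) auto
      finally show ?case by simp
    qed auto
    have step2: "d (q (z n)) (q (z m)) \<le> 2 * (1/2)^n" if "n \<le> m" for n m
      using step[of n "m - n"] that by (smt (verit) le_add_diff_inverse zero_le_power divide_nonneg_nonneg)
    have "MCauchy (\<lambda>n. q (z n))"
      unfolding MCauchy_def
    proof safe
      fix e :: real assume "e > 0"
      then obtain N where N: "(1/2)^N < e / 2"
        using real_arch_pow_inv[of "e/2" "1/2"] by auto
      have "d (q (z n)) (q (z m)) < e" if "N \<le> n" "N \<le> m" for n m
      proof (cases "n \<le> m")
        case True
        have "(1/2::real)^n \<le> (1/2)^N" using that by (intro power_decreasing) auto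
        then show ?thesis using step2[OF True] N by linarith
      next
        case False
        have "(1/2::real)^m \<le> (1/2)^N" using that by (intro power_decreasing) auto
        then show ?thesis using step2[of m n] False N commute[of "q (z n)" "q (z m)"] by linarith
      qed
      then show "\<exists>N. \<forall>n n'. N \<le> n \<longrightarrow> N \<le> n' \<longrightarrow> d (q (z n)) (q (z n')) < e" by blast
    qed auto
    then obtain l where l: "limitin mtopology (\<lambda>n. q (z n)) l sequentially"
      using Md(2) unfolding mcomplete_def by blast
    then have lM: "l \<in> M" by (simp add: limitin_mspace)
    have "d (q (z n)) l \<le> 2 * (1/2)^n" for n
    proof (rule field_le_epsilon)
      fix e :: real assume "e > 0"
      then have "\<forall>\<^sub>F m in sequentially. d (q (z m)) l < e"
        using l unfolding limit_metric_sequentially eventually_sequentially by blast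
      then obtain m where m: "m \<ge> n" "d (q (z m)) l < e"
        unfolding eventually_sequentially by (meson nle_le)
      have "d (q (z n)) l \<le> d (q (z n)) (q (z m)) + d (q (z m)) l"
        using lM by (intro triangle) auto
      then show "d (q (z n)) l \<le> 2 * (1/2)^n + e" using step2[OF m(1)] m(2) by linarith
    qed
    with lM have "l \<in> M \<and> (\<forall>n. d (q (z n)) l \<le> 2 * (1/2)^n)" by blast
    from someI[of "\<lambda>l. l \<in> M \<and> (\<forall>n. d (q (z n)) l \<le> 2 * (1/2)^n)", OF this] show "L z \<in> M" "d (q (z n)) (L z) \<le> 2 * (1/2)^n"
      unfolding L_def by blast+
  qed
  have Ld: "\<exists>n. \<forall>w\<in>F0. agree n z w \<longrightarrow> d (L z) (L w) < e" if z: "z \<in> F0" and "e > 0" for z e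
  proof -
    obtain n where n: "(1/2)^n < e / 4"
      using real_arch_pow_inv[of "e/4" "1/2"] \<open>e > 0\<close> by auto
    have "d (L z) (L w) < e" if w: "w \<in> F0" "agree (Suc n) z w" for w
    proof -
      have "d (L z) (L w) \<le> d (L z) (q (z n)) + d (q (z n)) (L w)"
        using L(1) w z by (intro triangle) auto
      also have "\<dots> \<le> 2 * (1/2)^n + 2 * (1/2)^n"
        using L(2)[OF z, of n] L(2)[OF w(1), of n] w(2) by (auto simp: commute)
      finally show ?thesis using n by linarith
    qed
    then show ?thesis by blast
  qed
  define F where "F = {z\<in>F0. L z \<in> S}"
  have F0cl: "z \<in> F0" if z: "\<forall>n. \<exists>w\<in>F0. agree n z w" for z
    unfolding F0_def
  proof safe
    fix n
    obtain w where "w \<in> F0" "agree (n+2) z w" using z by blast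
    moreover from this have "w n = z n" "w (Suc n) = z (Suc n)" by simp_all
    ultimately show "d (q (z n)) (q (z (Suc n))) \<le> (1/2)^n" unfolding F0_def by (metis (mono_tags, lifting) mem_Collect_eq)
  qed
  have "baire_closed F"
    unfolding baire_closed_def
  proof safe
    fix z assume z: "\<forall>n. \<exists>w\<in>F. agree n z w"
    have z0: "z \<in> F0"
    proof (rule F0cl, rule allI)
      fix n
      obtain w where "w \<in> F" "agree n z w" using z by blast
      then show "\<exists>w\<in>F0. agree n z w" unfolding F_def by (intro bexI[of _ w]) auto
    qed
    have "L z \<in> S"
    proof (rule ccontr)
      assume "L z \<notin> S"
      then have "L z \<in> topspace mtopology - S" using L(1) z0 by auto
      moreover have "openin mtopology (topspace mtopology - S)" using S unfolding Md(3) closedin_def by auto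
      ultimately obtain r where r: "r > 0" "mball (L z) r \<subseteq> topspace mtopology - S"
        by (meson openin_mtopology)
      obtain n where n: "\<forall>w\<in>F0. agree n z w \<longrightarrow> d (L z) (L w) < r" using Ld[OF z0 r(1)] by blast
      obtain w where "w \<in> F" "agree n z w" using z by blast
      then have "L w \<in> S" "d (L z) (L w) < r" using n unfolding F_def by blast+
      moreover have "L w \<in> M" using L(1) \<open>w \<in> F\<close> unfolding F_def by blast
      ultimately show False using r(2) L(1)[OF z0] by (auto simp: subset_iff)
    qed
    then show "z \<in> F" using z0 unfolding F_def by blast
  qed
  moreover have "baire_cont T F L"
    unfolding baire_cont_def
  proof safe
    fix U z assume U: "openin T U" and z: "z \<in> F" "L z \<in> U"
    obtain r where r: "r > 0" "mball (L z) r \<subseteq> U" using U z unfolding Md(3) by (meson openin_mtopology)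
    obtain n where n: "\<forall>w\<in>F0. agree n z w \<longrightarrow> d (L z) (L w) < r" using Ld[OF _ r(1), of z] z unfolding F_def by blast
    have "\<forall>w\<in>F. agree n z w \<longrightarrow> L w \<in> U"
      using n r L(1) z unfolding F_def by auto
    then show "\<exists>n. \<forall>w\<in>F. agree n z w \<longrightarrow> L w \<in> U" by blast
  qed
  moreover have "L ` F = S"
  proof safe
    fix s assume s: "s \<in> S"
    then have sM: "s \<in> M" using closedin_subset[OF S] by (auto simp: Md(3))
    \<comment> \<open>Half of the allowed distance: two consecutive approximations of
      \<open>s\<close> are then within \<open>(1/2)^n\<close> of each other.\<close>
    have "\<forall>n. \<exists>k. d (q k) s < (1/2)^n / 2"
      by (intro allI dense sM) auto
    then obtain z where z: "\<And>n. d (q (z n)) s < (1/2)^n / 2" by metis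
    have "d (q (z n)) (q (z (Suc n))) \<le> (1/2)^n" for n
    proof -
      have "d (q (z n)) (q (z (Suc n))) \<le> d (q (z n)) s + d s (q (z (Suc n)))"
        using sM by (intro triangle) auto
      also have "\<dots> \<le> (1/2)^n / 2 + (1/2)^(Suc n)/2"
        using z[of n] z[of "Suc n"] by (intro add_mono) (auto simp: commute less_imp_le)
      also have "\<dots> \<le> (1/2)^n" by auto
      finally show ?thesis .
    qed
    then have zF0: "z \<in> F0" unfolding F0_def by auto
    have "d (L z) s \<le> 0"
    proof (rule field_le_epsilon)
      fix e :: real assume "e > 0"
      then obtain n where n: "(1/2)^n < e / 4" using real_arch_pow_inv[of "e/4" "1/2"] by auto
      have "d (L z) s \<le> d (L z) (q (z n)) + d (q (z n)) s"
        using L(1)[OF zF0] sM by (intro triangle) auto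
      also have "\<dots> \<le> 2 * (1/2)^n + (1/2)^n/2"
        using L(2)[OF zF0, of n] z[of n] by (auto simp: commute)
      finally show "d (L z) s \<le> 0 + e" using n \<open>e > 0\<close> by linarith
    qed
    then have "L z = s" using L(1)[OF zF0] sM nonneg[of "L z" s] zero[of "L z" s] by linarith
    then show "s \<in> L ` F" using zF0 s unfolding F_def by auto
  qed (auto simp: F_def)
  ultimately show ?thesis unfolding souslin_def using closedin_subset[OF S] by blast
qed

lemma polish_metrizable: "polish_space_on T \<Longrightarrow> metrizable_space T"
  unfolding polish_space_on_def by (simp add: completely_metrizable_imp_metrizable_space)

lemma souslin_openin:
  assumes T: "polish_space_on T" and S: "openin T S"
  shows "souslin T S"
proof -
  have "fsigma_in T S" using polish_metrizable[OF T] S by (rule open_imp_fsigma_in)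
  then obtain C :: "nat \<Rightarrow> _" where "\<And>n. closedin T (C n)" "\<Union>(range C) = S"
    unfolding fsigma_in_ascending by blast
  then show ?thesis using souslin_Union[of T C] souslin_closedin[OF T] by auto
qed

section \<open>Borel sets of Polish spaces are analytic\<close>

lemma space_borel_sigma [simp]: "space (borel_sigma T) = topspace T"
  unfolding borel_sigma_def by (rule space_measure_of) (auto dest: openin_subset)

lemma sets_borel_sigma: "sets (borel_sigma T) = sigma_sets (topspace T) {U. openin T U}"
  unfolding borel_sigma_def by (rule sets_measure_of) (auto dest: openin_subset)

lemma borel_sigma_openin: "openin T U \<Longrightarrow> U \<in> sets (borel_sigma T)"
  unfolding sets_borel_sigma by auto

lemma souslin_borel:
  assumes T: "polish_space_on T" and S: "S \<in> sets (borel_sigma T)"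
  shows "souslin T S"
proof -
  have H: "Hausdorff_space T"
    using polish_metrizable[OF T] metrizable_imp_Hausdorff_space by blast
  \<comment> \<open>Analytic sets are not closed under complements, so the induction over the
    \<sigma>-algebra carries each set together with its complement.\<close>
  have "souslin T S \<and> souslin T (topspace T - S)"
    using S unfolding sets_borel_sigma
  proof (induction rule: sigma_sets.induct)
    case (Basic U)
    then show ?case using souslin_openin[OF T] souslin_closedin[OF T]
      by (simp add: openin_closedin_eq)
  next
    case Empty
    then show ?case using souslin_closedin[OF T] by auto
  next
    case (Compl U)
    have "souslin T (topspace T - (topspace T - U))"
      using Compl by (metis Diff_Diff_Int inf_absorb2 souslin_def)
    then show ?case using Compl by auto
  next
    case (Union U)
    have "topspace T - (\<Union>n. U n) = (\<Inter>n. topspace T - U n)" by auto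
    then show ?case using souslin_Union[of T U] souslin_Inter[OF H, of "\<lambda>n. topspace T - U n"] Union by simp
  qed
  then show ?thesis ..
qed

section \<open>Standard Borel spaces\<close>

lemma standard_borel_cong:
  assumes "sets M = sets N"
  shows "standard_borel M \<longleftrightarrow> standard_borel N"
  unfolding standard_borel_def
  by (simp add: measurable_cong_sets[OF assms refl] measurable_cong_sets[OF refl assms] sets_eq_imp_space_eq[OF assms])

text \<open>The trace \<open>C\<close> of \<open>B\<close> in the Polish space behind
  \<open>M\<close> is Borel, and the two isomorphisms compose to one between \<open>N\<close> and
  \<open>C\<close>.\<close>

lemma standard_borel_pullback:
  assumes M: "standard_borel M" and B: "B \<in> sets M"
    and f: "f \<in> N \<rightarrow>\<^sub>M restrict_space M B" and g: "g \<in> restrict_space M B \<rightarrow>\<^sub>M N"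
    and gf: "\<And>a. a \<in> space N \<Longrightarrow> g (f a) = a" and fg: "\<And>b. b \<in> B \<Longrightarrow> f (g b) = b"
  shows "standard_borel N"
proof -
  obtain T :: "real topology" and B' f' g' where *: "polish_space_on T" "B' \<in> sets (borel_sigma T)"
      "f' \<in> M \<rightarrow>\<^sub>M restrict_space (borel_sigma T) B'" "g' \<in> restrict_space (borel_sigma T) B' \<rightarrow>\<^sub>M M"
      "\<And>a. a \<in> space M \<Longrightarrow> g' (f' a) = a" "\<And>b. b \<in> B' \<Longrightarrow> f' (g' b) = b"
    using M unfolding standard_borel_def by blast
  define C where "C = g' -` B \<inter> B'"
  have spB: "space (restrict_space (borel_sigma T) B') = B'"
    using sets.sets_into_space[OF *(2)] by (auto simp: space_restrict_space)
  have C: "C \<in> sets (borel_sigma T)"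
  proof -
    have "g' -` B \<inter> space (restrict_space (borel_sigma T) B') \<in> sets (restrict_space (borel_sigma T) B')"
      by (rule measurable_sets[OF *(4) B])
    then show ?thesis unfolding C_def spB
      using *(2) sets.sets_into_space[OF *(2)] by (subst (asm) sets_restrict_space_iff) (auto simp: Int_absorb2)
  qed
  have spC: "space (restrict_space (borel_sigma T) C) = C"
    using sets.sets_into_space[OF C] by (auto simp: space_restrict_space)
  have BM: "B \<subseteq> space M" using sets.sets_into_space[OF B] .
  have fB: "f a \<in> B" if "a \<in> space N" for a
    using measurable_space[OF f that] BM by (auto simp: space_restrict_space)
  have f'B: "f' b \<in> B'" if "b \<in> space M" for b
    using measurable_space[OF *(3) that] spB by auto
  have fM: "f \<in> N \<rightarrow>\<^sub>M M" using f measurable_restrict_space2_iff by blast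
  have f'T: "f' \<in> M \<rightarrow>\<^sub>M borel_sigma T" using *(3) measurable_restrict_space2_iff by blast
  have 1: "(\<lambda>a. f' (f a)) \<in> N \<rightarrow>\<^sub>M restrict_space (borel_sigma T) C"
  proof (rule measurable_restrict_space2)
    show "(\<lambda>a. f' (f a)) \<in> space N \<rightarrow> C"
      unfolding C_def using fB BM f'B *(5) by (auto simp: subset_iff)
    show "(\<lambda>a. f' (f a)) \<in> N \<rightarrow>\<^sub>M borel_sigma T"
      by (rule measurable_compose[OF fM f'T])
  qed
  have 2: "(\<lambda>c. g (g' c)) \<in> restrict_space (borel_sigma T) C \<rightarrow>\<^sub>M N"
  proof (rule measurable_compose[OF _ g])
    have "g' \<in> restrict_space (borel_sigma T) C \<rightarrow>\<^sub>M M"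
      by (rule measurable_restrict_mono[OF *(4)]) (auto simp: C_def)
    then show "g' \<in> restrict_space (borel_sigma T) C \<rightarrow>\<^sub>M restrict_space M B"
      by (rule measurable_restrict_space2[rotated]) (auto simp: spC, auto simp: C_def)
  qed
  have "\<forall>a\<in>space N. g (g' (f' (f a))) = a" using fB BM *(5) gf by (simp add: subset_iff)
  moreover have "\<forall>c\<in>C. f' (f (g (g' c))) = c" using fg *(6) unfolding C_def by auto
  ultimately show ?thesis unfolding standard_borel_def using *(1) C 1 2
    by (intro exI[of _ T] exI[of _ C] exI[of _ "\<lambda>a. f' (f a)"] exI[of _ "\<lambda>c. g (g' c)"]) auto
qed

lemma standard_borel_restrict:
  assumes M: "standard_borel M" and B: "B \<in> sets M"
  shows "standard_borel (restrict_space M B)"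
  by (rule standard_borel_pullback[OF M B, where f="\<lambda>x. x" and g="\<lambda>x. x"]) auto

text \<open>The pulled-back \<sigma>-algebra makes \<open>h\<close> an isomorphism onto its Borel
  image. In the counterexample, B(V) receives its structure from a space of matrices in this
  way.\<close>

lemma standard_borel_vimage:
  assumes M: "standard_borel M" and inj: "inj_on h S" and im: "h ` S \<in> sets M"
  shows "standard_borel (vimage_algebra S h M)"
proof (rule standard_borel_pullback[OF M im, where f=h and g="the_inv_into S h"])
  have hS: "h \<in> S \<rightarrow> space M" using sets.sets_into_space[OF im] by auto
  show "h \<in> vimage_algebra S h M \<rightarrow>\<^sub>M restrict_space M (h ` S)"
    by (rule measurable_restrict_space2) (auto intro: measurable_vimage_algebra1[OF hS])
  have sp: "space (restrict_space M (h ` S)) = h ` S"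
    using sets.sets_into_space[OF im] by (auto simp: space_restrict_space)
  show "the_inv_into S h \<in> restrict_space M (h ` S) \<rightarrow>\<^sub>M vimage_algebra S h M"
  proof (rule measurable_vimage_algebra2)
    show "the_inv_into S h \<in> space (restrict_space M (h ` S)) \<rightarrow> S"
      unfolding sp using the_inv_into_into[OF inj] by auto
    show "(\<lambda>x. h (the_inv_into S h x)) \<in> restrict_space M (h ` S) \<rightarrow>\<^sub>M M"
      by (subst measurable_cong[where g="\<lambda>x. x"])
         (auto simp: sp f_the_inv_into_f[OF inj] intro: measurable_restrict_space1)
  qed
  show "\<And>a. a \<in> space (vimage_algebra S h M) \<Longrightarrow> the_inv_into S h (h a) = a"
    using the_inv_into_f_f[OF inj] by auto
  show "\<And>b. b \<in> h ` S \<Longrightarrow> h (the_inv_into S h b) = b"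
    using f_the_inv_into_f[OF inj] by auto
qed

definition separating :: "'a set \<Rightarrow> (nat \<Rightarrow> 'a set) \<Rightarrow> bool" where
  "separating S C \<longleftrightarrow> (\<forall>x\<in>S. \<forall>y\<in>S. (\<forall>n. x \<in> C n \<longleftrightarrow> y \<in> C n) \<longrightarrow> x = y)"

text \<open>The balls of radius \<open>1 / Suc k\<close> around a countable dense set separate the
  points of a Polish space; their preimages are enumerated by pairs.\<close>

lemma standard_borel_separating:
  assumes "standard_borel M"
  obtains C where "\<And>n. C n \<in> sets M" "separating (space M) C"
proof -
  obtain T :: "real topology" and B f g where *: "polish_space_on T" "B \<in> sets (borel_sigma T)"
      "f \<in> M \<rightarrow>\<^sub>M restrict_space (borel_sigma T) B"
      "\<And>a. a \<in> space M \<Longrightarrow> g (f a) = a"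
    using assms unfolding standard_borel_def by blast
  have fT: "f \<in> M \<rightarrow>\<^sub>M borel_sigma T" using *(3) measurable_restrict_space2_iff by blast
  obtain M' d where Md: "Metric_space M' d" "T = Metric_space.mtopology M' d"
    using *(1) unfolding polish_space_on_def completely_metrizable_space_def by blast
  interpret Metric_space M' d by fact
  obtain Q where Q: "countable Q" "Q \<subseteq> M'" "mtopology closure_of Q = M'"
    using *(1) unfolding polish_space_on_def separable_space_def Md(2) by auto
  define C where "C n = (case prod_decode n of (i, k) \<Rightarrow> f -` mball (from_nat_into Q i) (1 / Suc k) \<inter> space M)" for n
  have "C n \<in> sets M" for n
    unfolding C_def
    by (auto split: prod.split intro!: measurable_sets[OF fT] borel_sigma_openin simp: Md(2))
  moreover have "separating (space M) C"
    unfolding separating_def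
  proof safe
    fix x y assume xy: "x \<in> space M" "y \<in> space M" and eq: "\<forall>n. x \<in> C n \<longleftrightarrow> y \<in> C n"
    have fxy: "f x \<in> M'" "f y \<in> M'" using measurable_space[OF fT] xy by (auto simp: Md(2))
    have "d (f x) (f y) \<le> 0"
    proof (rule field_le_epsilon)
      fix e :: real assume "e > 0"
      then obtain k where k: "1 / Suc k < e / 2"
        by (metis half_gt_zero nat_approx_posE)
      have "f x \<in> mtopology closure_of Q" using fxy Q by auto
      then obtain y' where y': "y' \<in> Q" "y' \<in> mball (f x) (1 / Suc k)"
        unfolding metric_closure_of by (auto dest!: spec[of _ "1 / Suc k"])
      obtain i where i: "y' = from_nat_into Q i" using from_nat_into_surj[OF Q(1) y'(1)] by auto
      have "x \<in> C (prod_encode (i, k))"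
        using y'(2) xy fxy unfolding C_def i by (auto simp: commute)
      then have "y \<in> C (prod_encode (i, k))" using eq by blast
      then have "d (from_nat_into Q i) (f y) < 1 / Suc k" unfolding C_def by auto
      moreover have "d (f x) (from_nat_into Q i) < 1 / Suc k" using y'(2) unfolding i by auto
      moreover have "d (f x) (f y) \<le> d (f x) (from_nat_into Q i) + d (from_nat_into Q i) (f y)"
        using fxy y' i by (intro triangle) auto
      ultimately show "d (f x) (f y) \<le> 0 + e" using k by linarith
    qed
    then have "f x = f y" using fxy nonneg[of "f x" "f y"] zero[of "f x" "f y"] by linarith
    then show "x = y" using *(4) xy by metis
  qed
  ultimately show ?thesis using that by blast
qed

text \<open>Every countable family of Borel sets can be made clopen by a finer Polish topology; here
  the topology is the one of a closed set \<open>F\<close> of the Baire space.\<close>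

lemma standard_borel_scheme:
  assumes M: "standard_borel M" and D: "\<And>n::nat. D n \<in> sets M"
  obtains F g k where "baire_closed F" "g ` F = space M"
    "\<And>z n. z \<in> F \<Longrightarrow> g z \<in> D n \<longleftrightarrow> z (k n) = 0"
proof -
  obtain T :: "real topology" and B f h where *: "polish_space_on T" "B \<in> sets (borel_sigma T)"
      "f \<in> M \<rightarrow>\<^sub>M restrict_space (borel_sigma T) B" "h \<in> restrict_space (borel_sigma T) B \<rightarrow>\<^sub>M M"
      "\<And>a. a \<in> space M \<Longrightarrow> h (f a) = a" "\<And>b. b \<in> B \<Longrightarrow> f (h b) = b"
    using M unfolding standard_borel_def by blast
  have spB: "space (restrict_space (borel_sigma T) B) = B"
    using sets.sets_into_space[OF *(2)] by (auto simp: space_restrict_space)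
  define E where "E n = h -` D n \<inter> B" for n
  have E: "E n \<in> sets (borel_sigma T)" for n
  proof -
    have "h -` D n \<inter> space (restrict_space (borel_sigma T) B) \<in> sets (restrict_space (borel_sigma T) B)"
      by (rule measurable_sets[OF *(4) D])
    then show ?thesis unfolding E_def spB
      using *(2) sets.sets_into_space[OF *(2)] by (subst (asm) sets_restrict_space_iff) (auto simp: Int_absorb2)
  qed
  \<comment> \<open>The piece with index 0 is \<open>E n\<close> and every other piece is its
    complement, so the first entry of a code of the sum decides membership in
    \<open>E n\<close>.\<close>
  define E2 where "E2 n i = (if i = 0 then E n else B - E n)" for n i :: nat
  have S: "\<forall>n i. souslin T (E2 n i)"
    using E *(2) by (auto intro!: souslin_borel[OF *(1)] simp: E2_def)
  have "\<forall>n i. \<exists>F g. baire_closed F \<and> baire_cont T F g \<and> g ` F = E2 n i"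
    using S unfolding souslin_def by simp
  then obtain F where "\<forall>n i. \<exists>g. baire_closed (F n i) \<and> baire_cont T (F n i) g \<and> g ` F n i = E2 n i"
    unfolding choice_iff by auto
  then obtain g where Fg': "\<forall>n i. baire_closed (F n i) \<and> baire_cont T (F n i) (g n i) \<and> g n i ` F n i = E2 n i"
    unfolding choice_iff by auto
  have Fg: "baire_closed (F n i)" "baire_cont T (F n i) (g n i)"
      "g n i ` F n i = (if i = 0 then E n else B - E n)" for n i :: nat
    using Fg'[rule_format, of n i] unfolding E2_def by auto
  define F1 where "F1 n = {z. shift z \<in> F n (z 0)}" for n
  define g1 where "g1 n = (\<lambda>z. g n (z 0) (shift z))" for n
  have F1: "baire_closed (F1 n)" "baire_cont T (F1 n) (g1 n)" for n
    unfolding F1_def g1_def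
    by (rule baire_sum(1)[where T=T and g="g n"] baire_sum(2)[where T=T and g="g n"], rule Fg(1), rule Fg(2))+
  have F1im: "g1 n ` F1 n = (\<Union>i. g n i ` F n i)" for n
    unfolding F1_def g1_def
    using baire_sum(3)[where T=T and g="g n" and F="F n" and P="\<lambda>_. True", OF Fg(1,2)] by auto
  have im: "g1 n ` F1 n = B" for n
  proof -
    have "(\<Union>i. g n i ` F n i) = B"
      unfolding Fg(3) by (auto simp: E_def split: if_splits intro: exI[of _ 0] exI[of _ 1])
    then show ?thesis using F1im by simp
  qed
  have im0: "g1 n z \<in> E n \<longleftrightarrow> z 0 = 0" if "z \<in> F1 n" for n z
  proof -
    have "g1 n z \<in> g n (z 0) ` F n (z 0)" using that unfolding F1_def g1_def by auto
    then show ?thesis unfolding Fg(3) by (auto split: if_splits)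
  qed
  have top: "B \<subseteq> topspace T" using sets.sets_into_space[OF *(2)] by auto
  have H: "Hausdorff_space T"
    using polish_metrizable[OF *(1)] metrizable_imp_Hausdorff_space by blast
  \<comment> \<open>A code in the fibre product describes one point of \<open>B\<close> through all
    these sums at once, with one column for each \<open>n\<close>.\<close>
  define F' where "F' = {z. \<forall>n. col z n \<in> F1 n \<and> g1 n (col z n) = g1 0 (col z 0)}"
  define g' where "g' = (\<lambda>z. g1 0 (col z 0))"
  have F': "baire_closed F'" "g' ` F' = B"
    unfolding F'_def g'_def
    using baire_fibre_product(1,3)[where F=F1 and g=g1, OF H F1(1,2)] top im by auto
  show ?thesis
  \<comment> \<open>Entry 0 of column \<open>n\<close> is the name of the summand,
    \<open>E n\<close> or complement, that contains the point.\<close>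
  proof (rule that[of F' "\<lambda>z. h (g' z)" "\<lambda>n. prod_encode (n, 0)"])
    show "baire_closed F'" by fact
    show "(\<lambda>z. h (g' z)) ` F' = space M"
    proof -
      have "f a \<in> B" if "a \<in> space M" for a using measurable_space[OF *(3) that] spB by auto
      moreover have "h b \<in> space M" if "b \<in> B" for b using measurable_space[OF *(4)] spB that by auto
      ultimately have "h ` B = space M" using *(5) by force
      then show ?thesis using F'(2) by (metis image_image)
    qed
    show "h (g' z) \<in> D n \<longleftrightarrow> z (prod_encode (n, 0)) = 0" if z: "z \<in> F'" for z n
    proof -
      have "g' z \<in> B" using z F'(2) by auto
      then have "h (g' z) \<in> D n \<longleftrightarrow> g' z \<in> E n" unfolding E_def by auto
      moreover have "g' z = g1 n (col z n)"
        using z unfolding F'_def g'_def by (metis (mono_tags, lifting) mem_Collect_eq)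
      moreover have "g1 n (col z n) \<in> E n \<longleftrightarrow> col z n 0 = 0" using z im0 unfolding F'_def by blast
      ultimately show ?thesis unfolding col_def by simp
    qed
  qed
qed

section \<open>Cylinders and branches in the Baire space\<close>

definition cyl :: "nat list \<Rightarrow> (nat \<Rightarrow> nat) set" where
  "cyl u = {z. \<forall>i<length u. z i = u ! i}"

lemma cyl_Nil [simp]: "cyl [] = UNIV"
  by (auto simp: cyl_def)

lemma cyl_Un: "cyl u = (\<Union>j. cyl (u @ [j]))"
  by (auto simp: cyl_def nth_append less_Suc_eq)

lemma cyl_agree: "w \<in> cyl (map z [0..<n]) \<longleftrightarrow> agree n z w"
  by (auto simp: cyl_def)

lemma baire_closed_branch:
  assumes "baire_closed F" "\<And>n. F \<inter> cyl (map z [0..<n]) \<noteq> {}"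
  shows "z \<in> F"
  using assms(2) by (intro baire_closedD[OF assms(1)]) (auto simp flip: cyl_agree)

text \<open>Dependent choice along finite sequences. The extension is a function of the prefix, so
  the chosen prefixes cohere to one infinite sequence.\<close>

lemma ex_branch:
  assumes "P []" "\<And>u. P u \<Longrightarrow> \<exists>j. P (u @ [j])"
  shows "\<exists>z::nat\<Rightarrow>'a. \<forall>n. P (map z [0..<n])"
proof -
  define pre where "pre = rec_nat [] (\<lambda>_ u. u @ [SOME j. P (u @ [j])])"
  have pre: "pre 0 = []" "pre (Suc n) = pre n @ [SOME j. P (pre n @ [j])]" for n
    by (auto simp: pre_def)
  have P: "P (pre n)" for n
    by (induction n) (auto simp: pre assms intro: someI_ex assms(2))
  define z where "z n = (SOME j. P (pre n @ [j]))" for n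
  have "map z [0..<n] = pre n" for n
    by (induction n) (auto simp: pre z_def)
  then show ?thesis using P by (intro exI[of _ z]) simp
qed

section \<open>Separation\<close>

text \<open>Lusin's separation argument: if no set of \<open>A\<close> separates the two images, then this persists
  along a pair of branches, at whose ends some \<open>C n\<close> separates.\<close>

lemma souslin_separation:
  fixes F G :: "(nat \<Rightarrow> nat) set"
  assumes A: "sigma_algebra S A" and C: "\<And>n::nat. C n \<in> A"
    and F: "baire_closed F" and G: "baire_closed G" and gF: "g ` F \<subseteq> S" and hG: "h ` G \<subseteq> S"
    and g: "\<And>z n. z \<in> F \<Longrightarrow> g z \<in> C n \<longleftrightarrow> z (k n) = 0"
    and h: "\<And>z n. z \<in> G \<Longrightarrow> h z \<in> C n \<longleftrightarrow> z (l n) = 0"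
    and sep: "\<And>z w. z \<in> F \<Longrightarrow> w \<in> G \<Longrightarrow> \<exists>n. \<not> (g z \<in> C n \<longleftrightarrow> h w \<in> C n)"
  shows "\<exists>B\<in>A. g ` F \<subseteq> B \<and> h ` G \<inter> B = {}"
proof (rule ccontr)
  interpret sigma_algebra S A by fact
  define ok where "ok u v \<longleftrightarrow> (\<exists>B\<in>A. g ` (F \<inter> cyl u) \<subseteq> B \<and> h ` (G \<inter> cyl v) \<inter> B = {})" for u v
  assume "\<not> ?thesis"
  then have 0: "\<not> ok [] []" by (simp add: ok_def)
  have step: "\<exists>i j. \<not> ok (u @ [i]) (v @ [j])" if "\<not> ok u v" for u v
  proof (rule ccontr)
    assume "\<not> ?thesis"
    then have all_ok: "ok (u @ [i]) (v @ [j])" for i j by simp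
    have "\<forall>ij. \<exists>B. B \<in> A \<and> g ` (F \<inter> cyl (u @ [fst ij])) \<subseteq> B \<and> h ` (G \<inter> cyl (v @ [snd ij])) \<inter> B = {}"
      using all_ok unfolding ok_def Bex_def by (intro allI) simp
    from choice[OF this] obtain B' where B': "\<forall>ij. B' ij \<in> A \<and>
        g ` (F \<inter> cyl (u @ [fst ij])) \<subseteq> B' ij \<and> h ` (G \<inter> cyl (v @ [snd ij])) \<inter> B' ij = {}" ..
    define B where "B i j = B' (i, j)" for i j
    have BA: "B i j \<in> A" and Bg: "g ` (F \<inter> cyl (u @ [i])) \<subseteq> B i j"
      and Bh: "h ` (G \<inter> cyl (v @ [j])) \<inter> B i j = {}" for i j
      using B'[rule_format, of "(i, j)"] by (auto simp: B_def)
    \<comment> \<open>For fixed \<open>i\<close> the intersection over \<open>j\<close> still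
      contains the image of the cylinder of \<open>u @ [i]\<close> and misses the images of all
      cylinders of \<open>v @ [j]\<close>.\<close>
    have "(\<Union>i. \<Inter>j. B i j) \<in> A"
      using BA by (intro countable_UN countable_INT) auto
    moreover have "g ` (F \<inter> cyl u) \<subseteq> (\<Union>i. \<Inter>j. B i j)"
    proof -
      have "g ` (F \<inter> cyl (u @ [i])) \<subseteq> (\<Inter>j. B i j)" for i using Bg by (intro INT_greatest)
      then show ?thesis unfolding cyl_Un[of u] Int_UN_distrib image_UN by (intro UN_mono) auto
    qed
    moreover have "h ` (G \<inter> cyl v) \<inter> (\<Union>i. \<Inter>j. B i j) = {}"
      using Bh unfolding cyl_Un[of v] Int_UN_distrib image_UN by fast
    ultimately show False using that unfolding ok_def by (simp add: bexI)
  qed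
  \<comment> \<open>The two branches are built together, as one branch of pairs.\<close>
  define P where "P u \<longleftrightarrow> \<not> ok (map fst u) (map snd u)" for u :: "(nat \<times> nat) list"
  have "\<exists>z. \<forall>n. P (map z [0..<n])"
    using step by (intro ex_branch) (auto simp: P_def 0)
  then obtain zw where zw: "\<And>n. P (map zw [0..<n])" by blast
  define z w where "z = fst \<circ> zw" and "w = snd \<circ> zw"
  have nok: "\<not> ok (map z [0..<n]) (map w [0..<n])" for n
    using zw[of n] by (simp add: P_def z_def w_def)
  \<comment> \<open>If a cylinder missed \<open>F\<close>, its image would be empty and the empty
    set would separate; on the side of \<open>G\<close> the whole space \<open>S\<close> plays this
    part.\<close>
  have "z \<in> F"
  proof (rule baire_closed_branch[OF F], rule notI)
    fix n assume "F \<inter> cyl (map z [0..<n]) = {}"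
    then have "ok (map z [0..<n]) (map w [0..<n])" unfolding ok_def by (intro bexI[of _ "{}"]) auto
    then show False using nok by blast
  qed
  moreover have "w \<in> G"
  proof (rule baire_closed_branch[OF G], rule notI)
    fix n assume "G \<inter> cyl (map w [0..<n]) = {}"
    then have "ok (map z [0..<n]) (map w [0..<n])" unfolding ok_def using gF by (intro bexI[of _ S]) auto
    then show False using nok by blast
  qed
  ultimately obtain n where n: "\<not> (g z \<in> C n \<longleftrightarrow> h w \<in> C n)" using sep by blast
  \<comment> \<open>\<open>m\<close> exceeds both positions that decide membership in
    \<open>C n\<close>. On the two cylinders of this length membership is constant, so
    \<open>C n\<close> or its complement separates their images.\<close>
  define m where "m = Suc (max (k n) (l n))"
  have gz: "g z' \<in> C n \<longleftrightarrow> g z \<in> C n" if "z' \<in> F \<inter> cyl (map z [0..<m])" for z'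
  proof -
    have "z' \<in> F" "agree m z z'" using that unfolding Int_iff cyl_agree by auto
    then show ?thesis using g[of z' n] g[OF \<open>z \<in> F\<close>, of n] by (simp add: m_def)
  qed
  have hw: "h w' \<in> C n \<longleftrightarrow> h w \<in> C n" if "w' \<in> G \<inter> cyl (map w [0..<m])" for w'
  proof -
    have "w' \<in> G" "agree m w w'" using that unfolding Int_iff cyl_agree by auto
    then show ?thesis using h[of w' n] h[OF \<open>w \<in> G\<close>, of n] by (simp add: m_def)
  qed
  have "ok (map z [0..<m]) (map w [0..<m])"
  proof (cases "g z \<in> C n")
    case True
    then show ?thesis unfolding ok_def using gz hw n C[of n] by (intro bexI[of _ "C n"]) auto
  next
    case False
    then show ?thesis unfolding ok_def using gz hw n C[of n] gF by (intro bexI[of _ "S - C n"]) auto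
  qed
  then show False using nok by blast
qed

text \<open>A Borel set \<open>B\<close> and its complement have codings in which single entries
  decide the sets \<open>C n\<close>, and a point of \<open>B\<close> differs from a point outside
  in some \<open>C n\<close>. The separation therefore takes place inside the \<sigma>-algebra
  generated by the \<open>C n\<close>, and the separating set can only be \<open>B\<close>.\<close>

theorem separating_generates:
  assumes M: "standard_borel M" and C: "\<And>n. C n \<in> sets M" and sep: "separating (space M) C"
  shows "sets M = sigma_sets (space M) (range C)"
proof
  have CS: "range C \<subseteq> Pow (space M)" using C sets.sets_into_space by blast
  show "sigma_sets (space M) (range C) \<subseteq> sets M"
    using C by (intro sets.sigma_sets_subset) auto
  show "sets M \<subseteq> sigma_sets (space M) (range C)"
  proof
    fix B assume B: "B \<in> sets M"
    \<comment> \<open>With \<open>B\<close> in front, one and the same scheme decides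
      \<open>B\<close> and all the \<open>C n\<close>.\<close>
    define D where "D n = (case n of 0 \<Rightarrow> B | Suc n \<Rightarrow> C n)" for n
    have "D n \<in> sets M" for n using B C by (auto simp: D_def split: nat.split)
    then obtain F g k where F: "baire_closed F" "g ` F = space M"
        "\<And>z n. z \<in> F \<Longrightarrow> g z \<in> D n \<longleftrightarrow> z (k n) = 0"
      using standard_borel_scheme[OF M] by blast
    have gB: "g z \<in> B \<longleftrightarrow> z (k 0) = 0" if "z \<in> F" for z using F(3)[OF that, of 0] by (simp add: D_def)
    have gC: "g z \<in> C n \<longleftrightarrow> z (k (Suc n)) = 0" if "z \<in> F" for z n
      using F(3)[OF that, of "Suc n"] by (simp add: D_def)
    define F1 F2 where "F1 = {z\<in>F. z (k 0) = 0}" and "F2 = {z\<in>F. z (k 0) \<noteq> 0}"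
    have cl: "baire_closed {z\<in>F. P (z (k 0))}" for P
      unfolding baire_closed_def
    proof (intro allI impI CollectI conjI)
      fix z assume z: "\<forall>n. \<exists>w\<in>{z \<in> F. P (z (k 0))}. agree n z w"
      then show "z \<in> F" by (intro baire_closedD[OF F(1)]) blast
      show "P (z (k 0))" using z[rule_format, of "Suc (k 0)"] by auto
    qed
    have "\<exists>B'\<in>sigma_sets (space M) (range C). g ` F1 \<subseteq> B' \<and> g ` F2 \<inter> B' = {}"
    proof (rule souslin_separation[where S="space M" and C=C and k="\<lambda>n. k (Suc n)" and l="\<lambda>n. k (Suc n)"])
      show "sigma_algebra (space M) (sigma_sets (space M) (range C))"
        by (rule sigma_algebra_sigma_sets[OF CS])
      show "baire_closed F1" "baire_closed F2" unfolding F1_def F2_def by (rule cl)+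
      show "\<exists>n. \<not> (g z \<in> C n \<longleftrightarrow> g w \<in> C n)" if "z \<in> F1" "w \<in> F2" for z w
      proof (rule ccontr)
        assume "\<not> ?thesis"
        moreover have "g z \<in> space M" "g w \<in> space M" using that F(2) by (auto simp: F1_def F2_def)
        ultimately have "g z = g w" using sep unfolding separating_def by blast
        moreover have "g z \<in> B" "g w \<notin> B" using that gB by (auto simp: F1_def F2_def)
        ultimately show False by simp
      qed
    qed (use F(2) gC in \<open>auto simp: F1_def F2_def\<close>)
    then obtain B' where B': "B' \<in> sigma_sets (space M) (range C)" "g ` F1 \<subseteq> B'" "g ` F2 \<inter> B' = {}"
      by blast
    have "B' \<subseteq> space M" using B'(1) CS sigma_sets_into_sp by blast
    have "B = B'"
    proof (intro equalityI subsetI)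
      fix x assume "x \<in> B"
      then obtain z where "z \<in> F" "x = g z" using F(2) sets.sets_into_space[OF B] by blast
      then have "z \<in> F1" using \<open>x \<in> B\<close> gB by (auto simp: F1_def)
      then show "x \<in> B'" using B' \<open>x = g z\<close> by auto
    next
      fix x assume "x \<in> B'"
      then obtain z where z: "z \<in> F" "x = g z" using F(2) \<open>B' \<subseteq> space M\<close> by blast
      then have "z \<notin> F2" using B'(3) \<open>x \<in> B'\<close> by blast
      then show "x \<in> B" using z gB by (auto simp: F2_def)
    qed
    then show "B \<in> sigma_sets (space M) (range C)" using B' by simp
  qed
qed

lemma measurable_separating:
  assumes M: "standard_borel M" and C: "\<And>n. C n \<in> sets M" and sep: "separating (space M) C"
    and f: "\<And>x. x \<in> space N \<Longrightarrow> f x \<in> space M"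
    and meas: "\<And>n. {x \<in> space N. f x \<in> C n} \<in> sets N"
  shows "f \<in> N \<rightarrow>\<^sub>M M"
proof (rule measurable_sigma_sets[OF separating_generates[OF M C sep]])
  show "range C \<subseteq> Pow (space M)" using C sets.sets_into_space by blast
  show "f \<in> space N \<rightarrow> space M" using f by auto
  show "f -` y \<inter> space N \<in> sets N" if "y \<in> range C" for y
  proof -
    obtain n where "y = C n" using \<open>y \<in> range C\<close> by auto
    then have "f -` y \<inter> space N = {x \<in> space N. f x \<in> C n}" by auto
    then show ?thesis using meas by simp
  qed
qed

section \<open>Measurable selection\<close>

text \<open>A measurable superset of least measure, for a finite measure that has no further null
  sets. The infimum is attained by a countable intersection of near-optimal supersets.\<close>

lemma measurable_hull:
  assumes "sigma_finite_measure \<mu>" "S \<subseteq> space \<mu>"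
  shows "\<exists>H\<in>sets \<mu>. S \<subseteq> H \<and> (\<forall>B\<in>sets \<mu>. S \<subseteq> B \<longrightarrow> H - B \<in> null_sets \<mu>)"
proof -
  interpret sigma_finite_measure \<mu> by fact
  obtain h where h: "h \<in> borel_measurable \<mu>" "integral\<^sup>N \<mu> h \<noteq> \<infinity>" "\<forall>x\<in>space \<mu>. 0 < h x \<and> h x < \<infinity>"
    using Ex_finite_integrable_function by blast
  \<comment> \<open>A strictly positive integrable density turns \<mu> into a finite measure without
    creating new null sets.\<close>
  define \<nu> where "\<nu> = density \<mu> h"
  have sets [simp]: "sets \<nu> = sets \<mu>" "space \<nu> = space \<mu>" by (auto simp: \<nu>_def)
  interpret \<nu>: finite_measure \<nu>
    by (rule finite_measureI) (use h in \<open>auto simp: \<nu>_def emeasure_density cong: nn_integral_cong\<close>)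
  have null: "A \<in> null_sets \<mu>" if "A \<in> sets \<mu>" "emeasure \<nu> A = 0" for A
  proof -
    have "A \<in> null_sets \<nu>" using that by auto
    then have "AE x in \<mu>. x \<in> A \<longrightarrow> h x = 0" unfolding \<nu>_def null_sets_density_iff[OF h(1)] by blast
    then have "AE x in \<mu>. x \<notin> A" using AE_space
    proof eventually_elim
      case (elim x)
      then show ?case using h(3) by force
    qed
    then show ?thesis using that(1) AE_iff_null_sets by blast
  qed
  define \<A> where "\<A> = {B\<in>sets \<mu>. S \<subseteq> B}"
  have ne: "\<A> \<noteq> {}" using assms(2) by (auto simp: \<A>_def)
  define c where "c = (INF B\<in>\<A>. measure \<nu> B)"
  have bdd: "bdd_below (measure \<nu> ` \<A>)" by (intro bdd_belowI2[of _ 0]) auto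
  have "\<exists>B\<in>\<A>. measure \<nu> B < c + 1 / Suc n" for n
  proof -
    have "c < c + 1 / Suc n" by simp
    then show ?thesis unfolding c_def by (subst (asm) cINF_less_iff[OF ne bdd]) auto
  qed
  then obtain B where B: "\<And>n. B n \<in> \<A>" "\<And>n. measure \<nu> (B n) < c + 1 / Suc n" by metis
  define H where "H = (\<Inter>n. B n)"
  have H: "H \<in> sets \<mu>" "S \<subseteq> H" using B(1) by (auto simp: H_def \<A>_def)
  have Hc: "measure \<nu> H \<le> c"
  proof (rule field_le_epsilon)
    fix e :: real assume "e > 0"
    then obtain n where n: "1 / Suc n < e" using nat_approx_posE by blast
    have "measure \<nu> H \<le> measure \<nu> (B n)"
      using B(1)[of n] by (intro \<nu>.finite_measure_mono) (auto simp: H_def \<A>_def)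
    then show "measure \<nu> H \<le> c + e" using B(2)[of n] n by linarith
  qed
  have "H - A \<in> null_sets \<mu>" if A: "A \<in> sets \<mu>" "S \<subseteq> A" for A
  proof (rule null)
    have "H \<inter> A \<in> \<A>" using A H by (auto simp: \<A>_def)
    then have "c \<le> measure \<nu> (H \<inter> A)" unfolding c_def by (rule cINF_lower[OF bdd])
    moreover have "measure \<nu> H = measure \<nu> (H - A) + measure \<nu> (H \<inter> A)"
      using \<nu>.finite_measure_Diff'[of H A] H A by simp
    ultimately have "measure \<nu> (H - A) = 0" using Hc measure_nonneg[of \<nu> "H - A"] by linarith
    then show "emeasure \<nu> (H - A) = 0" by (simp add: \<nu>.emeasure_eq_measure)
  qed (use A H in auto)
  then show ?thesis using H by blast
qed

text \<open>The hulls \<open>H u\<close> of the images of the cylinders form a Souslin scheme, for which the leftmost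
  branch through a point is a measurable function of the point.\<close>

theorem measurable_selection:
  assumes M: "standard_borel M" and X: "standard_borel \<mu>" and sf: "sigma_finite_measure \<mu>"
    and f: "f \<in> M \<rightarrow>\<^sub>M \<mu>"
  shows "\<exists>A N s. A \<in> sets \<mu> \<and> N \<in> null_sets \<mu> \<and> s \<in> restrict_space \<mu> A \<rightarrow>\<^sub>M M \<and>
    (\<forall>x\<in>A. f (s x) = x) \<and> f ` space M \<subseteq> A \<union> N"
proof -
  obtain C where C: "\<And>n. C n \<in> sets \<mu>" "separating (space \<mu>) C"
    using standard_borel_separating[OF X] by metis
  obtain E where E: "\<And>n. E n \<in> sets M" "separating (space M) E"
    using standard_borel_separating[OF M] by metis
  \<comment> \<open>The even indices separate the points of the base, the odd ones those of
    \<open>M\<close>: the entries of a code determine the coded point as well as its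
    projection.\<close>
  define D where "D n = (if even n then f -` C (n div 2) \<inter> space M else E (n div 2))" for n
  have "D n \<in> sets M" for n using E C measurable_sets[OF f] by (auto simp: D_def)
  then obtain F g k where F: "baire_closed F" "g ` F = space M"
      "\<And>z n. z \<in> F \<Longrightarrow> g z \<in> D n \<longleftrightarrow> z (k n) = 0"
    using standard_borel_scheme[OF M] by blast
  have gM: "g z \<in> space M" if "z \<in> F" for z using that F(2) by auto
  define p where "p z = f (g z)" for z
  have pX: "p z \<in> space \<mu>" if "z \<in> F" for z
    using measurable_space[OF f gM[OF that]] by (simp add: p_def)
  have pC: "p z \<in> C n \<longleftrightarrow> z (k (2 * n)) = 0" if "z \<in> F" for z n
    using F(3)[OF that, of "2 * n"] gM[OF that] by (simp add: D_def p_def)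
  have gE: "g z \<in> E n \<longleftrightarrow> z (k (2 * n + 1)) = 0" if "z \<in> F" for z n
    using F(3)[OF that, of "2 * n + 1"] by (simp add: D_def)
  have "\<forall>u. \<exists>H. H \<in> sets \<mu> \<and> p ` (F \<inter> cyl u) \<subseteq> H \<and>
      (\<forall>B\<in>sets \<mu>. p ` (F \<inter> cyl u) \<subseteq> B \<longrightarrow> H - B \<in> null_sets \<mu>)"
  proof
    fix u
    have "p ` (F \<inter> cyl u) \<subseteq> space \<mu>" using pX by auto
    from measurable_hull[OF sf this] show "\<exists>H. H \<in> sets \<mu> \<and> p ` (F \<inter> cyl u) \<subseteq> H \<and>
      (\<forall>B\<in>sets \<mu>. p ` (F \<inter> cyl u) \<subseteq> B \<longrightarrow> H - B \<in> null_sets \<mu>)" by blast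
  qed
  from choice[OF this] obtain H0 where H0': "\<forall>u. H0 u \<in> sets \<mu> \<and> p ` (F \<inter> cyl u) \<subseteq> H0 u \<and>
      (\<forall>B\<in>sets \<mu>. p ` (F \<inter> cyl u) \<subseteq> B \<longrightarrow> H0 u - B \<in> null_sets \<mu>)" ..
  have H0: "H0 u \<in> sets \<mu>" "p ` (F \<inter> cyl u) \<subseteq> H0 u"
      "B \<in> sets \<mu> \<Longrightarrow> p ` (F \<inter> cyl u) \<subseteq> B \<Longrightarrow> H0 u - B \<in> null_sets \<mu>" for u B
    using H0'[rule_format, of u] by auto
  \<comment> \<open>\<open>Y u\<close> keeps those \<open>x\<close> that agree with the points coded
    by extensions of \<open>u\<close> on every \<open>C n\<close> that \<open>u\<close> already
    decides. Along an infinite branch this identifies the projection of the coded point with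
    \<open>x\<close>.\<close>
  define Y where "Y u = {x\<in>space \<mu>. \<forall>n. k (2 * n) < length u \<longrightarrow> (x \<in> C n \<longleftrightarrow> u ! k (2 * n) = 0)}" for u :: "nat list"
  \<comment> \<open>Making \<open>H u\<close> empty where the cylinder misses \<open>F\<close>
    confines the branches to the closed set \<open>F\<close>.\<close>
  define H where "H u = (if F \<inter> cyl u = {} then {} else H0 u \<inter> Y u)" for u
  have Y: "Y u \<in> sets \<mu>" for u
  proof -
    have [measurable]: "\<And>n. C n \<in> sets \<mu>" by fact
    show ?thesis unfolding Y_def by measurable
  qed
  have HY: "H u \<subseteq> Y u" and Hne: "x \<in> H u \<Longrightarrow> F \<inter> cyl u \<noteq> {}" for u x by (auto simp: H_def)
  have Hs [measurable]: "H u \<in> sets \<mu>" for u using H0(1) Y by (auto simp: H_def)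
  have pH: "p ` (F \<inter> cyl u) \<subseteq> H u" for u
  proof -
    have "p ` (F \<inter> cyl u) \<subseteq> Y u" using pX pC by (auto simp: Y_def cyl_def)
    then show ?thesis using H0(2)[of u] by (auto simp: H_def)
  qed
  have Hnull: "H u - B \<in> null_sets \<mu>" if "B \<in> sets \<mu>" "p ` (F \<inter> cyl u) \<subseteq> B" for u B
  proof (rule null_sets_subset[OF H0(3)[OF that]])
    show "H u - B \<in> sets \<mu>" using Hs that(1) by auto
    show "H u - B \<subseteq> H0 u - B" by (auto simp: H_def)
  qed
  \<comment> \<open>The points at which some node is not covered by its children. The children
    together cover the image of the node, so minimality of the hull makes each term null, and there
    are countably many nodes.\<close>
  define N where "N = (\<Union>u. H u - (\<Union>j. H (u @ [j])))"
  have N: "N \<in> null_sets \<mu>"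
    unfolding N_def
  proof (rule null_sets_UN, rule Hnull)
    fix u
    have "p ` (F \<inter> cyl u) = (\<Union>j. p ` (F \<inter> cyl (u @ [j])))" by (subst cyl_Un) auto
    also have "\<dots> \<subseteq> (\<Union>j. H (u @ [j]))" by (intro UN_mono pH subset_refl)
    finally show "p ` (F \<inter> cyl u) \<subseteq> (\<Union>j. H (u @ [j]))" .
  qed (use Hs in auto)
  define A where "A = H [] - N"
  have A: "A \<in> sets \<mu>" using N Hs by (auto simp: A_def)
  define pre where "pre x = rec_nat [] (\<lambda>_ u. u @ [LEAST j. x \<in> H (u @ [j])])" for x
  have pre: "pre x 0 = []" "pre x (Suc n) = pre x n @ [LEAST j. x \<in> H (pre x n @ [j])]" for x n
    by (auto simp: pre_def)
  define b where "b x n = (LEAST j. x \<in> H (pre x n @ [j]))" for x n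
  have preb: "pre x n = map (b x) [0..<n]" for x n
    by (induction n) (auto simp: pre b_def)
  have preH: "x \<in> H (pre x n)" if "x \<in> A" for x n
  proof (induction n)
    case 0
    then show ?case using that by (simp add: A_def pre)
  next
    case (Suc n)
    have "x \<notin> N" using that by (simp add: A_def)
    then have "\<exists>j. x \<in> H (pre x n @ [j])" using Suc unfolding N_def by blast
    then show ?case unfolding pre by (rule LeastI_ex)
  qed
  have bF: "b x \<in> F" if "x \<in> A" for x
  proof (rule baire_closed_branch[OF F(1)])
    show "F \<inter> cyl (map (b x) [0..<n]) \<noteq> {}" for n
      using Hne[OF preH[OF that, of n]] unfolding preb .
  qed
  have pb: "p (b x) = x" if x: "x \<in> A" for x
  proof -
    have xX: "x \<in> space \<mu>" using sets.sets_into_space[OF A] x by auto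
    have "p (b x) \<in> C n \<longleftrightarrow> x \<in> C n" for n
    proof -
      have "x \<in> Y (pre x (Suc (k (2 * n))))" using preH[OF x] HY by blast
      then have "x \<in> C n \<longleftrightarrow> b x (k (2 * n)) = 0"
        unfolding Y_def preb by (simp del: upt_Suc)
      then show ?thesis using pC[OF bF[OF x]] by simp
    qed
    then show ?thesis using C(2) pX[OF bF[OF x]] xX unfolding separating_def by blast
  qed
  \<comment> \<open>Prefixes take countably many values, so the next least child has to be
    measurable only for each fixed prefix.\<close>
  have pre_meas: "(\<lambda>x. pre x n) \<in> \<mu> \<rightarrow>\<^sub>M count_space UNIV" for n
  proof (induction n)
    case 0
    then show ?case by (simp add: pre)
  next
    case (Suc n)
    have 1: "(\<lambda>x. u @ [LEAST j. x \<in> H (u @ [j])]) \<in> \<mu> \<rightarrow>\<^sub>M count_space UNIV" for u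
      by measurable
    show ?case unfolding pre by (rule measurable_compose_countable[OF 1 Suc])
  qed
  have b_meas: "(\<lambda>x. b x n) \<in> \<mu> \<rightarrow>\<^sub>M count_space UNIV" for n
  proof -
    have "b x n = last (pre x (Suc n))" for x by (simp add: pre b_def)
    then show ?thesis using measurable_compose[OF pre_meas[of "Suc n"], of last "count_space UNIV"] by simp
  qed
  have sp: "space (restrict_space \<mu> A) = A"
    using sets.sets_into_space[OF A] by (auto simp: space_restrict_space)
  have "(\<lambda>x. g (b x)) \<in> restrict_space \<mu> A \<rightarrow>\<^sub>M M"
  proof (rule measurable_separating[OF M E])
    show "g (b x) \<in> space M" if "x \<in> space (restrict_space \<mu> A)" for x
      using that gM bF by (simp add: sp)
    fix n
    have "{x \<in> space (restrict_space \<mu> A). g (b x) \<in> E n} = {x\<in>space \<mu>. b x (k (2 * n + 1)) = 0} \<inter> A"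
      unfolding sp using gE[OF bF] sets.sets_into_space[OF A] by auto
    moreover have "{x\<in>space \<mu>. b x (k (2 * n + 1)) = 0} \<in> sets \<mu>"
      using b_meas by measurable
    ultimately show "{x \<in> space (restrict_space \<mu> A). g (b x) \<in> E n} \<in> sets (restrict_space \<mu> A)"
      using A by (auto simp: sets_restrict_space)
  qed
  moreover have "f ` space M \<subseteq> A \<union> N"
  proof -
    have "f ` space M = p ` (F \<inter> cyl [])" unfolding p_def using F(2) by (metis Int_UNIV_right cyl_Nil image_image)
    then show ?thesis using pH[of "[]"] by (auto simp: A_def)
  qed
  ultimately show ?thesis using A N pb unfolding p_def by blast
qed

section \<open>An analytic set that is not Borel\<close>

definition pair_code :: "nat list \<Rightarrow> nat list \<Rightarrow> nat" where
  "pair_code u v = prod_encode (list_encode u, list_encode v)"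

text \<open>The diagonal of the universal analytic set.\<close>

definition diag_analytic :: "(nat \<Rightarrow> nat) set" where
  "diag_analytic = {x. \<exists>z. \<forall>n. x (pair_code (map z [0..<n]) (map x [0..<n])) = 0}"

text \<open>Cantor's argument. If the set were Borel, its complement would be the projection of a
  closed set, hence the set of all \<open>x\<close> over which a certain tree \<open>R\<close> has a
  branch. A sequence \<open>y\<close> that codes \<open>R\<close> would then belong to the set
  exactly if it does not.\<close>

theorem diag_analytic_not_borel:
  assumes std: "standard_borel (borel :: (nat \<Rightarrow> nat) measure)"
  shows "diag_analytic \<notin> sets borel"
proof
  assume B: "diag_analytic \<in> sets borel"
  \<comment> \<open>Besides the complement of the set, the scheme decides all conditions
    \<open>x i = j\<close>, so the entries of a code determine the coded sequence.\<close>
  define D where "D n = (case n of 0 \<Rightarrow> - diag_analytic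
      | Suc m \<Rightarrow> (case prod_decode m of (i, j) \<Rightarrow> {x. x i = j}))" for n
  have "D n \<in> sets borel" for n
    using B by (auto simp: D_def split: nat.split prod.split)
  then obtain F g k where F: "baire_closed F" "g ` F = space borel"
      "\<And>z n. z \<in> F \<Longrightarrow> g z \<in> D n \<longleftrightarrow> z (k n) = 0"
    using standard_borel_scheme[OF std, of D] by metis
  have gD: "g z \<in> diag_analytic \<longleftrightarrow> z (k 0) \<noteq> 0" if "z \<in> F" for z
    using F(3)[OF that, of 0] by (auto simp: D_def)
  define l where "l i j = k (Suc (prod_encode (i, j)))" for i j
  have gl: "g z i = j \<longleftrightarrow> z (l i j) = 0" if "z \<in> F" for z i j
    using F(3)[OF that, of "Suc (prod_encode (i, j))"] by (auto simp: D_def l_def)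
  \<comment> \<open>Initial segments of a code and of the sequence that it codes, for codes of
    sequences outside the set.\<close>
  define R where "R u v \<longleftrightarrow> (\<exists>z\<in>F. z (k 0) = 0 \<and> z \<in> cyl u \<and> g z \<in> cyl v)" for u v
  define y where "y c = (case prod_decode c of (a, b) \<Rightarrow>
      if R (list_decode a) (list_decode b) then 0 else (1::nat))" for c
  have y: "y (pair_code u v) = 0 \<longleftrightarrow> R u v" for u v by (simp add: y_def pair_code_def)
  have key: "x \<notin> diag_analytic \<longleftrightarrow> (\<exists>z. \<forall>n. R (map z [0..<n]) (map x [0..<n]))" for x
  proof
    assume x: "x \<notin> diag_analytic"
    obtain z where "z \<in> F" "g z = x" using F(2) by (metis UNIV_I imageE space_borel)
    then show "\<exists>z. \<forall>n. R (map z [0..<n]) (map x [0..<n])"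
      using x gD unfolding R_def cyl_agree by (intro exI[of _ z] allI bexI[of _ z]) auto
  next
    assume "\<exists>z. \<forall>n. R (map z [0..<n]) (map x [0..<n])"
    then obtain z where z: "\<And>n. \<exists>w\<in>F. w (k 0) = 0 \<and> agree n z w \<and> agree n x (g w)"
      unfolding R_def cyl_agree by blast
    have zF: "z \<in> F" using z by (intro baire_closedD[OF F(1)]) blast
    have "z (k 0) = 0" using z[of "Suc (k 0)"] by auto
    moreover have "g z = x"
    proof
      fix i
      \<comment> \<open>The agreement has to reach the position \<open>l i (x i)\<close>, whose
        entry decides whether the coded sequence has the value \<open>x i\<close> at
        \<open>i\<close>.\<close>
      obtain w where w: "w \<in> F" "agree (Suc (max i (l i (x i)))) z w" "agree (Suc (max i (l i (x i)))) x (g w)"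
        using z by blast
      then have "g w i = x i" by auto
      then have "w (l i (x i)) = 0" using gl[OF w(1)] by simp
      then have "z (l i (x i)) = 0" using w(2) by auto
      then show "g z i = x i" using gl[OF zF] by simp
    qed
    ultimately show "x \<notin> diag_analytic" using gD[OF zF] by simp
  qed
  have "y \<in> diag_analytic \<longleftrightarrow> (\<exists>z. \<forall>n. R (map z [0..<n]) (map y [0..<n]))"
    unfolding diag_analytic_def by (simp add: y)
  then show False using key[of y] by blast
qed

section \<open>Isometry groups of separable Banach spaces\<close>

locale banach_fibre =
  fixes E :: "'v cnormed_space"
  assumes sep_banach: "separable_banach_space E"
begin

sublocale Module.module "ring_of_type_algebra :: complex ring" E
  using sep_banach unfolding separable_banach_space_def by blast

lemma scalar_simps [simp]:
  "carrier (ring_of_type_algebra :: complex ring) = UNIV"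
  "add (ring_of_type_algebra :: complex ring) = (+)"
  "one (ring_of_type_algebra :: complex ring) = 1"
  "zero (ring_of_type_algebra :: complex ring) = 0"
  "mult (ring_of_type_algebra :: complex ring) = (*)"
  by (auto simp: ring_of_type_algebra_def)

abbreviation N where "N \<equiv> vnorm E"
abbreviation d where "d \<equiv> norm_dist E"
abbreviation C where "C \<equiv> carrier E"
abbreviation I where "I \<equiv> isometries E"

lemma norm_pos: "v \<in> C \<Longrightarrow> 0 \<le> N v"
  and norm_eq_0: "v \<in> C \<Longrightarrow> N v = 0 \<longleftrightarrow> v = \<zero>\<^bsub>E\<^esub>"
  and norm_smult: "v \<in> C \<Longrightarrow> N (c \<odot>\<^bsub>E\<^esub> v) = cmod c * N v"
  and norm_triangle: "v \<in> C \<Longrightarrow> w \<in> C \<Longrightarrow> N (v \<oplus>\<^bsub>E\<^esub> w) \<le> N v + N w"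
  using sep_banach unfolding separable_banach_space_def by blast+

lemma minus_smult: "v \<in> C \<Longrightarrow> \<ominus>\<^bsub>E\<^esub> v = (- 1) \<odot>\<^bsub>E\<^esub> v"
  using smult_l_distr[of "-1" 1 v] smult_l_null[of v] smult_one[of v]
  by (intro M.minus_equality) auto

lemma smult_closed' [simp]: "v \<in> C \<Longrightarrow> c \<odot>\<^bsub>E\<^esub> v \<in> C"
  by simp

lemma dist_eq: "v \<in> C \<Longrightarrow> w \<in> C \<Longrightarrow> d v w = N (v \<ominus>\<^bsub>E\<^esub> w)"
  by (simp add: norm_dist_def restrict_dist_def)

lemma norm_uminus: "v \<in> C \<Longrightarrow> N (\<ominus>\<^bsub>E\<^esub> v) = N v"
  by (simp add: minus_smult norm_smult)

lemma dist_add: 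
  assumes "a \<in> C" "b \<in> C" "a' \<in> C" "b' \<in> C"
  shows "d (a \<oplus>\<^bsub>E\<^esub> b) (a' \<oplus>\<^bsub>E\<^esub> b') \<le> d a a' + d b b'"
proof -
  have "(a \<oplus>\<^bsub>E\<^esub> b) \<ominus>\<^bsub>E\<^esub> (a' \<oplus>\<^bsub>E\<^esub> b') = (a \<ominus>\<^bsub>E\<^esub> a') \<oplus>\<^bsub>E\<^esub> (b \<ominus>\<^bsub>E\<^esub> b')"
    using assms by (simp add: a_minus_def M.minus_add M.a_ac)
  then show ?thesis using assms norm_triangle[of "a \<ominus>\<^bsub>E\<^esub> a'" "b \<ominus>\<^bsub>E\<^esub> b'"] by (simp add: dist_eq)
qed

lemma dist_smult:
  assumes "a \<in> C" "a' \<in> C"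
  shows "d (c \<odot>\<^bsub>E\<^esub> a) (c \<odot>\<^bsub>E\<^esub> a') = cmod c * d a a'"
proof -
  have "(c \<odot>\<^bsub>E\<^esub> a) \<ominus>\<^bsub>E\<^esub> (c \<odot>\<^bsub>E\<^esub> a') = c \<odot>\<^bsub>E\<^esub> (a \<ominus>\<^bsub>E\<^esub> a')"
    using assms by (simp add: a_minus_def smult_r_distr smult_r_minus)
  then show ?thesis using assms by (simp add: dist_eq norm_smult)
qed

lemma minus_eq_zero_iff:
  assumes "v \<in> C" "w \<in> C"
  shows "v \<ominus>\<^bsub>E\<^esub> w = \<zero>\<^bsub>E\<^esub> \<longleftrightarrow> v = w"
proof
  have "v = (v \<ominus>\<^bsub>E\<^esub> w) \<oplus>\<^bsub>E\<^esub> w" using assms by (simp add: a_minus_def M.a_assoc M.l_neg)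
  moreover assume "v \<ominus>\<^bsub>E\<^esub> w = \<zero>\<^bsub>E\<^esub>"
  ultimately show "v = w" using assms by simp
qed (use assms in \<open>simp add: a_minus_def M.r_neg\<close>)

sublocale V: Metric_space C d
proof
  fix x y z
  show "0 \<le> d x y" by (simp add: norm_dist_def restrict_dist_def norm_pos)
  show "d x y = d y x"
  proof (cases "x \<in> C \<and> y \<in> C")
    case True
    then have "y \<ominus>\<^bsub>E\<^esub> x = \<ominus>\<^bsub>E\<^esub> (x \<ominus>\<^bsub>E\<^esub> y)"
      by (simp add: a_minus_def M.minus_add M.a_comm)
    then show ?thesis using True norm_uminus[of "x \<ominus>\<^bsub>E\<^esub> y"] by (simp add: dist_eq)
  qed (auto simp: norm_dist_def restrict_dist_def)
  show "d x y = 0 \<longleftrightarrow> x = y" if "x \<in> C" "y \<in> C"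
    using that norm_eq_0[of "x \<ominus>\<^bsub>E\<^esub> y"] by (simp add: dist_eq minus_eq_zero_iff)
  show "d x z \<le> d x y + d y z" if "x \<in> C" "y \<in> C" "z \<in> C"
  proof -
    have "x \<ominus>\<^bsub>E\<^esub> z = (x \<ominus>\<^bsub>E\<^esub> y) \<oplus>\<^bsub>E\<^esub> (y \<ominus>\<^bsub>E\<^esub> z)"
      using that by (simp add: a_minus_def M.a_assoc M.r_neg1)
    then show ?thesis using that norm_triangle[of "x \<ominus>\<^bsub>E\<^esub> y" "y \<ominus>\<^bsub>E\<^esub> z"] by (simp add: dist_eq)
  qed
qed

lemma complete: "V.mcomplete"
  using sep_banach unfolding separable_banach_space_def by blast

lemma norm_topology_eq: "norm_topology E = V.mtopology"
  by (simp add: norm_topology_def)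

lemma norm_eq_dist: "v \<in> C \<Longrightarrow> N v = d v \<zero>\<^bsub>E\<^esub>"
  by (simp add: dist_eq a_minus_def minus_smult)

section \<open>Linear operators and the group of isometries of one Banach space\<close>

lemma linear_opsD:
  assumes "T \<in> linear_ops E"
  shows "v \<in> C \<Longrightarrow> T v \<in> C" "T \<in> extensional C"
    "v \<in> C \<Longrightarrow> w \<in> C \<Longrightarrow> T (v \<oplus>\<^bsub>E\<^esub> w) = T v \<oplus>\<^bsub>E\<^esub> T w"
    "v \<in> C \<Longrightarrow> T (c \<odot>\<^bsub>E\<^esub> v) = c \<odot>\<^bsub>E\<^esub> T v"
  using assms unfolding linear_ops_def by (auto simp: PiE_def)

lemma linear_ops_minus:
  assumes "T \<in> linear_ops E" "v \<in> C" "w \<in> C"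
  shows "T (v \<ominus>\<^bsub>E\<^esub> w) = T v \<ominus>\<^bsub>E\<^esub> T w"
  using assms linear_opsD[OF assms(1)] by (simp add: a_minus_def minus_smult)

lemma bounded_opsD:
  assumes "T \<in> bounded_ops E"
  shows "\<exists>K\<ge>0. \<forall>v\<in>C. \<forall>w\<in>C. d (T v) (T w) \<le> K * d v w"
proof -
  have lin: "T \<in> linear_ops E" using assms unfolding bounded_ops_def by blast
  obtain K where K: "\<forall>v\<in>C. N (T v) \<le> K * N v"
    using assms unfolding bounded_ops_def by blast
  have "d (T v) (T w) \<le> max K 0 * d v w" if "v \<in> C" "w \<in> C" for v w
  proof -
    have "d (T v) (T w) = N (T (v \<ominus>\<^bsub>E\<^esub> w))"
      using that lin by (simp add: dist_eq linear_opsD linear_ops_minus)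
    also have "\<dots> \<le> K * N (v \<ominus>\<^bsub>E\<^esub> w)" using K that by auto
    also have "\<dots> \<le> max K 0 * N (v \<ominus>\<^bsub>E\<^esub> w)" using that by (intro mult_right_mono norm_pos) auto
    finally show ?thesis using that by (simp add: dist_eq)
  qed
  then show ?thesis by (intro exI[of _ "max K 0"]) auto
qed

lemma isometries_linear: "\<alpha> \<in> I \<Longrightarrow> \<alpha> \<in> linear_ops E"
  by (simp add: isometries_def)

lemmas isomD = linear_opsD[OF isometries_linear]

lemma isometries_bounded: "\<alpha> \<in> I \<Longrightarrow> \<alpha> \<in> bounded_ops E"
  unfolding isometries_def bounded_ops_def by (auto intro!: exI[of _ 1])

lemma isom_dist: "\<alpha> \<in> I \<Longrightarrow> v \<in> C \<Longrightarrow> w \<in> C \<Longrightarrow> d (\<alpha> v) (\<alpha> w) = d v w"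
  using linear_ops_minus[OF isometries_linear, of \<alpha> v w]
  by (simp add: dist_eq isomD isometries_def flip: linear_ops_minus)

text \<open>The restriction makes the inverse extensional, so that it is again a member of
  \<open>isometries E\<close> and coincides with the inverse in \<open>isom_group E\<close>.\<close>

definition iv where "iv \<alpha> = (\<lambda>v\<in>C. inv_into C \<alpha> v)"

lemma isom_bij: "\<alpha> \<in> I \<Longrightarrow> bij_betw \<alpha> C C"
  by (simp add: isometries_def)

lemma iv_closed [simp]: "\<alpha> \<in> I \<Longrightarrow> v \<in> C \<Longrightarrow> iv \<alpha> v \<in> C"
  using isom_bij[of \<alpha>] by (simp add: iv_def bij_betw_def inv_into_into)

lemma iv_right [simp]: "\<alpha> \<in> I \<Longrightarrow> v \<in> C \<Longrightarrow> \<alpha> (iv \<alpha> v) = v"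
  using isom_bij[of \<alpha>] by (simp add: iv_def bij_betw_def f_inv_into_f)

lemma iv_left [simp]: "\<alpha> \<in> I \<Longrightarrow> v \<in> C \<Longrightarrow> iv \<alpha> (\<alpha> v) = v"
  using isom_bij[of \<alpha>] isomD(1)[of \<alpha> v] by (simp add: iv_def bij_betw_def)

text \<open>Injectivity comes for free: a linear map that preserves the norm has trivial
  kernel.\<close>

lemma isometriesI:
  assumes lin: "\<alpha> \<in> linear_ops E" and "\<And>v. v \<in> C \<Longrightarrow> N (\<alpha> v) = N v"
    and surj: "\<And>v. v \<in> C \<Longrightarrow> \<exists>w\<in>C. \<alpha> w = v"
  shows "\<alpha> \<in> I"
proof -
  have "v = w" if "v \<in> C" "w \<in> C" "\<alpha> v = \<alpha> w" for v w
  proof -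
    have "N (v \<ominus>\<^bsub>E\<^esub> w) = N (\<alpha> v \<ominus>\<^bsub>E\<^esub> \<alpha> w)"
      using that(1,2) assms(2)[of "v \<ominus>\<^bsub>E\<^esub> w"] linear_ops_minus[OF lin] by simp
    also have "\<dots> = 0"
      using that linear_opsD(1)[OF lin] by (simp add: norm_eq_0 minus_eq_zero_iff)
    finally show ?thesis using that by (simp add: norm_eq_0 minus_eq_zero_iff)
  qed
  moreover have "\<alpha> ` C = C"
    using surj linear_opsD(1)[OF lin] by force
  ultimately have "bij_betw \<alpha> C C" by (auto simp: bij_betw_def inj_on_def)
  then show ?thesis using assms unfolding isometries_def by auto
qed

lemma iv_isom: assumes "\<alpha> \<in> I" shows "iv \<alpha> \<in> I"
proof (rule isometriesI)
  have eq: "iv \<alpha> w = v" if "v \<in> C" "w = \<alpha> v" for v w using that assms by simp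
  show "iv \<alpha> \<in> linear_ops E"
    unfolding linear_ops_def
  proof (intro CollectI conjI ballI allI)
    show "iv \<alpha> \<in> C \<rightarrow>\<^sub>E C" using assms iv_closed[OF assms] by (auto simp: iv_def)
    show "iv \<alpha> (v \<oplus>\<^bsub>E\<^esub> w) = iv \<alpha> v \<oplus>\<^bsub>E\<^esub> iv \<alpha> w" if "v \<in> C" "w \<in> C" for v w
      using that assms by (intro eq) (auto simp: isomD)
    show "iv \<alpha> (c \<odot>\<^bsub>E\<^esub> v) = c \<odot>\<^bsub>E\<^esub> iv \<alpha> v" if "v \<in> C" for c v
      using that assms by (intro eq) (auto simp: isomD)
  qed
  show "N (iv \<alpha> v) = N v" if "v \<in> C" for v
  proof -
    have "N (\<alpha> (iv \<alpha> v)) = N (iv \<alpha> v)" using assms iv_closed[OF assms that] unfolding isometries_def by blast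
    then show ?thesis using assms that by simp
  qed
  show "\<exists>w\<in>C. iv \<alpha> w = v" if "v \<in> C" for v
    using that assms by (intro bexI[of _ "\<alpha> v"]) (auto simp: isomD)
qed

lemma iv_dist: 
  assumes "\<alpha> \<in> I" "v \<in> C" "w \<in> C"
  shows "d (iv \<alpha> v) w = d v (\<alpha> w)"
  using isom_dist[OF assms(1), of "iv \<alpha> v" w] assms by simp

lemma isometries_Bij: "I \<subseteq> Bij C"
  using isomD(2) isom_bij by (auto simp: Bij_def)

lemma mult_isom_group: "\<alpha> \<in> I \<Longrightarrow> \<beta> \<in> I \<Longrightarrow> \<alpha> \<otimes>\<^bsub>isom_group E\<^esub> \<beta> = compose C \<alpha> \<beta>"
  using isometries_Bij by (auto simp: isom_group_def BijGroup_def)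

lemma carrier_isom_group [simp]: "carrier (isom_group E) = I"
  by (simp add: isom_group_def)

lemma one_isom_group: "\<one>\<^bsub>isom_group E\<^esub> = (\<lambda>v\<in>C. v)"
  by (simp add: isom_group_def BijGroup_def)

lemma compose_isom:
  assumes "\<alpha> \<in> I" "\<beta> \<in> I"
  shows "compose C \<alpha> \<beta> \<in> I"
proof (rule isometriesI)
  show "compose C \<alpha> \<beta> \<in> linear_ops E"
    unfolding linear_ops_def
    using assms by (auto simp: compose_def isomD)
  show "N (compose C \<alpha> \<beta> v) = N v" if "v \<in> C" for v
    using assms that isomD(1)[OF assms(2)] by (simp add: compose_def isometries_def)
  show "\<exists>w\<in>C. compose C \<alpha> \<beta> w = v" if "v \<in> C" for v
    using assms that by (intro bexI[of _ "iv \<beta> (iv \<alpha> v)"]) (auto simp: compose_def)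
qed

lemma id_isom: "(\<lambda>v\<in>C. v) \<in> I"
  by (rule isometriesI) (auto simp: linear_ops_def)

lemma subgroup_isom: "subgroup I (BijGroup C)"
proof (rule group.subgroupI[OF group_BijGroup])
  show "I \<subseteq> carrier (BijGroup C)" using isometries_Bij by (simp add: BijGroup_def)
  show "I \<noteq> {}" using id_isom by blast
  show "inv\<^bsub>BijGroup C\<^esub> \<alpha> \<in> I" if "\<alpha> \<in> I" for \<alpha>
    using iv_isom[OF that] that isometries_Bij by (simp add: inv_BijGroup iv_def subset_iff)
  show "\<alpha> \<otimes>\<^bsub>BijGroup C\<^esub> \<beta> \<in> I" if "\<alpha> \<in> I" "\<beta> \<in> I" for \<alpha> \<beta>
    using compose_isom[OF that] that isometries_Bij by (simp add: BijGroup_def subset_iff)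
qed

lemma group_isom: "group (isom_group E)"
  unfolding isom_group_def by (rule subgroup.subgroup_is_group[OF subgroup_isom group_BijGroup])

lemma inv_isom_group: "\<alpha> \<in> I \<Longrightarrow> inv\<^bsub>isom_group E\<^esub> \<alpha> = iv \<alpha>"
  unfolding isom_group_def iv_def
  using group.m_inv_consistent[OF group_BijGroup subgroup_isom, of \<alpha>] isometries_Bij
  by (simp add: inv_BijGroup subset_iff)

end

section \<open>Countable criteria for operators, from a dense sequence of vectors\<close>

locale banach_fibre_dense = banach_fibre E for E :: "'v cnormed_space" +
  fixes q :: "nat \<Rightarrow> 'v"
  assumes qC [simp]: "q n \<in> carrier E"
    and dense: "\<And>v e. v \<in> carrier E \<Longrightarrow> e > 0 \<Longrightarrow> \<exists>n. norm_dist E (q n) v < e"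
begin

lemma dist_le_eps: "x \<in> C \<Longrightarrow> y \<in> C \<Longrightarrow> (\<And>e. e > 0 \<Longrightarrow> d x y \<le> e) \<Longrightarrow> x = y"
  using field_le_epsilon[of "d x y" 0] V.nonneg[of x y] V.zero[of x y] by force

lemma bounded_ops_eqI:
  assumes S: "S \<in> bounded_ops E" and T: "T \<in> bounded_ops E" and eq: "\<And>n. S (q n) = T (q n)"
  shows "S = T"
proof
  fix v
  have lin: "S \<in> linear_ops E" "T \<in> linear_ops E" using S T unfolding bounded_ops_def by auto
  show "S v = T v"
  proof (cases "v \<in> C")
    case True
    obtain K L where K: "K \<ge> 0" "\<And>v w. v \<in> C \<Longrightarrow> w \<in> C \<Longrightarrow> d (S v) (S w) \<le> K * d v w"
      and L: "L \<ge> 0" "\<And>v w. v \<in> C \<Longrightarrow> w \<in> C \<Longrightarrow> d (T v) (T w) \<le> L * d v w"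
      using bounded_opsD[OF S] bounded_opsD[OF T] by metis
    show ?thesis
    proof (rule dist_le_eps)
      fix e :: real assume "e > 0"
      obtain n where n: "d (q n) v < e / (K + L + 1)"
        using dense[OF True, of "e / (K + L + 1)"] \<open>e > 0\<close> K L by auto
      have "d (S v) (T v) \<le> d (S v) (S (q n)) + d (S (q n)) (T v)"
        using True lin by (intro V.triangle) (auto simp: linear_opsD(1))
      also have "\<dots> \<le> K * d v (q n) + L * d (q n) v"
        using K(2)[OF True, of "q n"] L(2)[of "q n" v] True by (simp add: eq)
      also have "\<dots> = (K + L) * d (q n) v" by (simp add: algebra_simps V.commute)
      also have "\<dots> \<le> (K + L + 1) * d (q n) v" by (intro mult_right_mono) auto
      also have "\<dots> \<le> e" using n K L by (simp add: field_simps)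
      finally show "d (S v) (T v) \<le> e" .
    qed (use lin True in \<open>auto simp: linear_opsD\<close>)
  next
    case False
    then show ?thesis using linear_opsD(2)[OF lin(1)] linear_opsD(2)[OF lin(2)] by (simp add: extensional_def)
  qed
qed

text \<open>A vector is determined by the balls of radius \<open>1 / Suc k\<close> around the
  \<open>q m\<close> that contain it. This provides the countably many conditions that separate
  operators.\<close>

lemma bounded_ops_dist_eqI:
  assumes S: "S \<in> bounded_ops E" and T: "T \<in> bounded_ops E"
    and eq: "\<And>n m k. d (S (q n)) (q m) < 1 / Suc k \<longleftrightarrow> d (T (q n)) (q m) < 1 / Suc k"
  shows "S = T"
proof (rule bounded_ops_eqI[OF S T])
  fix n
  have SC: "S (q n) \<in> C" and TC: "T (q n) \<in> C"
    using S T unfolding bounded_ops_def by (auto intro: linear_opsD)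
  show "S (q n) = T (q n)"
  proof (rule dist_le_eps[OF SC TC])
    fix e :: real assume "e > 0"
    then obtain k where k: "1 / Suc k < e / 2" by (metis half_gt_zero nat_approx_posE)
    obtain m where "d (q m) (S (q n)) < 1 / Suc k" using dense[OF SC] by force
    then have "d (S (q n)) (q m) < 1 / Suc k" by (simp add: V.commute)
    moreover from this eq have "d (T (q n)) (q m) < 1 / Suc k" by blast
    moreover have "d (S (q n)) (T (q n)) \<le> d (S (q n)) (q m) + d (q m) (T (q n))"
      using SC TC by (intro V.triangle) auto
    ultimately show "d (S (q n)) (T (q n)) \<le> e" using k by (simp add: V.commute)
  qed
qed

text \<open>Both properties can be tested on the dense sequence: bounded operators are continuous,
  and the range of a linear isometry of a complete space is closed, so that a dense range is
  everything. The quantifiers are countable, which is what makes Isom V Borel.\<close>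

lemma isometries_iff:
  assumes T: "T \<in> bounded_ops E"
  shows "T \<in> I \<longleftrightarrow> (\<forall>n. N (T (q n)) = N (q n)) \<and> (\<forall>n k. \<exists>m. d (T (q m)) (q n) < 1 / Suc k)"
proof safe
  fix n assume "T \<in> I"
  then show "N (T (q n)) = N (q n)" by (simp add: isometries_def)
next
  fix n k assume TI: "T \<in> I"
  obtain m where "d (q m) (iv T (q n)) < 1 / Suc k"
    using dense[of "iv T (q n)" "1 / Suc k"] TI by auto
  then show "\<exists>m. d (T (q m)) (q n) < 1 / Suc k"
    using iv_dist[OF TI, of "q n" "q m"] by (intro exI[of _ m]) (simp add: V.commute)
next
  assume iso: "\<forall>n. N (T (q n)) = N (q n)" and surj: "\<forall>n k. \<exists>m. d (T (q m)) (q n) < 1 / Suc k"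
  have lin: "T \<in> linear_ops E" using T unfolding bounded_ops_def by auto
  obtain K where K: "K \<ge> 0" "\<And>v w. v \<in> C \<Longrightarrow> w \<in> C \<Longrightarrow> d (T v) (T w) \<le> K * d v w"
    using bounded_opsD[OF T] by metis
  have nd: "\<bar>N v - N w\<bar> \<le> d v w" if "v \<in> C" "w \<in> C" for v w
    using V.triangle[of v w "\<zero>\<^bsub>E\<^esub>"] V.triangle[of w v "\<zero>\<^bsub>E\<^esub>"] that by (simp add: norm_eq_dist V.commute abs_le_iff)
  have norm: "N (T v) = N v" if v: "v \<in> C" for v
  proof -
    have "\<bar>N (T v) - N v\<bar> \<le> 0"
    proof (rule field_le_epsilon)
      fix e :: real assume "e > 0"
      obtain n where n: "d (q n) v < e / (K + 1)"
        using dense[OF v, of "e / (K + 1)"] \<open>e > 0\<close> K by auto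
      have "\<bar>N (T v) - N v\<bar> \<le> \<bar>N (T v) - N (T (q n))\<bar> + \<bar>N (q n) - N v\<bar>" using iso by auto
      also have "\<dots> \<le> d (T v) (T (q n)) + d (q n) v"
        using v lin by (intro add_mono nd) (auto simp: linear_opsD)
      also have "\<dots> \<le> K * d v (q n) + d (q n) v" using K(2)[OF v, of "q n"] by simp
      also have "\<dots> = (K + 1) * d (q n) v" by (simp add: algebra_simps V.commute)
      also have "\<dots> \<le> e" using n K by (simp add: field_simps)
      finally show "\<bar>N (T v) - N v\<bar> \<le> 0 + e" by simp
    qed
    then show ?thesis by simp
  qed
  have dist: "d (T v) (T w) = d v w" if "v \<in> C" "w \<in> C" for v w
    using that lin norm[of "v \<ominus>\<^bsub>E\<^esub> w"] by (simp add: dist_eq linear_opsD linear_ops_minus)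
  have app: "\<exists>m. d (T (q m)) v < e" if v: "v \<in> C" and "e > 0" for v e
  proof -
    obtain n where n: "d (q n) v < e / 2" using dense[OF v, of "e/2"] \<open>e > 0\<close> by auto
    obtain k where k: "1 / Suc k < e / 2" using \<open>e > 0\<close> by (metis half_gt_zero nat_approx_posE)
    obtain m where m: "d (T (q m)) (q n) < 1 / Suc k" using surj by blast
    have "d (T (q m)) v \<le> d (T (q m)) (q n) + d (q n) v"
      using v lin by (intro V.triangle) (auto simp: linear_opsD)
    then show ?thesis using n k m by (intro exI[of _ m]) linarith
  qed
  show "T \<in> I"
  proof (rule isometriesI[OF lin norm])
    fix v assume v: "v \<in> C"
    have "\<forall>k. \<exists>m. d (T (q m)) v < 1 / Suc k" using app[OF v] by simp
    then obtain m where m: "\<And>k. d (T (q (m k))) v < 1 / Suc k" by metis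
    have TC: "T (q n) \<in> C" for n using lin by (simp add: linear_opsD)
    have "(\<lambda>k. d (T (q (m k))) v) \<longlonglongrightarrow> 0"
    proof (rule real_tendsto_sandwich[OF _ _ tendsto_const])
      show "(\<lambda>k. 1 / real (Suc k)) \<longlonglongrightarrow> 0" by (rule lim_1_over_n[THEN LIMSEQ_Suc])
    qed (use m in \<open>auto intro!: always_eventually less_imp_le\<close>)
    then have lim: "limitin V.mtopology (\<lambda>k. T (q (m k))) v sequentially"
      using TC v by (simp add: V.limitin_metric_dist_null)
    then have "V.MCauchy (\<lambda>k. T (q (m k)))" using TC by (intro V.convergent_imp_MCauchy) auto
    \<comment> \<open>The isometry pulls the Cauchy property back from the images to the
      \<open>q (m k)\<close>, whose limit is the desired preimage.\<close>
    then have "V.MCauchy (\<lambda>k. q (m k))"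
      unfolding V.MCauchy_def using dist by (simp add: image_subset_iff)
    then obtain w where w: "limitin V.mtopology (\<lambda>k. q (m k)) w sequentially"
      using complete unfolding V.mcomplete_def by blast
    then have wC: "w \<in> C" by (simp add: V.limitin_mspace)
    have "(\<lambda>k. d (T (q (m k))) (T w)) \<longlonglongrightarrow> 0"
      using w wC dist by (simp add: V.limitin_metric_dist_null)
    then have "limitin V.mtopology (\<lambda>k. T (q (m k))) (T w) sequentially"
      using TC wC lin by (simp add: V.limitin_metric_dist_null linear_opsD)
    then have "T w = v" using V.limitin_metric_unique[OF _ lim] by simp
    then show "\<exists>w\<in>C. T w = v" using wC by blast
  qed
qed

end

context banach_fibre_dense
begin

text \<open>The strong operator topology is induced by a complete metric that controls a countable dense
  set of vectors, for an operator and its inverse.\<close>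

definition delta where "delta n \<alpha> \<beta> = d (\<alpha> (q n)) (\<beta> (q n)) + d (iv \<alpha> (q n)) (iv \<beta> (q n))"

definition rho where "rho \<alpha> \<beta> = (SUP n. min (1 / Suc n) (delta n \<alpha> \<beta>))"

abbreviation r where "r \<equiv> restrict_dist I rho"

lemma delta_nonneg: "0 \<le> delta n \<alpha> \<beta>"
  by (simp add: delta_def)

lemma bdd_rho: "bdd_above (range (\<lambda>n. min (1 / real (Suc n)) (delta n \<alpha> \<beta>)))"
  by (rule bdd_aboveI2[of _ _ 1]) (auto simp: min_le_iff_disj divide_le_eq)

lemma rho_le_iff: "rho \<alpha> \<beta> \<le> e \<longleftrightarrow> (\<forall>n. min (1 / Suc n) (delta n \<alpha> \<beta>) \<le> e)"
  unfolding rho_def by (subst cSUP_le_iff[OF _ bdd_rho]) auto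

lemma rho_ge: "min (1 / Suc n) (delta n \<alpha> \<beta>) \<le> rho \<alpha> \<beta>"
  using rho_le_iff[of \<alpha> \<beta> "rho \<alpha> \<beta>"] by blast

lemma rho_lessD: "rho \<alpha> \<beta> < min (1 / Suc n) e \<Longrightarrow> delta n \<alpha> \<beta> < e"
  using rho_ge[of n \<alpha> \<beta>] by linarith

text \<open>All but finitely many terms of the supremum are below \<open>e\<close> by the truncation
  at \<open>1 / Suc n\<close>. A ball of \<open>rho\<close> is thus a condition on finitely many
  vectors.\<close>

lemma rho_small:
  assumes "e > 0"
  shows "\<exists>M. \<forall>\<alpha> \<beta>. (\<forall>n<M. delta n \<alpha> \<beta> \<le> e) \<longrightarrow> rho \<alpha> \<beta> \<le> e"
proof -
  obtain M where M: "1 / real (Suc M) < e" using assms nat_approx_posE by blast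
  have "min (1 / real (Suc n)) (delta n \<alpha> \<beta>) \<le> e" if "\<forall>n<M. delta n \<alpha> \<beta> \<le> e" for n \<alpha> \<beta>
  proof (cases "n < M")
    case False
    then have "1 / real (Suc n) \<le> 1 / real (Suc M)" by (simp add: frac_le)
    then show ?thesis using M by linarith
  qed (use that in auto)
  then show ?thesis unfolding rho_le_iff by blast
qed

lemma rho_nonneg: "0 \<le> rho \<alpha> \<beta>"
  using rho_ge[of 0 \<alpha> \<beta>] delta_nonneg[of 0 \<alpha> \<beta>] by linarith

lemma r_eq: "\<alpha> \<in> I \<Longrightarrow> \<beta> \<in> I \<Longrightarrow> r \<alpha> \<beta> = rho \<alpha> \<beta>"
  by (simp add: restrict_dist_def)

lemma rho_commute: "rho \<alpha> \<beta> = rho \<beta> \<alpha>"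
  by (simp add: rho_def delta_def V.commute)

lemma rho_refl [simp]: "rho \<alpha> \<alpha> = 0"
proof -
  have "d x x = 0" for x using V.zero[of x x] by (cases "x \<in> C") (simp_all add: norm_dist_def restrict_dist_def)
  then have "rho \<alpha> \<alpha> \<le> 0" unfolding rho_le_iff delta_def by auto
  then show ?thesis using rho_nonneg[of \<alpha> \<alpha>] by linarith
qed

sublocale R: Metric_space I r
proof
  fix x y z
  show "0 \<le> r x y" by (simp add: restrict_dist_def rho_nonneg)
  show "r x y = r y x" by (simp add: restrict_dist_def rho_commute)
  show "r x y = 0 \<longleftrightarrow> x = y" if "x \<in> I" "y \<in> I"
  proof
    assume "r x y = 0"
    then have 0: "rho x y = 0" using that by (simp add: r_eq)
    show "x = y"
    proof (rule bounded_ops_eqI)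
      show "x (q n) = y (q n)" for n
      proof (rule dist_le_eps)
        fix e :: real assume "e > 0"
        then have "delta n x y < e" by (intro rho_lessD) (simp add: 0)
        then show "d (x (q n)) (y (q n)) \<le> e"
          using V.nonneg[of "iv x (q n)" "iv y (q n)"] unfolding delta_def by linarith
      qed (use that in \<open>auto simp: isomD\<close>)
    qed (use that isometries_bounded in auto)
  qed (use that in \<open>simp add: r_eq\<close>)
  show "r x z \<le> r x y + r y z" if xyz: "x \<in> I" "y \<in> I" "z \<in> I"
  proof -
    have "rho x z \<le> rho x y + rho y z"
      unfolding rho_le_iff
    proof
      fix n
      have "delta n x z \<le> delta n x y + delta n y z"
        using V.triangle[of "x (q n)" "y (q n)" "z (q n)"]
          V.triangle[of "iv x (q n)" "iv y (q n)" "iv z (q n)"] xyz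
        by (simp add: delta_def isomD)
      then show "min (1 / real (Suc n)) (delta n x z) \<le> rho x y + rho y z"
        using rho_ge[of n x y] rho_ge[of n y z] delta_nonneg[of n x y] delta_nonneg[of n y z]
          rho_nonneg[of x y] rho_nonneg[of y z]
        by (auto simp: min_def split: if_splits)
    qed
    then show ?thesis using xyz by (simp add: r_eq)
  qed
qed

text \<open>Isometries are equicontinuous: the two outer terms of the triangle inequality equal
  \<open>d (q n) v\<close>, whichever isometries occur.\<close>

lemma dist_transfer:
  assumes "\<gamma> \<in> I" "\<gamma>' \<in> I" "v \<in> C" and n: "d (q n) v < e / 3" and close: "d (\<gamma> (q n)) (\<gamma>' (q n)) < e / 3"
  shows "d (\<gamma> v) (\<gamma>' v) < e"
proof -
  have "d (\<gamma> v) (\<gamma>' v) \<le> d (\<gamma> v) (\<gamma> (q n)) + d (\<gamma> (q n)) (\<gamma>' v)"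
    using assms by (intro V.triangle) (auto simp: isomD)
  moreover have "d (\<gamma> (q n)) (\<gamma>' v) \<le> d (\<gamma> (q n)) (\<gamma>' (q n)) + d (\<gamma>' (q n)) (\<gamma>' v)"
    using assms by (intro V.triangle) (auto simp: isomD)
  moreover have "d (\<gamma> v) (\<gamma> (q n)) = d (q n) v" using assms by (simp add: isom_dist V.commute)
  moreover have "d (\<gamma>' (q n)) (\<gamma>' v) = d (q n) v" using assms by (simp add: isom_dist)
  ultimately show ?thesis using n close by linarith
qed

lemma deltaD:
  assumes "delta n \<alpha> \<beta> < e"
  shows "d (\<alpha> (q n)) (\<beta> (q n)) < e" "d (iv \<alpha> (q n)) (iv \<beta> (q n)) < e"
  using assms V.nonneg[of "\<alpha> (q n)" "\<beta> (q n)"] V.nonneg[of "iv \<alpha> (q n)" "iv \<beta> (q n)"]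
  unfolding delta_def by linarith+

lemma r_evaluation:
  assumes "\<alpha> \<in> I" "v \<in> C" "e > 0"
  shows "\<exists>s>0. \<forall>\<beta>\<in>I. r \<alpha> \<beta> < s \<longrightarrow> d (\<alpha> v) (\<beta> v) < e \<and> d (iv \<alpha> v) (iv \<beta> v) < e"
proof -
  obtain n where n: "d (q n) v < e / 3" using dense[OF assms(2), of "e/3"] assms(3) by auto
  show ?thesis
  proof (intro exI[of _ "min (1 / Suc n) (e / 3)"] conjI ballI impI)
    fix \<beta> assume \<beta>: "\<beta> \<in> I" "r \<alpha> \<beta> < min (1 / Suc n) (e / 3)"
    then have "delta n \<alpha> \<beta> < e / 3" using assms by (intro rho_lessD) (simp add: r_eq)
    from deltaD[OF this] show "d (\<alpha> v) (\<beta> v) < e" "d (iv \<alpha> v) (iv \<beta> v) < e"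
      using dist_transfer[OF _ _ assms(2) n] assms(1) \<beta>(1) iv_isom by blast+
  qed (use assms in auto)
qed

section \<open>Comparison of the metric with the strong operator topology\<close>

lemma topspace_isom [simp]: "topspace (isom_topology E) = I"
proof -
  have "I \<subseteq> C \<rightarrow>\<^sub>E C" using isomD by (auto simp: PiE_def)
  then show ?thesis by (auto simp: isom_topology_def norm_topology_eq)
qed

lemma continuous_evaluation:
  assumes "v \<in> C"
  shows "continuous_map (isom_topology E) V.mtopology (\<lambda>\<alpha>. \<alpha> v)"
  unfolding isom_topology_def norm_topology_eq
  using assms by (intro continuous_map_from_subtopology continuous_map_product_projection)

lemma openin_evaluation:
  assumes "v \<in> C" "w \<in> C"
  shows "openin (isom_topology E) {\<alpha>\<in>I. d w (\<alpha> v) < e}"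
proof -
  have "openin (isom_topology E) {\<alpha>\<in>topspace (isom_topology E). \<alpha> v \<in> V.mball w e}"
    by (rule openin_continuous_map_preimage[OF continuous_evaluation[OF assms(1)]]) simp
  moreover have "{\<alpha>\<in>topspace (isom_topology E). \<alpha> v \<in> V.mball w e} = {\<alpha>\<in>I. d w (\<alpha> v) < e}"
    using assms by (auto simp: isomD)
  ultimately show ?thesis by simp
qed

text \<open>The isometry \<beta> carries the distance between the two inverses at \<open>q n\<close>
  to one between \<open>q n\<close> and the value of \<beta> at a vector that depends on \<alpha>
  only. So evaluations of \<beta> also control its inverse, and the second summand of
  \<open>delta\<close> does not refine the topology.\<close>

lemma delta_eq:
  assumes "\<alpha> \<in> I" "\<beta> \<in> I"
  shows "delta n \<alpha> \<beta> = d (\<alpha> (q n)) (\<beta> (q n)) + d (q n) (\<beta> (iv \<alpha> (q n)))"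
  using assms iv_dist[of \<beta> "q n" "iv \<alpha> (q n)"] by (simp add: delta_def V.commute)

text \<open>Evaluations are continuous for the metric by density of the \<open>q n\<close>;
  conversely, a ball of the metric contains a neighbourhood given by finitely many evaluations,
  thanks to \<open>rho_small\<close> and \<open>delta_eq\<close>.\<close>

theorem isom_topology_eq: "isom_topology E = R.mtopology"
  unfolding topology_eq
proof (intro allI iffI)
  fix U assume U: "openin (isom_topology E) U"
  have "continuous_map R.mtopology (isom_topology E) (\<lambda>\<alpha>. \<alpha>)"
    unfolding isom_topology_def norm_topology_eq continuous_map_in_subtopology continuous_map_componentwise
  proof (intro conjI ballI)
    fix v assume v: "v \<in> C"
    show "continuous_map R.mtopology V.mtopology (\<lambda>\<alpha>. \<alpha> v)"
      unfolding V.continuous_map_to_metric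
    proof (intro ballI allI impI)
      fix \<alpha> and e :: real assume \<alpha>: "\<alpha> \<in> topspace R.mtopology" and e: "e > 0"
      then have \<alpha>I: "\<alpha> \<in> I" by simp
      obtain s where s: "s > 0" "\<forall>\<beta>\<in>I. r \<alpha> \<beta> < s \<longrightarrow> d (\<alpha> v) (\<beta> v) < e \<and> d (iv \<alpha> v) (iv \<beta> v) < e"
        using r_evaluation[OF \<alpha>I v e] by blast
      then show "\<exists>W. openin R.mtopology W \<and> \<alpha> \<in> W \<and> (\<forall>\<beta>\<in>W. \<beta> v \<in> V.mball (\<alpha> v) e)"
        using \<alpha>I v by (intro exI[of _ "R.mball \<alpha> s"]) (auto simp: isomD)
    qed
  qed (use isomD(2) in auto)
  from openin_continuous_map_preimage[OF this U]
  have "openin R.mtopology {\<alpha>\<in>I. \<alpha> \<in> U}" by simp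
  moreover have "{\<alpha>\<in>I. \<alpha> \<in> U} = U" using openin_subset[OF U] by auto
  ultimately show "openin R.mtopology U" by simp
next
  fix U assume U: "openin R.mtopology U"
  show "openin (isom_topology E) U"
  proof (subst openin_subopen, intro ballI)
    fix \<alpha> assume \<alpha>: "\<alpha> \<in> U"
    then have \<alpha>I: "\<alpha> \<in> I" using U openin_subset by fastforce
    obtain e where e: "e > 0" "R.mball \<alpha> e \<subseteq> U" using U \<alpha> by (meson R.openin_mtopology)
    obtain M where M: "\<And>\<alpha> \<beta>. (\<forall>n<M. delta n \<alpha> \<beta> \<le> e / 2) \<Longrightarrow> rho \<alpha> \<beta> \<le> e / 2"
      using rho_small[of "e/2"] e(1) by auto
    define W where "W = I \<inter> (\<Inter>n\<in>{..<M}. {\<beta>\<in>I. d (\<alpha> (q n)) (\<beta> (q n)) < e / 4} \<inter>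
      {\<beta>\<in>I. d (q n) (\<beta> (iv \<alpha> (q n))) < e / 4})"
    have "openin (isom_topology E) W"
    \<comment> \<open>An intersection over no indices is the universe of the type and not a member
      of the topology; here \<open>W\<close> is the whole group.\<close>
    proof (cases "M = 0")
      case True
      then show ?thesis using openin_topspace[of "isom_topology E"] by (simp add: W_def)
    next
      case False
      then show ?thesis unfolding W_def using \<alpha>I openin_topspace[of "isom_topology E"]
        by (intro openin_Int openin_INT2 openin_evaluation) (auto simp: isomD)
    qed
    moreover have "\<alpha> \<in> W" using \<alpha>I e(1) by (auto simp: W_def isomD)
    moreover have "W \<subseteq> U"
    proof
      fix \<beta> assume \<beta>: "\<beta> \<in> W"
      then have \<beta>I: "\<beta> \<in> I" by (simp add: W_def)
      have "rho \<alpha> \<beta> \<le> e / 2"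
      proof (rule M, intro allI impI)
        fix n assume "n < M"
        then have "d (\<alpha> (q n)) (\<beta> (q n)) < e / 4" "d (q n) (\<beta> (iv \<alpha> (q n))) < e / 4"
          using \<beta> by (auto simp: W_def)
        then show "delta n \<alpha> \<beta> \<le> e / 2" unfolding delta_eq[OF \<alpha>I \<beta>I] by linarith
      qed
      then have "\<beta> \<in> R.mball \<alpha> e" using \<alpha>I \<beta>I e(1) by (simp add: r_eq)
      then show "\<beta> \<in> U" using e by blast
    qed
    ultimately show "\<exists>T. openin (isom_topology E) T \<and> \<alpha> \<in> T \<and> T \<subseteq> U" by blast
  qed
qed

lemma MCauchy_evaluation:
  assumes "R.MCauchy \<xi>" "v \<in> C"
  shows "V.MCauchy (\<lambda>k. \<xi> k v)" "V.MCauchy (\<lambda>k. iv (\<xi> k) v)"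
proof -
  have \<xi>: "\<xi> k \<in> I" for k using assms(1) unfolding R.MCauchy_def by auto
  have "\<exists>N. \<forall>m\<ge>N. \<forall>n\<ge>N. d (\<xi> m v) (\<xi> n v) < e \<and> d (iv (\<xi> m) v) (iv (\<xi> n) v) < e" if e: "e > 0" for e
  proof -
    obtain j where j: "d (q j) v < e / 3" using dense[OF assms(2), of "e/3"] e by auto
    obtain N where N: "\<And>m n. N \<le> m \<Longrightarrow> N \<le> n \<Longrightarrow> r (\<xi> m) (\<xi> n) < min (1 / Suc j) (e / 3)"
      using assms(1) e unfolding R.MCauchy_def
      by (metis (no_types, lifting) divide_pos_pos min_less_iff_conj of_nat_0_less_iff zero_less_Suc zero_less_numeral zero_less_one)
    have "d (\<xi> m v) (\<xi> n v) < e \<and> d (iv (\<xi> m) v) (iv (\<xi> n) v) < e" if "N \<le> m" "N \<le> n" for m n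
    proof -
      have "delta j (\<xi> m) (\<xi> n) < e / 3" using N[OF that] by (intro rho_lessD) (simp add: r_eq \<xi>)
      from deltaD[OF this] show ?thesis
        using dist_transfer[OF _ _ assms(2) j] \<xi> iv_isom by blast
    qed
    then show ?thesis by blast
  qed
  then show "V.MCauchy (\<lambda>k. \<xi> k v)" "V.MCauchy (\<lambda>k. iv (\<xi> k) v)"
    using \<xi> assms(2) unfolding V.MCauchy_def by (auto simp: isomD image_subset_iff) (meson)+
qed

lemma dist_tendsto_unique:
  assumes "\<And>k. s k \<in> C" "x \<in> C" "y \<in> C" "(\<lambda>k. d (s k) x) \<longlonglongrightarrow> 0" "(\<lambda>k. d (s k) y) \<longlonglongrightarrow> 0"
  shows "x = y"
proof -
  have "limitin V.mtopology s x sequentially" "limitin V.mtopology s y sequentially"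
    using assms by (simp_all add: V.limitin_metric_dist_null)
  then show ?thesis using V.limitin_metric_unique by (metis sequentially_bot)
qed

lemma dist_tendsto_0I:
  assumes "\<And>k. f k \<le> g k" "\<And>k. 0 \<le> f k" "g \<longlonglongrightarrow> (0::real)"
  shows "f \<longlonglongrightarrow> 0"
  by (rule real_tendsto_sandwich[OF _ _ tendsto_const assms(3)]) (use assms in auto)

lemma limit_linear_op:
  assumes \<xi>: "\<And>k. \<xi> k \<in> I" and lim: "\<And>v. v \<in> C \<Longrightarrow> (\<lambda>k. d (\<xi> k v) (\<alpha> v)) \<longlonglongrightarrow> 0"
    and \<alpha>: "\<alpha> \<in> C \<rightarrow>\<^sub>E C"
  shows "\<alpha> \<in> linear_ops E" "v \<in> C \<Longrightarrow> N (\<alpha> v) = N v"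
proof -
  have \<alpha>C: "\<alpha> v \<in> C" if "v \<in> C" for v using \<alpha> that by auto
  have \<xi>C: "\<xi> k v \<in> C" if "v \<in> C" for k v using \<xi> that by (simp add: isomD)
  show "\<alpha> \<in> linear_ops E"
    unfolding linear_ops_def
  proof (intro CollectI conjI ballI allI)
    fix v w assume vw: "v \<in> C" "w \<in> C"
    show "\<alpha> (v \<oplus>\<^bsub>E\<^esub> w) = \<alpha> v \<oplus>\<^bsub>E\<^esub> \<alpha> w"
    proof (rule dist_tendsto_unique[where s="\<lambda>k. \<xi> k (v \<oplus>\<^bsub>E\<^esub> w)"])
      show "(\<lambda>k. d (\<xi> k (v \<oplus>\<^bsub>E\<^esub> w)) (\<alpha> v \<oplus>\<^bsub>E\<^esub> \<alpha> w)) \<longlonglongrightarrow> 0"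
      proof (rule dist_tendsto_0I)
        show "d (\<xi> k (v \<oplus>\<^bsub>E\<^esub> w)) (\<alpha> v \<oplus>\<^bsub>E\<^esub> \<alpha> w) \<le> d (\<xi> k v) (\<alpha> v) + d (\<xi> k w) (\<alpha> w)" for k
          using vw \<xi> \<alpha>C \<xi>C by (simp add: isomD(3) dist_add)
        show "(\<lambda>k. d (\<xi> k v) (\<alpha> v) + d (\<xi> k w) (\<alpha> w)) \<longlonglongrightarrow> 0"
          using tendsto_add[OF lim[OF vw(1)] lim[OF vw(2)]] by simp
      qed simp
    qed (use vw \<alpha>C \<xi>C lim in auto)
  next
    fix c v assume v: "v \<in> C"
    show "\<alpha> (c \<odot>\<^bsub>E\<^esub> v) = c \<odot>\<^bsub>E\<^esub> \<alpha> v"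
    proof (rule dist_tendsto_unique[where s="\<lambda>k. \<xi> k (c \<odot>\<^bsub>E\<^esub> v)"])
      have "(\<lambda>k. cmod c * d (\<xi> k v) (\<alpha> v)) \<longlonglongrightarrow> 0"
        using tendsto_mult_left[OF lim[OF v], of "cmod c"] by simp
      then show "(\<lambda>k. d (\<xi> k (c \<odot>\<^bsub>E\<^esub> v)) (c \<odot>\<^bsub>E\<^esub> \<alpha> v)) \<longlonglongrightarrow> 0"
        using v \<xi> \<alpha>C \<xi>C by (simp add: isomD(4) dist_smult)
    qed (use v \<alpha>C \<xi>C lim in auto)
  qed (fact \<alpha>)
  show "N (\<alpha> v) = N v" if v: "v \<in> C"
  proof -
    have "\<bar>N (\<alpha> v) - N v\<bar> \<le> d (\<xi> k v) (\<alpha> v)" for k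
    proof -
      have "N v = N (\<xi> k v)" using \<xi> v by (simp add: isometries_def)
      then show ?thesis
        using V.triangle[of "\<alpha> v" "\<xi> k v" "\<zero>\<^bsub>E\<^esub>"] V.triangle[of "\<xi> k v" "\<alpha> v" "\<zero>\<^bsub>E\<^esub>"] v \<alpha>C \<xi>C
        by (simp add: norm_eq_dist V.commute abs_le_iff)
    qed
    then have "\<bar>N (\<alpha> v) - N v\<bar> \<le> 0" using LIMSEQ_le_const[OF lim[OF v]] by blast
    then show ?thesis by simp
  qed
qed

text \<open>A strong limit of surjective isometries need not be surjective. As \<open>rho\<close>
  controls the inverses too, these converge as well, and their limit is a right inverse of the
  limit.\<close>

theorem mcomplete_isom: "R.mcomplete"
  unfolding R.mcomplete_def
proof (intro allI impI)
  fix \<xi> assume Cau: "R.MCauchy \<xi>"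
  have \<xi>: "\<xi> k \<in> I" for k using Cau unfolding R.MCauchy_def by auto
  have \<xi>C: "\<xi> k v \<in> C" if "v \<in> C" for k v using \<xi> that by (simp add: isomD)
  have ex: "\<exists>l\<in>C. (\<lambda>k. d (s k) l) \<longlonglongrightarrow> 0" if "V.MCauchy s" for s
  proof -
    obtain l where "limitin V.mtopology s l sequentially"
      using complete \<open>V.MCauchy s\<close> unfolding V.mcomplete_def by blast
    then show ?thesis unfolding V.limitin_metric_dist_null by blast
  qed
  have "\<forall>v\<in>C. \<exists>l\<in>C. (\<lambda>k. d (\<xi> k v) l) \<longlonglongrightarrow> 0"
    using MCauchy_evaluation(1)[OF Cau] ex by blast
  then obtain a where a: "\<And>v. v \<in> C \<Longrightarrow> a v \<in> C" "\<And>v. v \<in> C \<Longrightarrow> (\<lambda>k. d (\<xi> k v) (a v)) \<longlonglongrightarrow> 0"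
    by metis
  have "\<forall>v\<in>C. \<exists>l\<in>C. (\<lambda>k. d (iv (\<xi> k) v) l) \<longlonglongrightarrow> 0"
    using MCauchy_evaluation(2)[OF Cau] ex by blast
  then obtain b where b: "\<And>v. v \<in> C \<Longrightarrow> b v \<in> C" "\<And>v. v \<in> C \<Longrightarrow> (\<lambda>k. d (iv (\<xi> k) v) (b v)) \<longlonglongrightarrow> 0"
    by metis
  define \<alpha> where "\<alpha> = restrict a C"
  have \<alpha>: "\<alpha> \<in> C \<rightarrow>\<^sub>E C" "\<And>v. v \<in> C \<Longrightarrow> \<alpha> v = a v" using a by (auto simp: \<alpha>_def)
  have ab: "a (b v) = v" if v: "v \<in> C" for v
  proof (rule dist_tendsto_unique[where s="\<lambda>k. \<xi> k (b v)"])
    have "d (\<xi> k (b v)) v = d (iv (\<xi> k) v) (b v)" for k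
      using iv_dist[OF \<xi>, of v "b v" k] v b by (simp add: V.commute)
    then show "(\<lambda>k. d (\<xi> k (b v)) v) \<longlonglongrightarrow> 0" using b(2)[OF v] by simp
  qed (use v a b \<xi>C in auto)
  have \<alpha>I: "\<alpha> \<in> I"
  proof (rule isometriesI)
    have lim: "(\<lambda>k. d (\<xi> k v) (\<alpha> v)) \<longlonglongrightarrow> 0" if "v \<in> C" for v using a(2) \<alpha>(2) that by simp
    show "\<alpha> \<in> linear_ops E" by (rule limit_linear_op(1)[OF \<xi> lim \<alpha>(1)])
    show "N (\<alpha> v) = N v" if "v \<in> C" for v
      by (rule limit_linear_op(2)[OF \<xi> lim \<alpha>(1) that])
    show "\<exists>w\<in>C. \<alpha> w = v" if "v \<in> C" for v
      using that ab b \<alpha>(2) by (intro bexI[of _ "b v"]) auto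
  qed
  have iv: "iv \<alpha> v = b v" if "v \<in> C" for v
    using iv_left[OF \<alpha>I, of "b v"] ab[OF that] \<alpha>(2) b(1) that by simp
  have "(\<lambda>k. delta n (\<xi> k) \<alpha>) \<longlonglongrightarrow> 0" for n
    using tendsto_add[OF a(2)[of "q n"] b(2)[of "q n"]] by (simp add: delta_def \<alpha>(2) iv)
  have "(\<lambda>k. r (\<xi> k) \<alpha>) \<longlonglongrightarrow> 0"
    unfolding LIMSEQ_iff
  proof (intro allI impI)
    fix e :: real assume e: "e > 0"
    obtain M where M: "\<And>\<alpha> \<beta>. (\<forall>n<M. delta n \<alpha> \<beta> \<le> e / 2) \<Longrightarrow> rho \<alpha> \<beta> \<le> e / 2"
      using rho_small[of "e/2"] e by auto
    have "\<forall>\<^sub>F k in sequentially. \<forall>n\<in>{..<M}. delta n (\<xi> k) \<alpha> < e / 2"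
      using \<open>\<And>n. (\<lambda>k. delta n (\<xi> k) \<alpha>) \<longlonglongrightarrow> 0\<close> e
      by (intro eventually_ball_finite ballI order_tendstoD(2)[of _ 0]) auto
    then obtain K where "\<And>k n. k \<ge> K \<Longrightarrow> n < M \<Longrightarrow> delta n (\<xi> k) \<alpha> < e / 2"
      unfolding eventually_sequentially by (meson lessThan_iff)
    then have "rho (\<xi> k) \<alpha> \<le> e / 2" if "k \<ge> K" for k
      using that by (intro M) (auto intro: less_imp_le)
    then show "\<exists>K. \<forall>k\<ge>K. norm (r (\<xi> k) \<alpha> - 0) < e"
      using e \<xi> \<alpha>I by (intro exI[of _ K]) (fastforce simp: r_eq rho_nonneg)
  qed
  then have "limitin R.mtopology \<xi> \<alpha> sequentially"
    using \<xi> \<alpha>I by (simp add: R.limitin_metric_dist_null)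
  then show "\<exists>x. limitin R.mtopology \<xi> x sequentially" by blast
qed

text \<open>Finite intersections of evaluation conditions, indexed by lists of triples so that there
  are only countably many of them.\<close>

definition basic :: "(nat \<times> nat \<times> nat) list \<Rightarrow> ('v \<Rightarrow> 'v) set" where
  "basic p = {\<alpha>\<in>I. \<forall>(n, m, k)\<in>set p. d (\<alpha> (q n)) (q m) < 1 / Suc k}"

text \<open>Serves twice: for the separability of a single group and for the density of sections
  that are selected from the basic sets.\<close>

lemma dense_isomI:
  assumes "S \<subseteq> I" and S: "\<And>p. basic p \<noteq> {} \<Longrightarrow> S \<inter> basic p \<noteq> {}"
  shows "isom_topology E closure_of S = I"
proof -
  have "\<exists>\<beta>\<in>S. \<beta> \<in> R.mball \<alpha> e" if \<alpha>: "\<alpha> \<in> I" and e: "e > 0" for \<alpha> e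
  proof -
    obtain M where M: "\<And>\<alpha> \<beta>. (\<forall>n<M. delta n \<alpha> \<beta> \<le> e / 2) \<Longrightarrow> rho \<alpha> \<beta> \<le> e / 2"
      using rho_small[of "e/2"] e by auto
    \<comment> \<open>Four errors of size \<open>1 / Suc k\<close> have to stay below the bound
      \<open>e / 2\<close> on \<open>delta\<close>.\<close>
    obtain k where k: "1 / Suc k < e / 8" using e nat_approx_posE[of "e/8"] by auto
    have "\<forall>n. \<exists>m. d (q m) (\<alpha> (q n)) < 1 / Suc k" using dense \<alpha> by (auto simp: isomD)
    then obtain m where m: "\<And>n. d (q (m n)) (\<alpha> (q n)) < 1 / Suc k" by metis
    have "\<forall>n. \<exists>l. d (q l) (iv \<alpha> (q n)) < 1 / Suc k" using dense \<alpha> by auto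
    then obtain l where l: "\<And>n. d (q (l n)) (iv \<alpha> (q n)) < 1 / Suc k" by metis
    \<comment> \<open>The second list takes care of the inverse: that \<open>q (l n)\<close> is
      close to the preimage of \<open>q n\<close> means that \<alpha> maps \<open>q (l n)\<close>
      close to \<open>q n\<close>, which is again an evaluation condition.\<close>
    define p where "p = map (\<lambda>n. (n, m n, k)) [0..<M] @ map (\<lambda>n. (l n, n, k)) [0..<M]"
    have "\<alpha> \<in> basic p"
    proof -
      have "d (\<alpha> (q (l n))) (q n) < 1 / Suc k" for n
        using l[of n] iv_dist[OF \<alpha>, of "q n" "q (l n)"] by (simp add: V.commute)
      moreover have "d (\<alpha> (q n)) (q (m n)) < 1 / Suc k" for n using m[of n] by (simp add: V.commute)
      ultimately show ?thesis using \<alpha> by (auto simp: basic_def p_def)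
    qed
    then obtain \<beta> where \<beta>: "\<beta> \<in> S" "\<beta> \<in> basic p" using S by blast
    then have \<beta>I: "\<beta> \<in> I" using assms(1) by auto
    have "rho \<alpha> \<beta> \<le> e / 2"
    proof (rule M, intro allI impI)
      fix n assume n: "n < M"
      have 1: "d (\<beta> (q n)) (q (m n)) < 1 / Suc k" and 2: "d (\<beta> (q (l n))) (q n) < 1 / Suc k"
        using \<beta>(2) n unfolding basic_def p_def by fastforce+
      have "d (\<alpha> (q n)) (\<beta> (q n)) \<le> d (\<alpha> (q n)) (q (m n)) + d (q (m n)) (\<beta> (q n))"
        using \<alpha> \<beta>I by (intro V.triangle) (auto simp: isomD)
      moreover have "d (q n) (\<beta> (iv \<alpha> (q n))) \<le> d (q n) (\<beta> (q (l n))) + d (\<beta> (q (l n))) (\<beta> (iv \<alpha> (q n)))"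
        using \<alpha> \<beta>I by (intro V.triangle) (auto simp: isomD)
      moreover have "d (\<beta> (q (l n))) (\<beta> (iv \<alpha> (q n))) = d (q (l n)) (iv \<alpha> (q n))"
        using \<alpha> \<beta>I by (simp add: isom_dist)
      ultimately show "delta n \<alpha> \<beta> \<le> e / 2"
        unfolding delta_eq[OF \<alpha> \<beta>I] using 1 2 m[of n] l[of n] k by (simp add: V.commute)
    qed
    then show ?thesis using \<alpha> \<beta>I \<beta>(1) e by (intro bexI[of _ \<beta>]) (auto simp: r_eq)
  qed
  then show ?thesis unfolding isom_topology_eq R.metric_closure_of by auto
qed

lemma polish_isom: "polish_space_on (isom_topology E)"
  unfolding polish_space_on_def
proof
  define s where "s p = (SOME \<alpha>. \<alpha> \<in> basic p)" for p
  define S where "S = s ` {p. basic p \<noteq> {}}"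
  have s: "s p \<in> basic p" if "basic p \<noteq> {}" for p
    unfolding s_def using that by (simp add: some_in_eq)
  have "countable S" by (simp add: S_def)
  moreover have SI: "S \<subseteq> I" using s by (auto simp: S_def basic_def)
  moreover have "isom_topology E closure_of S = topspace (isom_topology E)"
    unfolding topspace_isom by (rule dense_isomI[OF SI]) (use s in \<open>auto simp: S_def\<close>)
  ultimately show "separable_space (isom_topology E)"
    unfolding separable_space_def by (intro exI[of _ S]) auto
  show "completely_metrizable_space (isom_topology E)"
    unfolding completely_metrizable_space_def
    using R.Metric_space_axioms mcomplete_isom isom_topology_eq by blast
qed

text \<open>Composition is jointly continuous because the outer isometry does not enlarge the error
  of the inner one. Inversion is continuous because \<open>iv_dist\<close> moves the inverse to the
  other side of a distance.\<close>

theorem polish_group_isom: "polish_group (isom_group E) (isom_topology E)"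
  unfolding polish_group_def
proof (intro conjI)
  let ?T = "isom_topology E"
  have cont: "continuous_map Y ?T f"
    if "\<And>y. y \<in> topspace Y \<Longrightarrow> f y \<in> I" "\<And>v. v \<in> C \<Longrightarrow> continuous_map Y V.mtopology (\<lambda>y. f y v)"
    for Y :: "'z topology" and f
    unfolding isom_topology_def norm_topology_eq continuous_map_in_subtopology continuous_map_componentwise
    using that isomD(2) by auto
  show "continuous_map (prod_topology ?T ?T) ?T (\<lambda>(g, h). g \<otimes>\<^bsub>isom_group E\<^esub> h)"
  proof (rule cont)
    fix v assume v: "v \<in> C"
    show "continuous_map (prod_topology ?T ?T) V.mtopology (\<lambda>y. (case y of (g, h) \<Rightarrow> g \<otimes>\<^bsub>isom_group E\<^esub> h) v)"
      unfolding V.continuous_map_to_metric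
    proof (intro ballI allI impI)
      fix y and e :: real assume y: "y \<in> topspace (prod_topology ?T ?T)" and e: "e > 0"
      obtain \<alpha> \<beta> where ab: "y = (\<alpha>, \<beta>)" "\<alpha> \<in> I" "\<beta> \<in> I" using y by (auto simp: )
      define W where "W = {\<gamma>\<in>I. d (\<alpha> (\<beta> v)) (\<gamma> (\<beta> v)) < e / 2} \<times> {\<gamma>\<in>I. d (\<beta> v) (\<gamma> v) < e / 2}"
      have "openin (prod_topology ?T ?T) W"
        unfolding W_def openin_prod_Times_iff using ab v
        by (intro disjI2 conjI openin_evaluation) (auto simp: isomD)
      moreover have "y \<in> W" using ab e v by (auto simp: W_def isomD)
      moreover have "(case z of (g, h) \<Rightarrow> g \<otimes>\<^bsub>isom_group E\<^esub> h) v \<in> V.mball ((case y of (g, h) \<Rightarrow> g \<otimes>\<^bsub>isom_group E\<^esub> h) v) e"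
        if z: "z \<in> W" for z
      proof -
        obtain g h where gh: "z = (g, h)" "g \<in> I" "h \<in> I" "d (\<alpha> (\<beta> v)) (g (\<beta> v)) < e / 2" "d (\<beta> v) (h v) < e / 2"
          using z by (auto simp: W_def)
        have "d (\<alpha> (\<beta> v)) (g (h v)) \<le> d (\<alpha> (\<beta> v)) (g (\<beta> v)) + d (g (\<beta> v)) (g (h v))"
          using ab gh v by (intro V.triangle) (auto simp: isomD)
        moreover have "d (g (\<beta> v)) (g (h v)) = d (\<beta> v) (h v)" using ab gh v by (simp add: isom_dist isomD)
        ultimately show ?thesis using ab gh v by (simp add: mult_isom_group compose_def isomD)
      qed
      ultimately show "\<exists>W. openin (prod_topology ?T ?T) W \<and> y \<in> W \<and>
          (\<forall>z\<in>W. (case z of (g, h) \<Rightarrow> g \<otimes>\<^bsub>isom_group E\<^esub> h) v \<in> V.mball ((case y of (g, h) \<Rightarrow> g \<otimes>\<^bsub>isom_group E\<^esub> h) v) e)"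
        by blast
    qed
  qed (auto simp: mult_isom_group compose_isom)
  show "continuous_map ?T ?T (\<lambda>g. inv\<^bsub>isom_group E\<^esub> g)"
  proof (rule cont)
    fix v assume v: "v \<in> C"
    show "continuous_map ?T V.mtopology (\<lambda>g. (inv\<^bsub>isom_group E\<^esub> g) v)"
      unfolding V.continuous_map_to_metric
    proof (intro ballI allI impI)
      fix \<alpha> and e :: real assume "\<alpha> \<in> topspace ?T" and e: "e > 0"
      then have \<alpha>: "\<alpha> \<in> I" by simp
      define W where "W = {\<gamma>\<in>I. d v (\<gamma> (iv \<alpha> v)) < e}"
      have "openin ?T W" unfolding W_def using \<alpha> v by (intro openin_evaluation) auto
      moreover have "\<alpha> \<in> W" using \<alpha> v e by (simp add: W_def)
      moreover have "(inv\<^bsub>isom_group E\<^esub> \<gamma>) v \<in> V.mball ((inv\<^bsub>isom_group E\<^esub> \<alpha>) v) e" if "\<gamma> \<in> W" for \<gamma>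
        using that \<alpha> v iv_dist[of \<gamma> v "iv \<alpha> v"] by (auto simp: W_def inv_isom_group V.commute)
      ultimately show "\<exists>W. openin ?T W \<and> \<alpha> \<in> W \<and>
          (\<forall>\<gamma>\<in>W. (inv\<^bsub>isom_group E\<^esub> \<gamma>) v \<in> V.mball ((inv\<^bsub>isom_group E\<^esub> \<alpha>) v) e)" by blast
    qed
  qed (auto simp: inv_isom_group iv_isom)
qed (auto simp: group_isom polish_isom)

end

section \<open>Borel fields of isometry groups\<close>

lemma measurable_fiber_prodI:
  assumes "a \<in> \<Omega> \<rightarrow>\<^sub>M M" "b \<in> \<Omega> \<rightarrow>\<^sub>M N" "\<And>\<omega>. \<omega> \<in> space \<Omega> \<Longrightarrow> fst (a \<omega>) = fst (b \<omega>)"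
  shows "(\<lambda>\<omega>. (a \<omega>, b \<omega>)) \<in> \<Omega> \<rightarrow>\<^sub>M fiber_prod M N"
  unfolding fiber_prod_def using assms
  by (intro measurable_restrict_space2 measurable_Pair) auto

lemma measurable_fst_fiber_prod: "fst \<in> fiber_prod M N \<rightarrow>\<^sub>M M"
  unfolding fiber_prod_def by (rule measurable_restrict_space1) simp

lemma measurable_snd_fiber_prod: "snd \<in> fiber_prod M N \<rightarrow>\<^sub>M N"
  unfolding fiber_prod_def by (rule measurable_restrict_space1) simp

lemma space_fiber_prod:
  "space (fiber_prod M N) = {p \<in> space M \<times> space N. fst (fst p) = fst (snd p)}"
  unfolding fiber_prod_def by (auto simp: space_restrict_space space_pair_measure)

lemma measurable_restrict_space12:
  assumes "f \<in> M \<rightarrow>\<^sub>M N" "\<And>x. x \<in> space M \<Longrightarrow> x \<in> A \<Longrightarrow> f x \<in> B"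
  shows "f \<in> restrict_space M A \<rightarrow>\<^sub>M restrict_space N B"
  using assms by (intro measurable_restrict_space2 measurable_restrict_space1) (auto simp: space_restrict_space)

lemma standard_borel_restrict':
  assumes "standard_borel M" "B \<inter> space M \<in> sets M"
  shows "standard_borel (restrict_space M B)"
proof -
  have "sets (restrict_space M B) = sets (restrict_space M (B \<inter> space M))"
    unfolding sets_restrict_space using sets.sets_into_space[of _ M]
    by (intro image_cong) auto
  then show ?thesis using standard_borel_restrict[OF assms] standard_borel_cong by blast
qed

lemma banach_dense_iff:
  assumes "banach_fibre E"
  shows "norm_topology E closure_of range q = topspace (norm_topology E) \<longleftrightarrow>
    (\<forall>v\<in>carrier E. \<forall>e>0. \<exists>n. q n \<in> carrier E \<and> norm_dist E (q n) v < e)"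
proof -
  interpret banach_fibre E by fact
  show ?thesis
    unfolding norm_topology_eq V.metric_closure_of by (auto simp: V.commute) 
qed

section \<open>Borel fields of Banach spaces and Borel structures on operators\<close>

locale banach_field =
  fixes X :: "'x measure" and V :: "'x \<Rightarrow> 'v cnormed_space" and MV \<phi>
  assumes field: "borel_field_banach X V MV"
    and sections: "dense_borel_sections X (\<lambda>x. norm_topology (V x)) MV \<phi>"
begin

lemma standard_X: "standard_borel X" and standard_MV: "standard_borel MV"
  and space_MV: "space MV = Sigma (space X) (\<lambda>x. carrier (V x))"
  and fst_MV [measurable]: "fst \<in> MV \<rightarrow>\<^sub>M X"
  and norm_MV: "(\<lambda>(x, v). vnorm (V x) v) \<in> MV \<rightarrow>\<^sub>M borel"
  and add_MV: "(\<lambda>((x, v), (y, w)). (x, v \<oplus>\<^bsub>V x\<^esub> w)) \<in> fiber_prod MV MV \<rightarrow>\<^sub>M MV"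
  and smult_MV: "(\<lambda>(c, (x, v)). (x, c \<odot>\<^bsub>V x\<^esub> v)) \<in> (borel :: complex measure) \<Otimes>\<^sub>M MV \<rightarrow>\<^sub>M MV"
  using field unfolding borel_field_banach_def by blast+

lemma section_meas [measurable]: "(\<lambda>x. (x, \<phi> n x)) \<in> X \<rightarrow>\<^sub>M MV"
  using sections unfolding dense_borel_sections_def by blast

lemma fibre: "x \<in> space X \<Longrightarrow> banach_fibre (V x)"
  using field unfolding borel_field_banach_def banach_fibre_def by blast

lemma fibre_dense:
  assumes x: "x \<in> space X"
  shows "banach_fibre_dense (V x) (\<lambda>n. \<phi> n x)"
proof -
  interpret banach_fibre "V x" by (rule fibre[OF x])
  have "\<phi> n x \<in> carrier (V x)" for n
    using measurable_space[OF section_meas x, of n] by (simp add: space_MV)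
  moreover have "\<exists>n. norm_dist (V x) (\<phi> n x) v < e" if "v \<in> carrier (V x)" "e > 0" for v e
    using sections x banach_dense_iff[OF fibre[OF x], of "\<lambda>n. \<phi> n x"] that unfolding dense_borel_sections_def by blast
  ultimately show ?thesis by unfold_locales
qed

lemma measurable_norm:
  assumes "p \<in> \<Omega> \<rightarrow>\<^sub>M MV"
  shows "(\<lambda>\<omega>. vnorm (V (fst (p \<omega>))) (snd (p \<omega>))) \<in> borel_measurable \<Omega>"
  using measurable_compose[OF assms norm_MV] by (simp add: split_beta)

text \<open>The assumptions speak of norm, addition and scalar multiplication, so the difference is
  formed as a sum with the multiple by -1.\<close>

lemma measurable_dist:
  assumes p: "p \<in> \<Omega> \<rightarrow>\<^sub>M MV" and q: "q \<in> \<Omega> \<rightarrow>\<^sub>M MV"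
    and eq: "\<And>\<omega>. \<omega> \<in> space \<Omega> \<Longrightarrow> fst (p \<omega>) = fst (q \<omega>)"
  shows "(\<lambda>\<omega>. norm_dist (V (fst (p \<omega>))) (snd (p \<omega>)) (snd (q \<omega>))) \<in> borel_measurable \<Omega>"
proof -
  have "(\<lambda>\<omega>. (- 1 :: complex, q \<omega>)) \<in> \<Omega> \<rightarrow>\<^sub>M borel \<Otimes>\<^sub>M MV" using q by simp
  from measurable_compose[OF this smult_MV]
  have q': "(\<lambda>\<omega>. (fst (q \<omega>), (- 1) \<odot>\<^bsub>V (fst (q \<omega>))\<^esub> snd (q \<omega>))) \<in> \<Omega> \<rightarrow>\<^sub>M MV"
    by (simp add: split_beta)
  have "(\<lambda>\<omega>. (p \<omega>, (fst (q \<omega>), (- 1) \<odot>\<^bsub>V (fst (q \<omega>))\<^esub> snd (q \<omega>)))) \<in> \<Omega> \<rightarrow>\<^sub>M fiber_prod MV MV"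
    using eq by (intro measurable_fiber_prodI p q') simp
  from measurable_norm[OF measurable_compose[OF this add_MV]]
  have "(\<lambda>\<omega>. vnorm (V (fst (p \<omega>))) (snd (p \<omega>) \<oplus>\<^bsub>V (fst (p \<omega>))\<^esub> (- 1) \<odot>\<^bsub>V (fst (q \<omega>))\<^esub> snd (q \<omega>))) \<in> borel_measurable \<Omega>"
    by (simp add: split_beta)
  moreover have "vnorm (V (fst (p \<omega>))) (snd (p \<omega>) \<oplus>\<^bsub>V (fst (p \<omega>))\<^esub> (- 1) \<odot>\<^bsub>V (fst (q \<omega>))\<^esub> snd (q \<omega>)) =
      norm_dist (V (fst (p \<omega>))) (snd (p \<omega>)) (snd (q \<omega>))" if \<omega>: "\<omega> \<in> space \<Omega>" for \<omega>
  proof -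
    have pq: "fst (p \<omega>) \<in> space X" "snd (p \<omega>) \<in> carrier (V (fst (p \<omega>)))" "snd (q \<omega>) \<in> carrier (V (fst (p \<omega>)))"
      using measurable_space[OF p \<omega>] measurable_space[OF q \<omega>] eq[OF \<omega>] by (auto simp: space_MV)
    interpret banach_fibre "V (fst (p \<omega>))" by (rule fibre[OF pq(1)])
    show ?thesis using pq by (simp add: dist_eq a_minus_def minus_smult flip: eq[OF \<omega>])
  qed
  ultimately show ?thesis by (simp cong: measurable_cong)
qed

lemma measurable_section:
  assumes "f \<in> \<Omega> \<rightarrow>\<^sub>M X"
  shows "(\<lambda>\<omega>. (f \<omega>, \<phi> n (f \<omega>))) \<in> \<Omega> \<rightarrow>\<^sub>M MV"
  by (rule measurable_compose[OF assms section_meas])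

text \<open>Measured fields allow a null set to be discarded, and what remains has to be a Borel
  field over the remaining base.\<close>

lemma restrict_field:
  assumes X0: "X0 \<in> sets X"
  defines "P \<equiv> {p. fst p \<in> X0}"
  shows "banach_field (restrict_space X X0) V (restrict_space MV P) \<phi>"
proof
  have X0X: "X0 \<subseteq> space X" using sets.sets_into_space[OF X0] .
  have sp: "space (restrict_space X X0) = X0" using X0X by (auto simp: space_restrict_space)
  have fp: "p \<in> fiber_prod (restrict_space MV P) (restrict_space MV P) \<rightarrow>\<^sub>M N"
    if "p \<in> fiber_prod MV MV \<rightarrow>\<^sub>M N" for p and N :: "'z measure"
  proof -
    have "(\<lambda>\<omega>. \<omega>) \<in> restrict_space MV P \<rightarrow>\<^sub>M MV" by (rule measurable_restrict_space1) simp
    then have "(\<lambda>\<omega>. (fst \<omega>, snd \<omega>)) \<in> fiber_prod (restrict_space MV P) (restrict_space MV P) \<rightarrow>\<^sub>M fiber_prod MV MV"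
      by (intro measurable_fiber_prodI measurable_compose[OF measurable_fst_fiber_prod]
            measurable_compose[OF measurable_snd_fiber_prod]) (auto simp: space_fiber_prod)
    from measurable_compose[OF this that] show ?thesis by simp
  qed
  have "P \<inter> space MV \<in> sets MV"
  proof -
    have "fst -` X0 \<inter> space MV \<in> sets MV" by (rule measurable_sets[OF fst_MV X0])
    moreover have "fst -` X0 \<inter> space MV = P \<inter> space MV" by (auto simp: P_def)
    ultimately show ?thesis by simp
  qed
  then have std: "standard_borel (restrict_space MV P)"
    by (rule standard_borel_restrict'[OF standard_MV])
  have sect: "dense_borel_sections (restrict_space X X0) (\<lambda>x. norm_topology (V x)) (restrict_space MV P) \<phi>"
    unfolding dense_borel_sections_def
    using sections X0X sp unfolding dense_borel_sections_def
    by (auto intro!: measurable_restrict_space12 simp: P_def)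
  show "dense_borel_sections (restrict_space X X0) (\<lambda>x. norm_topology (V x)) (restrict_space MV P) \<phi>" by fact
  show "borel_field_banach (restrict_space X X0) V (restrict_space MV P)"
    unfolding borel_field_banach_def
  proof (intro conjI)
    show "standard_borel (restrict_space X X0)" by (rule standard_borel_restrict[OF standard_X X0])
    show "standard_borel (restrict_space MV P)" by (rule std)
    show "\<forall>x\<in>space (restrict_space X X0). separable_banach_space (V x)"
      using fibre X0X sp by (auto simp: banach_fibre_def)
    show "space (restrict_space MV P) = Sigma (space (restrict_space X X0)) (\<lambda>x. carrier (V x))"
      unfolding sp using X0X by (auto simp add: space_restrict_space space_MV P_def)
    show "fst \<in> restrict_space MV P \<rightarrow>\<^sub>M restrict_space X X0"
      by (rule measurable_restrict_space12) (auto simp: P_def)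
    show "(\<lambda>(x, v). vnorm (V x) v) \<in> restrict_space MV P \<rightarrow>\<^sub>M borel"
      by (rule measurable_restrict_space1[OF norm_MV])
    show "(\<lambda>((x, v), y, w). (x, v \<oplus>\<^bsub>V x\<^esub> w)) \<in> fiber_prod (restrict_space MV P) (restrict_space MV P) \<rightarrow>\<^sub>M restrict_space MV P"
      by (rule measurable_restrict_space2[OF _ fp[OF add_MV]])
         (auto simp: space_fiber_prod space_restrict_space P_def)
    show "(\<lambda>(c, x, v). (x, c \<odot>\<^bsub>V x\<^esub> v)) \<in> borel \<Otimes>\<^sub>M restrict_space MV P \<rightarrow>\<^sub>M restrict_space MV P"
    proof (rule measurable_restrict_space2)
      have "(\<lambda>\<omega>. \<omega>) \<in> restrict_space MV P \<rightarrow>\<^sub>M MV" by (rule measurable_restrict_space1) simp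
      then have "(\<lambda>\<omega>. (fst \<omega>, snd \<omega>)) \<in> (borel :: complex measure) \<Otimes>\<^sub>M restrict_space MV P \<rightarrow>\<^sub>M borel \<Otimes>\<^sub>M MV"
        by (intro measurable_Pair measurable_fst measurable_compose[OF measurable_snd])
      from measurable_compose[OF this smult_MV]
      show "(\<lambda>(c, x, v). (x, c \<odot>\<^bsub>V x\<^esub> v)) \<in> borel \<Otimes>\<^sub>M restrict_space MV P \<rightarrow>\<^sub>M MV" by simp
    qed (auto simp: space_pair_measure space_restrict_space P_def)
    show "\<exists>\<phi>. dense_borel_sections (restrict_space X X0) (\<lambda>x. norm_topology (V x)) (restrict_space MV P) \<phi>"
      using sect by blast
  qed
qed

end

text \<open>The family \<open>S\<close> is left open, so that B(V), Isom V and its restrictions to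
  Borel subsets of the base share one treatment.\<close>

locale operator_field = banach_field X V MV \<phi>
  for X :: "'x measure" and V :: "'x \<Rightarrow> 'v cnormed_space" and MV \<phi> +
  fixes S :: "'x \<Rightarrow> ('v \<Rightarrow> 'v) set" and M :: "('x \<times> ('v \<Rightarrow> 'v)) measure"
  assumes bounded: "x \<in> space X \<Longrightarrow> S x \<subseteq> bounded_ops (V x)"
    and struct: "operator_borel_structure X MV S M"
begin

lemma standard_M: "standard_borel M" and space_M: "space M = Sigma (space X) S"
  and fst_M [measurable]: "fst \<in> M \<rightarrow>\<^sub>M X"
  and eval_M: "(\<lambda>((x, T), (y, v)). (x, T v)) \<in> fiber_prod M MV \<rightarrow>\<^sub>M MV"
  using struct unfolding operator_borel_structure_def by blast+

lemma measurable_eval: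
  assumes a: "a \<in> \<Omega> \<rightarrow>\<^sub>M M" and b: "b \<in> \<Omega> \<rightarrow>\<^sub>M MV"
    and eq: "\<And>\<omega>. \<omega> \<in> space \<Omega> \<Longrightarrow> fst (a \<omega>) = fst (b \<omega>)"
  shows "(\<lambda>\<omega>. (fst (a \<omega>), snd (a \<omega>) (snd (b \<omega>)))) \<in> \<Omega> \<rightarrow>\<^sub>M MV"
  using measurable_compose[OF measurable_fiber_prodI[OF a b eq] eval_M] by (simp add: split_beta)

lemma measurable_eval_section:
  assumes a: "a \<in> \<Omega> \<rightarrow>\<^sub>M M"
  shows "(\<lambda>\<omega>. (fst (a \<omega>), snd (a \<omega>) (\<phi> n (fst (a \<omega>))))) \<in> \<Omega> \<rightarrow>\<^sub>M MV"
  using measurable_eval[OF a measurable_section[OF measurable_compose[OF a fst_M]]] by simp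

lemma measurable_dist_section:
  assumes a: "a \<in> \<Omega> \<rightarrow>\<^sub>M M"
  shows "(\<lambda>\<omega>. norm_dist (V (fst (a \<omega>))) (snd (a \<omega>) (\<phi> n (fst (a \<omega>)))) (\<phi> m (fst (a \<omega>)))) \<in> borel_measurable \<Omega>"
  using measurable_dist[OF measurable_eval_section[OF a] measurable_section[OF measurable_compose[OF a fst_M]]] by simp

text \<open>Conditions on the base point and on the operator are merged into one sequence; a first
  component 0 marks the former.\<close>

definition generator :: "(nat \<Rightarrow> 'x set) \<Rightarrow> nat \<Rightarrow> ('x \<times> ('v \<Rightarrow> 'v)) set" where
  "generator C c = (case prod_decode c of
      (0, n) \<Rightarrow> {p \<in> Sigma (space X) S. fst p \<in> C n}
    | (Suc n, j) \<Rightarrow> (case prod_decode j of (m, k) \<Rightarrow>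
        {p \<in> Sigma (space X) S. norm_dist (V (fst p)) (snd p (\<phi> n (fst p))) (\<phi> m (fst p)) < 1 / Suc k}))"

lemma generator_simps:
  "generator C (prod_encode (0, n)) = {p \<in> Sigma (space X) S. fst p \<in> C n}"
  "generator C (prod_encode (Suc n, prod_encode (m, k))) =
    {p \<in> Sigma (space X) S. norm_dist (V (fst p)) (snd p (\<phi> n (fst p))) (\<phi> m (fst p)) < 1 / Suc k}"
  by (simp_all add: generator_def)

lemma generator_cases:
  obtains n where "c = prod_encode (0, n)" | n m k where "c = prod_encode (Suc n, prod_encode (m, k))"
proof (cases "prod_decode c")
  case (Pair a b)
  then have c: "c = prod_encode (a, b)" by (metis prod_decode_inverse)
  show ?thesis
  proof (cases a)
    case 0
    then show ?thesis using c that(1) by simp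
  next
    case (Suc n)
    obtain m k where "b = prod_encode (m, k)" by (metis prod_decode_inverse surj_pair)
    then show ?thesis using c that(2) Suc by simp
  qed
qed

lemma generator_sets:
  assumes C: "\<And>n. C n \<in> sets X"
  shows "generator C c \<in> sets M"
proof (cases rule: generator_cases[of c])
  case (1 n)
  have "fst -` C n \<inter> space M \<in> sets M" by (rule measurable_sets[OF fst_M C])
  moreover have "fst -` C n \<inter> space M = generator C c" by (auto simp: 1 generator_simps space_M)
  ultimately show ?thesis by simp
next
  case (2 n m k)
  have [measurable]: "(\<lambda>p. norm_dist (V (fst p)) (snd p (\<phi> n (fst p))) (\<phi> m (fst p))) \<in> borel_measurable M"
    by (rule measurable_dist_section) simp
  have "{p \<in> space M. norm_dist (V (fst p)) (snd p (\<phi> n (fst p))) (\<phi> m (fst p)) < 1 / Suc k} \<in> sets M"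
    by measurable
  then show ?thesis by (simp add: 2 generator_simps space_M)
qed

text \<open>The sets \<open>C n\<close> separate the base points. Within one fibre, the values on
  the dense sections separate bounded operators by \<open>bounded_ops_dist_eqI\<close>.\<close>

lemma generator_separating:
  assumes sep: "separating (space X) C"
  shows "separating (Sigma (space X) S) (generator C)"
  unfolding separating_def
proof (intro ballI impI)
  fix p q assume p: "p \<in> Sigma (space X) S" and q: "q \<in> Sigma (space X) S"
    and eq: "\<forall>n. p \<in> generator C n \<longleftrightarrow> q \<in> generator C n"
  obtain x S' y T where pq: "p = (x, S')" "q = (y, T)" by (metis surj_pair)
  have "x \<in> C n \<longleftrightarrow> y \<in> C n" for n
    using eq[rule_format, of "prod_encode (0, n)"] p q by (simp add: generator_simps pq)
  then have xy: "x = y" using sep p q unfolding separating_def pq by auto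
  have x: "x \<in> space X" "S' \<in> bounded_ops (V x)" "T \<in> bounded_ops (V x)"
    using p q bounded unfolding pq xy by auto
  interpret banach_fibre_dense "V x" "\<lambda>n. \<phi> n x" by (rule fibre_dense[OF x(1)])
  have "S' = T"
  proof (rule bounded_ops_dist_eqI[OF x(2,3)])
    show "norm_dist (V x) (S' (\<phi> n x)) (\<phi> m x) < 1 / real (Suc k) \<longleftrightarrow>
        norm_dist (V x) (T (\<phi> n x)) (\<phi> m x) < 1 / real (Suc k)" for n m k
      using eq[rule_format, of "prod_encode (Suc n, prod_encode (m, k))"] p q
      by (simp add: generator_simps pq xy)
  qed
  then show "p = q" by (simp add: pq xy)
qed

lemma sets_M:
  assumes "\<And>n. C n \<in> sets X" "separating (space X) C"
  shows "sets M = sigma_sets (Sigma (space X) S) (range (generator C))"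
  using separating_generates[OF standard_M generator_sets[OF assms(1)], unfolded space_M, OF generator_separating[OF assms(2)]] .

lemma measurable_M_I:
  assumes sp: "\<And>\<omega>. \<omega> \<in> space \<Omega> \<Longrightarrow> f \<omega> \<in> Sigma (space X) S"
    and fst: "(\<lambda>\<omega>. fst (f \<omega>)) \<in> \<Omega> \<rightarrow>\<^sub>M X"
    and dist: "\<And>n m. (\<lambda>\<omega>. norm_dist (V (fst (f \<omega>))) (snd (f \<omega>) (\<phi> n (fst (f \<omega>)))) (\<phi> m (fst (f \<omega>)))) \<in> borel_measurable \<Omega>"
  shows "f \<in> \<Omega> \<rightarrow>\<^sub>M M"
proof -
  obtain C where C: "\<And>n. C n \<in> sets X" "separating (space X) C"
    using standard_borel_separating[OF standard_X] by metis
  show ?thesis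
  proof (rule measurable_separating[OF standard_M generator_sets[OF C(1)]])
    show "separating (space M) (generator C)" unfolding space_M by (rule generator_separating[OF C(2)])
    show "f \<omega> \<in> space M" if "\<omega> \<in> space \<Omega>" for \<omega> using sp[OF that] by (simp add: space_M)
    fix c
    note [measurable] = fst dist
    show "{\<omega> \<in> space \<Omega>. f \<omega> \<in> generator C c} \<in> sets \<Omega>"
    proof (cases rule: generator_cases[of c])
      case (1 n)
      have "(\<lambda>\<omega>. fst (f \<omega>)) -` C n \<inter> space \<Omega> \<in> sets \<Omega>" by (rule measurable_sets[OF fst C(1)])
      moreover have "(\<lambda>\<omega>. fst (f \<omega>)) -` C n \<inter> space \<Omega> = {\<omega> \<in> space \<Omega>. f \<omega> \<in> generator C c}"
        using sp by (auto simp: 1 generator_simps)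
      ultimately show ?thesis by simp
    next
      case (2 n m k)
      have "{\<omega> \<in> space \<Omega>. norm_dist (V (fst (f \<omega>))) (snd (f \<omega>) (\<phi> n (fst (f \<omega>)))) (\<phi> m (fst (f \<omega>))) < 1 / Suc k} \<in> sets \<Omega>"
        by measurable
      moreover have "{\<omega> \<in> space \<Omega>. f \<omega> \<in> generator C c} = {\<omega> \<in> space \<Omega>. norm_dist (V (fst (f \<omega>))) (snd (f \<omega>) (\<phi> n (fst (f \<omega>)))) (\<phi> m (fst (f \<omega>))) < 1 / Suc k}"
        using sp by (auto simp: 2 generator_simps simp del: SigmaI split_paired_All)
      ultimately show ?thesis by simp
    qed
  qed
qed

end

text \<open>\<open>generator C\<close> is built from \<open>S\<close> and the sections without
  reference to the Borel structure, so both \<sigma>-algebras are generated by the same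
  sets.\<close>

theorem operator_structure_unique:
  assumes "operator_field X V MV \<phi> S M" "operator_field X V MV \<phi> S M'"
  shows "sets M = sets M'"
proof -
  interpret M: operator_field X V MV \<phi> S M by fact
  interpret M': operator_field X V MV \<phi> S M' by fact
  obtain C where C: "\<And>n. C n \<in> sets X" "separating (space X) C"
    using standard_borel_separating[OF M.standard_X] by metis
  show ?thesis unfolding M.sets_M[OF C] M'.sets_M[OF C] ..
qed

locale bounded_field = operator_field X V MV \<phi> "\<lambda>x. bounded_ops (V x)" MB
  for X :: "'x measure" and V :: "'x \<Rightarrow> 'v cnormed_space" and MV \<phi> MB
begin

abbreviation MI where "MI \<equiv> restrict_space MB (isom_total X V)"

lemma isom_sub: "x \<in> space X \<Longrightarrow> isometries (V x) \<subseteq> bounded_ops (V x)"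
  using banach_fibre.isometries_bounded[OF fibre] by blast

text \<open>Along the dense sections, the criterion \<open>isometries_iff\<close> is a countable
  combination of Borel conditions.\<close>

theorem isom_total_sets: "isom_total X V \<in> sets MB"
proof -
  have [measurable]: "(\<lambda>p. norm_dist (V (fst p)) (snd p (\<phi> n (fst p))) (\<phi> m (fst p))) \<in> borel_measurable MB" for n m
    by (rule measurable_dist_section) simp
  have [measurable]: "(\<lambda>p. vnorm (V (fst p)) (snd p (\<phi> n (fst p)))) \<in> borel_measurable MB" for n
    using measurable_norm[OF measurable_eval_section[of "\<lambda>p. p" MB n]] by simp
  have [measurable]: "(\<lambda>p. vnorm (V (fst p)) (\<phi> n (fst p))) \<in> borel_measurable MB" for n
    using measurable_norm[OF measurable_section[OF fst_M, of n]] by simp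
  have "{p \<in> space MB. (\<forall>n. vnorm (V (fst p)) (snd p (\<phi> n (fst p))) = vnorm (V (fst p)) (\<phi> n (fst p))) \<and>
      (\<forall>n k. \<exists>m. norm_dist (V (fst p)) (snd p (\<phi> m (fst p))) (\<phi> n (fst p)) < 1 / Suc k)} \<in> sets MB"
    by measurable
  also have "{p \<in> space MB. (\<forall>n. vnorm (V (fst p)) (snd p (\<phi> n (fst p))) = vnorm (V (fst p)) (\<phi> n (fst p))) \<and>
      (\<forall>n k. \<exists>m. norm_dist (V (fst p)) (snd p (\<phi> m (fst p))) (\<phi> n (fst p)) < 1 / Suc k)} = isom_total X V"
  proof -
    have "p \<in> isom_total X V \<longleftrightarrow> p \<in> space MB \<and> (\<forall>n. vnorm (V (fst p)) (snd p (\<phi> n (fst p))) = vnorm (V (fst p)) (\<phi> n (fst p))) \<and>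
      (\<forall>n k. \<exists>m. norm_dist (V (fst p)) (snd p (\<phi> m (fst p))) (\<phi> n (fst p)) < 1 / Suc k)" for p
    proof (cases p)
      case (Pair x T)
      show ?thesis
        using banach_fibre_dense.isometries_iff[OF fibre_dense, of x T] isom_sub[of x]
        by (auto simp: Pair isom_total_def space_M)
    qed
    then show ?thesis by blast
  qed
  finally show ?thesis .
qed

lemma space_MI: "space MI = Sigma (space X) (\<lambda>x. isometries (V x))"
  using isom_sub by (auto simp: space_restrict_space space_M isom_total_def)

theorem isom_structure: "operator_borel_structure X MV (\<lambda>x. isometries (V x)) MI"
  unfolding operator_borel_structure_def
proof (intro conjI space_MI)
  have id: "(\<lambda>p. p) \<in> MI \<rightarrow>\<^sub>M MB" by (rule measurable_restrict_space1) simp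
  show "standard_borel MI" by (rule standard_borel_restrict[OF standard_M isom_total_sets])
  show "fst \<in> MI \<rightarrow>\<^sub>M X" by (rule measurable_restrict_space1) simp
  have "(\<lambda>p. (fst (fst p), snd (fst p) (snd (snd p)))) \<in> fiber_prod MI MV \<rightarrow>\<^sub>M MV"
    by (rule measurable_eval[OF measurable_compose[OF measurable_fst_fiber_prod id] measurable_snd_fiber_prod])
       (simp add: space_fiber_prod)
  then show "(\<lambda>((x, T), y, v). (x, T v)) \<in> fiber_prod MI MV \<rightarrow>\<^sub>M MV"
    by (simp add: split_beta')
qed

end

section \<open>Group operations, metric and dense sections on Isom V\<close>

locale isom_field = operator_field X V MV \<phi> "\<lambda>x. isometries (V x)" M
  for X :: "'x measure" and V :: "'x \<Rightarrow> 'v cnormed_space" and MV \<phi> M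
begin

lemma isomE:
  assumes "p \<in> space M"
  obtains "fst p \<in> space X" "snd p \<in> isometries (V (fst p))" "banach_fibre_dense (V (fst p)) (\<lambda>n. \<phi> n (fst p))"
  using assms fibre_dense that unfolding space_M by force

theorem measurable_mult:
  "(\<lambda>((x, \<alpha>), (y, \<beta>)). (x, \<alpha> \<otimes>\<^bsub>isom_group (V x)\<^esub> \<beta>)) \<in> fiber_prod M M \<rightarrow>\<^sub>M M"
proof -
  let ?f = "\<lambda>p. (fst (fst p), snd (fst p) \<otimes>\<^bsub>isom_group (V (fst (fst p)))\<^esub> snd (snd p))"
  have "?f \<in> fiber_prod M M \<rightarrow>\<^sub>M M"
  proof (rule measurable_M_I)
    note fm = measurable_fst_fiber_prod[of M M] and sm = measurable_snd_fiber_prod[of M M]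
    show "(\<lambda>p. fst (?f p)) \<in> fiber_prod M M \<rightarrow>\<^sub>M X"
      using measurable_compose[OF fm fst_M] by simp
    show "?f p \<in> Sigma (space X) (\<lambda>x. isometries (V x))" if "p \<in> space (fiber_prod M M)" for p
    proof -
      have p: "fst p \<in> space M" "snd p \<in> space M" "fst (fst p) = fst (snd p)" using that by (auto simp: space_fiber_prod)
      interpret banach_fibre_dense "V (fst (fst p))" "\<lambda>n. \<phi> n (fst (fst p))" using isomE[OF p(1)] .
      have "fst (fst p) \<in> space X" "snd (fst p) \<in> isometries (V (fst (fst p)))"
          "snd (snd p) \<in> isometries (V (fst (fst p)))"
        using p by (auto simp: space_M)
      then show ?thesis by (simp add: mult_isom_group compose_isom)
    qed
    fix n m
    \<comment> \<open>A section is moved by the second isometry and the result by the first, so the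
      evaluation map is used twice.\<close>
    have "(\<lambda>p. (fst (fst p), snd (fst p) (snd (snd p) (\<phi> n (fst (snd p)))))) \<in> fiber_prod M M \<rightarrow>\<^sub>M MV"
      using measurable_eval[OF fm measurable_eval_section[OF sm, of n]] by (simp add: space_fiber_prod)
    from measurable_dist[OF this measurable_section[OF measurable_compose[OF fm fst_M], of m]]
    have "(\<lambda>p. norm_dist (V (fst (fst p))) (snd (fst p) (snd (snd p) (\<phi> n (fst (snd p))))) (\<phi> m (fst (fst p))))
        \<in> borel_measurable (fiber_prod M M)" by simp
    moreover have "norm_dist (V (fst (fst p))) (snd (fst p) (snd (snd p) (\<phi> n (fst (snd p))))) (\<phi> m (fst (fst p)))
        = norm_dist (V (fst (?f p))) (snd (?f p) (\<phi> n (fst (?f p)))) (\<phi> m (fst (?f p)))"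
      if "p \<in> space (fiber_prod M M)" for p
    proof -
      have p: "fst p \<in> space M" "snd p \<in> space M" "fst (fst p) = fst (snd p)" using that by (auto simp: space_fiber_prod)
      interpret banach_fibre_dense "V (fst (fst p))" "\<lambda>n. \<phi> n (fst (fst p))" using isomE[OF p(1)] .
      have "snd (fst p) \<in> isometries (V (fst (fst p)))" "snd (snd p) \<in> isometries (V (fst (fst p)))"
        using p by (auto simp: space_M)
      then show ?thesis using qC[of n] by (simp add: mult_isom_group compose_def flip: p(3))
    qed
    ultimately show "(\<lambda>p. norm_dist (V (fst (?f p))) (snd (?f p) (\<phi> n (fst (?f p)))) (\<phi> m (fst (?f p))))
        \<in> borel_measurable (fiber_prod M M)" by (simp cong: measurable_cong)
  qed
  then show ?thesis by (simp add: split_beta')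
qed

text \<open>By \<open>iv_dist\<close>, the distance from the inverse at one section to another
  section is a distance that involves the isometry itself, so the evaluation map suffices.\<close>

lemma iv_field:
  "(\<lambda>p. (fst p, banach_fibre.iv (V (fst p)) (snd p))) \<in> M \<rightarrow>\<^sub>M M" (is "?f \<in> _")
proof (rule measurable_M_I)
  show "(\<lambda>p. fst (?f p)) \<in> M \<rightarrow>\<^sub>M X" by simp
  show "?f p \<in> Sigma (space X) (\<lambda>x. isometries (V x))" if p: "p \<in> space M" for p
  proof -
    interpret banach_fibre_dense "V (fst p)" "\<lambda>n. \<phi> n (fst p)" using isomE[OF p] .
    have "fst p \<in> space X" "snd p \<in> isometries (V (fst p))" using p by (auto simp: space_M)
    then show ?thesis by (simp add: iv_isom)
  qed
  fix n m
  have "(\<lambda>p. norm_dist (V (fst p)) (\<phi> n (fst p)) (snd p (\<phi> m (fst p)))) \<in> borel_measurable M"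
    using measurable_dist[OF measurable_section[OF fst_M, of n] measurable_eval_section[of "\<lambda>p. p" M m]] by simp
  moreover have "norm_dist (V (fst p)) (\<phi> n (fst p)) (snd p (\<phi> m (fst p))) =
      norm_dist (V (fst (?f p))) (snd (?f p) (\<phi> n (fst (?f p)))) (\<phi> m (fst (?f p)))" if p: "p \<in> space M" for p
  proof -
    interpret banach_fibre_dense "V (fst p)" "\<lambda>n. \<phi> n (fst p)" using isomE[OF p] .
    have "snd p \<in> isometries (V (fst p))" using p by (auto simp: space_M)
    then show ?thesis using iv_dist[of "snd p" "\<phi> n (fst p)" "\<phi> m (fst p)"] by simp
  qed
  ultimately show "(\<lambda>p. norm_dist (V (fst (?f p))) (snd (?f p) (\<phi> n (fst (?f p)))) (\<phi> m (fst (?f p))))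
      \<in> borel_measurable M" by (simp cong: measurable_cong)
qed

theorem measurable_inv: "(\<lambda>(x, \<alpha>). (x, inv\<^bsub>isom_group (V x)\<^esub> \<alpha>)) \<in> M \<rightarrow>\<^sub>M M"
proof (subst measurable_cong)
  show "(\<lambda>p. (fst p, banach_fibre.iv (V (fst p)) (snd p))) \<in> M \<rightarrow>\<^sub>M M" by (rule iv_field)
  show "(case p of (x, \<alpha>) \<Rightarrow> (x, inv\<^bsub>isom_group (V x)\<^esub> \<alpha>)) = (fst p, banach_fibre.iv (V (fst p)) (snd p))"
    if p: "p \<in> space M" for p
  proof -
    interpret banach_fibre_dense "V (fst p)" "\<lambda>n. \<phi> n (fst p)" using isomE[OF p] .
    have "snd p \<in> isometries (V (fst p))" using p by (auto simp: space_M)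
    then show ?thesis by (simp add: inv_isom_group split_beta)
  qed
qed

lemma measurable_one: "(\<lambda>x. (x, \<one>\<^bsub>isom_group (V x)\<^esub>)) \<in> X \<rightarrow>\<^sub>M M"
proof (rule measurable_M_I)
  show "(\<lambda>x. fst (x, \<one>\<^bsub>isom_group (V x)\<^esub>)) \<in> X \<rightarrow>\<^sub>M X" by simp
  show "(x, \<one>\<^bsub>isom_group (V x)\<^esub>) \<in> Sigma (space X) (\<lambda>x. isometries (V x))" if "x \<in> space X" for x
    using that banach_fibre.id_isom[OF fibre] banach_fibre.one_isom_group[OF fibre] by auto
  fix n m
  have "(\<lambda>x. norm_dist (V x) (\<phi> n x) (\<phi> m x)) \<in> borel_measurable X"
    using measurable_dist[OF section_meas[of n] section_meas[of m]] by simp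
  moreover have "norm_dist (V x) (\<one>\<^bsub>isom_group (V x)\<^esub> (\<phi> n x)) (\<phi> m x) = norm_dist (V x) (\<phi> n x) (\<phi> m x)"
    if "x \<in> space X" for x
  proof -
    interpret banach_fibre_dense "V x" "\<lambda>n. \<phi> n x" by (rule fibre_dense[OF that])
    show ?thesis using qC[of n] by (simp add: one_isom_group)
  qed
  ultimately show "(\<lambda>x. norm_dist (V (fst (x, \<one>\<^bsub>isom_group (V x)\<^esub>))) (snd (x, \<one>\<^bsub>isom_group (V x)\<^esub>) (\<phi> n (fst (x, \<one>\<^bsub>isom_group (V x)\<^esub>)))) (\<phi> m (fst (x, \<one>\<^bsub>isom_group (V x)\<^esub>)))) \<in> borel_measurable X"
    by (simp cong: measurable_cong)
qed

text \<open>A countable supremum of distances between evaluations of the two isometries and of their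
  inverses; the latter are available by \<open>iv_field\<close>.\<close>

lemma measurable_rho:
  "(\<lambda>p. banach_fibre_dense.rho (V (fst (fst p))) (\<lambda>n. \<phi> n (fst (fst p))) (snd (fst p)) (snd (snd p)))
    \<in> borel_measurable (fiber_prod M M)"
proof -
  let ?F = "fiber_prod M M"
  note fm = measurable_fst_fiber_prod[of M M] and sm = measurable_snd_fiber_prod[of M M]
  define D where "D n p = norm_dist (V (fst (fst p))) (snd (fst p) (\<phi> n (fst (fst p)))) (snd (snd p) (\<phi> n (fst (fst p))))
    + norm_dist (V (fst (fst p))) (banach_fibre.iv (V (fst (fst p))) (snd (fst p)) (\<phi> n (fst (fst p))))
       (banach_fibre.iv (V (fst (fst p))) (snd (snd p)) (\<phi> n (fst (fst p))))" for n and p :: "('x \<times> ('v \<Rightarrow> 'v)) \<times> 'x \<times> ('v \<Rightarrow> 'v)"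
  have [measurable]: "D n \<in> borel_measurable ?F" for n
  proof -
    have 1: "(\<lambda>p. norm_dist (V (fst (fst p))) (snd (fst p) (\<phi> n (fst (fst p)))) (snd (snd p) (\<phi> n (fst (snd p))))) \<in> borel_measurable ?F"
      using measurable_dist[OF measurable_eval_section[OF fm, of n] measurable_eval_section[OF sm, of n]]
      by (simp add: space_fiber_prod)
    have 2: "(\<lambda>p. norm_dist (V (fst (fst p))) (banach_fibre.iv (V (fst (fst p))) (snd (fst p)) (\<phi> n (fst (fst p))))
       (banach_fibre.iv (V (fst (snd p))) (snd (snd p)) (\<phi> n (fst (snd p))))) \<in> borel_measurable ?F"
      using measurable_dist[OF measurable_eval_section[OF measurable_compose[OF fm iv_field], of n]
          measurable_eval_section[OF measurable_compose[OF sm iv_field], of n]]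
      by (simp add: space_fiber_prod)
    have "D n p = norm_dist (V (fst (fst p))) (snd (fst p) (\<phi> n (fst (fst p)))) (snd (snd p) (\<phi> n (fst (snd p)))) +
      norm_dist (V (fst (fst p))) (banach_fibre.iv (V (fst (fst p))) (snd (fst p)) (\<phi> n (fst (fst p))))
       (banach_fibre.iv (V (fst (snd p))) (snd (snd p)) (\<phi> n (fst (snd p))))" if "p \<in> space ?F" for p
      using that by (simp add: space_fiber_prod D_def)
    then show ?thesis using borel_measurable_add[OF 1 2] by (simp cong: measurable_cong)
  qed
  have "(\<lambda>p. SUP n. min (1 / real (Suc n)) (D n p)) \<in> borel_measurable ?F"
  proof (rule borel_measurable_cSUP)
    show "bdd_above (range (\<lambda>n. min (1 / real (Suc n)) (D n p)))" for p
      by (rule bdd_aboveI2[of _ _ 1]) (auto simp: min_le_iff_disj divide_le_eq)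
  qed auto
  moreover have "(SUP n. min (1 / real (Suc n)) (D n p)) =
      banach_fibre_dense.rho (V (fst (fst p))) (\<lambda>n. \<phi> n (fst (fst p))) (snd (fst p)) (snd (snd p))" if "p \<in> space ?F" for p
  proof -
    have p: "fst p \<in> space M" using that by (auto simp: space_fiber_prod)
    interpret banach_fibre_dense "V (fst (fst p))" "\<lambda>n. \<phi> n (fst (fst p))" using isomE[OF p] .
    show ?thesis by (simp add: rho_def delta_def D_def)
  qed
  ultimately show ?thesis by (simp cong: measurable_cong)
qed

text \<open>Metric, unit, product and inverse are Borel for every field of isometry groups. Dense
  sections are the one ingredient that has to be supplied.\<close>

theorem polish_groups:
  assumes \<psi>: "dense_borel_sections X (\<lambda>x. isom_topology (V x)) M \<psi>"
  shows "borel_field_polish_groups X (\<lambda>x. isom_group (V x)) (\<lambda>x. isom_topology (V x)) M"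
  unfolding borel_field_polish_groups_def
proof (intro conjI measurable_one measurable_mult measurable_inv ballI)
  show "polish_group (isom_group (V x)) (isom_topology (V x))" if "x \<in> space X" for x
    by (rule banach_fibre_dense.polish_group_isom[OF fibre_dense[OF that]])
  show "borel_field_polish X (\<lambda>x. isom_topology (V x)) M"
    unfolding borel_field_polish_def
  proof (intro conjI standard_X standard_M fst_M ballI)
    show "polish_space_on (isom_topology (V x))" if "x \<in> space X" for x
      by (rule banach_fibre_dense.polish_isom[OF fibre_dense[OF that]])
    have top: "topspace (isom_topology (V x)) = isometries (V x)" if "x \<in> space X" for x
      by (rule banach_fibre_dense.topspace_isom[OF fibre_dense[OF that]])
    show "space M = Sigma (space X) (\<lambda>x. topspace (isom_topology (V x)))"
      unfolding space_M using top by auto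
    show "\<exists>\<phi>. dense_borel_sections X (\<lambda>x. isom_topology (V x)) M \<phi>" using \<psi> by blast
    let ?d = "\<lambda>p. banach_fibre_dense.rho (V (fst (fst p))) (\<lambda>n. \<phi> n (fst (fst p))) (snd (fst p)) (snd (snd p))"
    show "\<exists>d. d \<in> borel_measurable (fiber_prod M M) \<and> (\<forall>x\<in>space X.
        let dx = restrict_dist (topspace (isom_topology (V x))) (\<lambda>v w. d ((x, v), x, w))
         in Metric_space (topspace (isom_topology (V x))) dx \<and>
            Metric_space.mcomplete (topspace (isom_topology (V x))) dx \<and>
            Metric_space.mtopology (topspace (isom_topology (V x))) dx = isom_topology (V x))"
    proof (intro exI[of _ ?d] conjI measurable_rho ballI)
      fix x assume x: "x \<in> space X"
      interpret banach_fibre_dense "V x" "\<lambda>n. \<phi> n x" by (rule fibre_dense[OF x])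
      show "let dx = restrict_dist (topspace (isom_topology (V x))) (\<lambda>v w. ?d ((x, v), x, w))
         in Metric_space (topspace (isom_topology (V x))) dx \<and>
            Metric_space.mcomplete (topspace (isom_topology (V x))) dx \<and>
            Metric_space.mtopology (topspace (isom_topology (V x))) dx = isom_topology (V x)"
        using R.Metric_space_axioms mcomplete_isom isom_topology_eq by (simp add: Let_def)
    qed
  qed
qed

lemma restrict_isom_field:
  assumes X0: "X0 \<in> sets X"
  shows "isom_field (restrict_space X X0) V (restrict_space MV {p. fst p \<in> X0}) \<phi> (restrict_space M {p. fst p \<in> X0})"
proof -
  let ?P = "{p. fst p \<in> X0}"
  have X0X: "X0 \<subseteq> space X" using sets.sets_into_space[OF X0] .
  have sp: "space (restrict_space X X0) = X0" using X0X by (auto simp: space_restrict_space)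
  interpret B: banach_field "restrict_space X X0" V "restrict_space MV {p. fst p \<in> X0}" \<phi>
    by (rule restrict_field[OF X0])
  show ?thesis
  proof
    show "isometries (V x) \<subseteq> bounded_ops (V x)" if "x \<in> space (restrict_space X X0)" for x
      using that bounded X0X sp by auto
    show "operator_borel_structure (restrict_space X X0) (restrict_space MV ?P) (\<lambda>x. isometries (V x)) (restrict_space M ?P)"
      unfolding operator_borel_structure_def
    proof (intro conjI)
      have "fst -` X0 \<inter> space M \<in> sets M" by (rule measurable_sets[OF fst_M X0])
      moreover have "fst -` X0 \<inter> space M = ?P \<inter> space M" by auto
      ultimately show "standard_borel (restrict_space M ?P)"
        by (intro standard_borel_restrict'[OF standard_M]) simp
      show "space (restrict_space M ?P) = Sigma (space (restrict_space X X0)) (\<lambda>x. isometries (V x))"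
        unfolding sp using X0X by (auto simp add: space_restrict_space space_M)
      show "fst \<in> restrict_space M ?P \<rightarrow>\<^sub>M restrict_space X X0"
        by (rule measurable_restrict_space12) auto
      have id: "(\<lambda>p. p) \<in> restrict_space M ?P \<rightarrow>\<^sub>M M" "(\<lambda>p. p) \<in> restrict_space MV ?P \<rightarrow>\<^sub>M MV"
        by (rule measurable_restrict_space1, simp)+
      have "(\<lambda>p. (fst (fst p), snd (fst p) (snd (snd p)))) \<in> fiber_prod (restrict_space M ?P) (restrict_space MV ?P) \<rightarrow>\<^sub>M MV"
        by (rule measurable_eval[OF measurable_compose[OF measurable_fst_fiber_prod id(1)]
              measurable_compose[OF measurable_snd_fiber_prod id(2)]]) (simp add: space_fiber_prod)
      then have "(\<lambda>p. (fst (fst p), snd (fst p) (snd (snd p)))) \<in> fiber_prod (restrict_space M ?P) (restrict_space MV ?P) \<rightarrow>\<^sub>M restrict_space MV ?P"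
        by (rule measurable_restrict_space2[rotated]) (auto simp: space_fiber_prod space_restrict_space)
      then show "(\<lambda>((x, T), y, v). (x, T v)) \<in> fiber_prod (restrict_space M ?P) (restrict_space MV ?P) \<rightarrow>\<^sub>M restrict_space MV ?P"
        by (simp add: split_beta')
    qed
  qed
qed

text \<open>For each of the countably many basic conditions \<open>p\<close>, measurable selection
  applies to the Borel set of isometries that satisfy it. The exceptional null sets are discarded
  together; over the remaining base every nonempty basic set contains the value of a
  section.\<close>

theorem measured_field:
  assumes sf: "sigma_finite_measure X"
  shows "measured_field_polish_groups X (\<lambda>x. isom_group (V x)) (\<lambda>x. isom_topology (V x)) M"
proof -
  let ?basic = "\<lambda>x. banach_fibre_dense.basic (V x) (\<lambda>n. \<phi> n x)"
  define B where "B p = {w \<in> space M. snd w \<in> ?basic (fst w) p}" for p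
  have basic: "\<alpha> \<in> ?basic x p \<longleftrightarrow> \<alpha> \<in> isometries (V x) \<and>
      (\<forall>(n, m, k)\<in>set p. norm_dist (V x) (\<alpha> (\<phi> n x)) (\<phi> m x) < 1 / Suc k)" if "x \<in> space X" for x \<alpha> p
    unfolding banach_fibre_dense.basic_def[OF fibre_dense[OF that]] by simp
  have B: "B p \<in> sets M" for p
  proof -
    have [measurable]: "(\<lambda>w. norm_dist (V (fst w)) (snd w (\<phi> n (fst w))) (\<phi> m (fst w))) \<in> borel_measurable M" for n m
      by (rule measurable_dist_section) simp
    have "{w \<in> space M. \<forall>j\<in>set p. norm_dist (V (fst w)) (snd w (\<phi> (fst j) (fst w))) (\<phi> (fst (snd j)) (fst w)) < 1 / Suc (snd (snd j))} \<in> sets M"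
      by measurable
    also have "{w \<in> space M. \<forall>j\<in>set p. norm_dist (V (fst w)) (snd w (\<phi> (fst j) (fst w))) (\<phi> (fst (snd j)) (fst w)) < 1 / Suc (snd (snd j))} = B p"
      unfolding B_def
    proof (intro Collect_cong conj_cong refl)
      fix w assume "w \<in> space M"
      then have "fst w \<in> space X" "snd w \<in> isometries (V (fst w))" by (auto simp: space_M)
      then show "(\<forall>j\<in>set p. norm_dist (V (fst w)) (snd w (\<phi> (fst j) (fst w))) (\<phi> (fst (snd j)) (fst w)) < 1 / Suc (snd (snd j)))
          \<longleftrightarrow> snd w \<in> ?basic (fst w) p"
        using basic[of "fst w" "snd w" p] by (simp add: split_beta)
    qed
    finally show ?thesis .
  qed
  have "\<exists>A N s. A \<in> sets X \<and> N \<in> null_sets X \<and> s \<in> restrict_space X A \<rightarrow>\<^sub>M restrict_space M (B p) \<and>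
      (\<forall>x\<in>A. fst (s x) = x) \<and> fst ` space (restrict_space M (B p)) \<subseteq> A \<union> N" for p
    by (rule measurable_selection[OF standard_borel_restrict[OF standard_M B] standard_X sf])
       (rule measurable_restrict_space1[OF fst_M])
  then obtain A N s where sel: "\<And>p. A p \<in> sets X" "\<And>p. N p \<in> null_sets X"
      "\<And>p. s p \<in> restrict_space X (A p) \<rightarrow>\<^sub>M restrict_space M (B p)"
      "\<And>p x. x \<in> A p \<Longrightarrow> fst (s p x) = x"
      "\<And>p. fst ` space (restrict_space M (B p)) \<subseteq> A p \<union> N p"
    by metis
  have BM: "B p \<subseteq> space M" for p by (auto simp: B_def)
  have AX: "A p \<subseteq> space X" for p using sets.sets_into_space[OF sel(1)] .
  have sB: "s p x \<in> B p" if "x \<in> A p" for p x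
    using measurable_space[OF sel(3)[of p], of x] that AX[of p] BM[of p] by (auto simp: space_restrict_space)
  define N' where "N' = (\<Union>p. N p)"
  have N': "N' \<in> null_sets X" unfolding N'_def by (rule null_sets_UN) (rule sel)
  define X0 where "X0 = space X - N'"
  have X0: "X0 \<in> sets X" "X0 \<subseteq> space X" using N' by (auto simp: X0_def)
  \<comment> \<open>Outside the domain of the selection the unit is taken, so that the section is
    defined and Borel on the whole base.\<close>
  define \<psi> where "\<psi> c x = (if x \<in> A (from_nat c) then snd (s (from_nat c) x) else \<one>\<^bsub>isom_group (V x)\<^esub>)" for c x
  have \<psi>_meas: "(\<lambda>x. (x, \<psi> c x)) \<in> X \<rightarrow>\<^sub>M M" for c
  proof -
    have 1: "s (from_nat c) \<in> restrict_space X (A (from_nat c)) \<rightarrow>\<^sub>M M"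
      using sel(3) measurable_restrict_space2_iff by blast
    have 2: "(\<lambda>x. (x, \<one>\<^bsub>isom_group (V x)\<^esub>)) \<in> restrict_space X {x. x \<notin> A (from_nat c)} \<rightarrow>\<^sub>M M"
      by (rule measurable_restrict_space1[OF measurable_one])
    have "(\<lambda>x. if x \<in> A (from_nat c) then s (from_nat c) x else (x, \<one>\<^bsub>isom_group (V x)\<^esub>)) \<in> X \<rightarrow>\<^sub>M M"
      by (subst measurable_If_restrict_space_iff) (use 1 2 sel(1) in auto)
    moreover have "(if x \<in> A (from_nat c) then s (from_nat c) x else (x, \<one>\<^bsub>isom_group (V x)\<^esub>)) = (x, \<psi> c x)" for x
      using sel(4)[of x "from_nat c"] by (auto simp: \<psi>_def prod_eq_iff)
    ultimately show ?thesis by simp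
  qed
  interpret R: isom_field "restrict_space X X0" V "restrict_space MV {p. fst p \<in> X0}" \<phi> "restrict_space M {p. fst p \<in> X0}"
    by (rule restrict_isom_field[OF X0(1)])
  have sp: "space (restrict_space X X0) = X0" using X0(2) by (auto simp: space_restrict_space)
  have "dense_borel_sections (restrict_space X X0) (\<lambda>x. isom_topology (V x)) (restrict_space M {p. fst p \<in> X0}) \<psi>"
    unfolding dense_borel_sections_def sp
  proof (intro conjI allI ballI)
    show "(\<lambda>x. (x, \<psi> c x)) \<in> restrict_space X X0 \<rightarrow>\<^sub>M restrict_space M {p. fst p \<in> X0}" for c
      by (rule measurable_restrict_space12[OF \<psi>_meas]) auto
    fix x assume x: "x \<in> X0"
    then have xX: "x \<in> space X" using X0 by auto
    interpret banach_fibre_dense "V x" "\<lambda>n. \<phi> n x" by (rule fibre_dense[OF xX])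
    have "isom_topology (V x) closure_of range (\<lambda>c. \<psi> c x) = isometries (V x)"
    proof (rule dense_isomI)
      show "range (\<lambda>c. \<psi> c x) \<subseteq> isometries (V x)"
        using measurable_space[OF \<psi>_meas xX] by (auto simp: space_M)
      fix p assume "basic p \<noteq> {}"
      then obtain \<alpha> where \<alpha>: "\<alpha> \<in> basic p" by blast
      then have "(x, \<alpha>) \<in> B p" using xX basic[OF xX] by (auto simp: B_def space_M)
      then have "x \<in> fst ` space (restrict_space M (B p))" using BM by (force simp: space_restrict_space)
      \<comment> \<open>The point \<open>x\<close> lies in the projection of \<open>B p\<close> and
        avoids the exceptional set, so the selection is defined at \<open>x\<close>.\<close>
      then have "x \<in> A p" using sel(5)[of p] x by (auto simp: X0_def N'_def)
      then have "\<psi> (to_nat p) x \<in> basic p" using sB[of x p] sel(4)[of x p] by (auto simp: \<psi>_def B_def)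
      then show "range (\<lambda>c. \<psi> c x) \<inter> basic p \<noteq> {}" by blast
    qed
    then show "isom_topology (V x) closure_of range (\<lambda>c. \<psi> c x) = topspace (isom_topology (V x))" by simp
  qed
  then have "borel_field_polish_groups (restrict_space X X0) (\<lambda>x. isom_group (V x)) (\<lambda>x. isom_topology (V x))
      (restrict_space M {p. fst p \<in> X0})"
    by (rule R.polish_groups)
  moreover have "space X - X0 \<in> null_sets X"
  proof -
    have "space X - X0 = N'" using null_setsD2[OF N'] sets.sets_into_space by (auto simp: X0_def)
    then show ?thesis using N' by simp
  qed
  moreover have "space M = Sigma (space X) (\<lambda>x. carrier (isom_group (V x)))"
    unfolding space_M using banach_fibre.carrier_isom_group[OF fibre] by (intro Sigma_cong) auto
  ultimately show ?thesis
    unfolding measured_field_polish_groups_def using standard_X sf standard_M fst_M X0(1)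
      banach_fibre_dense.polish_group_isom[OF fibre_dense]
    by blast
qed

end

section \<open>Polish spaces of sequences\<close>

text \<open>A point of a second countable Hausdorff space is determined by the basic open sets that
  contain it, hence by a set of natural numbers, hence by a real. This fits the space to
  \<open>standard_borel\<close>, which speaks of topologies on reals.\<close>

lemma ex_inj_real:
  assumes H: "Hausdorff_space (euclidean :: 'a :: second_countable_topology topology)"
  shows "\<exists>f :: 'a \<Rightarrow> real. inj f"
proof -
  obtain B :: "'a set set" where B: "countable B" "topological_basis B"
    using ex_countable_basis by blast
  obtain b :: "nat set \<Rightarrow> real" where b: "bij b"
    using nat_sets_eqpoll_reals unfolding eqpoll_def by blast
  define c where "c x = {n. x \<in> from_nat_into B n}" for x :: 'a
  have "inj c"
  proof (rule injI, rule ccontr)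
    fix x y :: 'a assume eq: "c x = c y" and "x \<noteq> y"
    then have "\<exists>U W. open U \<and> open W \<and> x \<in> U \<and> y \<in> W \<and> disjnt U W"
      using H by (simp add: Hausdorff_space_def)
    then obtain U where U: "open U" "\<not> (x \<in> U \<longleftrightarrow> y \<in> U)" by (meson disjnt_iff)
    have "\<exists>V\<in>B. \<not> (x \<in> V \<longleftrightarrow> y \<in> V)"
    proof (cases "x \<in> U")
      case True
      then obtain V where "V \<in> B" "x \<in> V" "V \<subseteq> U" using topological_basisE[OF B(2) U(1)] by blast
      then show ?thesis using U True by blast
    next
      case False
      then obtain V where "V \<in> B" "y \<in> V" "V \<subseteq> U" using topological_basisE[OF B(2) U(1), of y] U(2) by blast
      then show ?thesis using U False by blast
    qed
    then obtain n where "\<not> (x \<in> from_nat_into B n \<longleftrightarrow> y \<in> from_nat_into B n)"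
      using from_nat_into_surj[OF B(1)] by metis
    then show False using eq unfolding c_def by blast
  qed
  then have "inj (b \<circ> c)" using b by (meson bij_is_inj inj_compose)
  then show ?thesis by blast
qed

lemma measurable_borel_sigma:
  assumes "continuous_map T T' f"
  shows "f \<in> borel_sigma T \<rightarrow>\<^sub>M borel_sigma T'"
proof (rule measurable_sigma_sets[OF sets_borel_sigma])
  show "{U. openin T' U} \<subseteq> Pow (topspace T')" by (auto dest: openin_subset)
  show "f \<in> space (borel_sigma T) \<rightarrow> topspace T'" using continuous_map_image_subset_topspace[OF assms] by auto
  show "f -` U \<inter> space (borel_sigma T) \<in> sets (borel_sigma T)" if "U \<in> {U. openin T' U}" for U
  proof -
    have "openin T {x\<in>topspace T. f x \<in> U}" using that openin_continuous_map_preimage[OF assms] by blast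
    moreover have "{x\<in>topspace T. f x \<in> U} = f -` U \<inter> space (borel_sigma T)" by auto
    ultimately show ?thesis using borel_sigma_openin by metis
  qed
qed

lemma sets_borel_sigma_euclidean: "sets (borel_sigma euclidean) = sets borel"
  by (simp add: sets_borel_sigma borel_def)

lemma separable_euclidean:
  "separable_space (euclidean :: 'a :: second_countable_topology topology)"
proof -
  obtain D :: "'a set" where D: "countable D" "\<And>X. open X \<Longrightarrow> X \<noteq> {} \<Longrightarrow> \<exists>d\<in>D. d \<in> X"
    by (rule countable_dense_setE) blast
  have "closure D = UNIV"
  proof (rule ccontr)
    assume "closure D \<noteq> UNIV"
    then have "- closure D \<noteq> {}" by auto
    from D(2)[OF _ this] obtain d where "d \<in> D" "d \<notin> closure D" by auto
    then show False using closure_subset by blast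
  qed
  then show ?thesis unfolding separable_space_def using D(1) by (intro exI[of _ D]) auto
qed

lemma completely_metrizable_nat: "completely_metrizable_space (euclidean :: nat topology)"
proof -
  have "(euclidean :: nat topology) = discrete_topology UNIV"
    by (simp add: topology_eq open_discrete)
  then show ?thesis by (simp add: completely_metrizable_space_discrete_topology)
qed

lemma completely_metrizable_fun:
  assumes "completely_metrizable_space (euclidean :: 'a :: topological_space topology)"
  shows "completely_metrizable_space (euclidean :: (nat \<Rightarrow> 'a) topology)"
  unfolding euclidean_product_topology[symmetric] completely_metrizable_space_product_topology
  using assms by simp

lemma completely_metrizable_prod:
  assumes "completely_metrizable_space (euclidean :: 'a :: topological_space topology)"
    and "completely_metrizable_space (euclidean :: 'b :: topological_space topology)"
  shows "completely_metrizable_space (euclidean :: ('a \<times> 'b) topology)"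
  unfolding prod_topology_euclidean[symmetric] completely_metrizable_space_prod_topology
  using assms by simp

lemmas completely_metrizable_intros =
  completely_metrizable_nat completely_metrizable_fun completely_metrizable_prod completely_metrizable_space_euclidean

text \<open>The topology is transported to the range of an injection into the reals, where it is
  again Polish.\<close>

theorem standard_borel_borel:
  assumes metr: "completely_metrizable_space (euclidean :: 'a :: second_countable_topology topology)"
  shows "standard_borel (borel :: 'a measure)"
proof -
  obtain f :: "'a \<Rightarrow> real" where f: "inj f" using ex_inj_real[OF metrizable_imp_Hausdorff_space[OF completely_metrizable_imp_metrizable_space[OF metr]]] by blast
  define g where "g = the_inv f"
  have gf [simp]: "g (f x) = x" for x using f by (simp add: g_def the_inv_f_f)
  define T where "T = pullback_topology (range f) g euclidean"
  have top: "topspace T = range f" by (auto simp: T_def topspace_pullback_topology)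
  have cg: "continuous_map T (euclidean :: 'a topology) g"
    using continuous_map_pullback[of euclidean euclidean id "range f" g] by (simp add: T_def)
  have cf: "continuous_map (euclidean :: 'a topology) T f"
    unfolding T_def by (rule continuous_map_pullback') (auto simp: o_def)
  have hom: "(euclidean :: 'a topology) homeomorphic_space T"
    unfolding homeomorphic_space_def homeomorphic_maps_def
    using cf cg top by (intro exI[of _ f] exI[of _ g]) auto
  have T: "polish_space_on T"
    unfolding polish_space_on_def
    using homeomorphic_completely_metrizable_space[OF hom] homeomorphic_separable_space[OF hom]
      separable_euclidean[where 'a='a] metr by blast
  have B: "range f \<in> sets (borel_sigma T)" using top borel_sigma_openin[OF openin_topspace, of T] by simp
  show ?thesis
    unfolding standard_borel_def
  proof (intro exI[of _ T] exI[of _ "range f"] exI[of _ f] exI[of _ g] conjI T B)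
    show "f \<in> borel \<rightarrow>\<^sub>M restrict_space (borel_sigma T) (range f)"
      using measurable_borel_sigma[OF cf]
      by (intro measurable_restrict_space2) (auto simp: measurable_cong_sets[OF sets_borel_sigma_euclidean refl])
    show "g \<in> restrict_space (borel_sigma T) (range f) \<rightarrow>\<^sub>M borel"
      using measurable_borel_sigma[OF cg]
      by (intro measurable_restrict_space1) (auto simp: measurable_cong_sets[OF refl sets_borel_sigma_euclidean])
  qed auto
qed

section \<open>Clique spaces\<close>

definition clique :: "(nat \<Rightarrow> nat \<Rightarrow> bool) \<Rightarrow> nat set \<Rightarrow> bool" where
  "clique R C \<longleftrightarrow> finite C \<and> (\<forall>s\<in>C. \<forall>t\<in>C. s \<noteq> t \<longrightarrow> R s t)"

definition mass :: "nat set \<Rightarrow> (nat \<Rightarrow> complex) \<Rightarrow> real" where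
  "mass C v = (\<Sum>t\<in>C. cmod (v t))"

text \<open>The closure of the finitely supported vectors for the norm that is the supremum of the
  masses on finite cliques of the graph \<open>R\<close>.\<close>

definition clique_vectors :: "(nat \<Rightarrow> nat \<Rightarrow> bool) \<Rightarrow> (nat \<Rightarrow> complex) set" where
  "clique_vectors R = {v. \<forall>e>0. \<exists>m. \<forall>C. clique R C \<and> C \<inter> {..<m} = {} \<longrightarrow> mass C v \<le> e}"

definition clique_norm :: "(nat \<Rightarrow> nat \<Rightarrow> bool) \<Rightarrow> (nat \<Rightarrow> complex) \<Rightarrow> real" where
  "clique_norm R v = (SUP C\<in>Collect (clique R). mass C v)"

definition clique_space :: "(nat \<Rightarrow> nat \<Rightarrow> bool) \<Rightarrow> (nat \<Rightarrow> complex) cnormed_space" where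
  "clique_space R = \<lparr>carrier = clique_vectors R, mult = (\<lambda>v w. v), one = (\<lambda>t. 0), zero = (\<lambda>t. 0),
     add = (\<lambda>v w t. v t + w t), smult = (\<lambda>c v t. c * v t), vnorm = clique_norm R\<rparr>"

definition trunc :: "nat \<Rightarrow> (nat \<Rightarrow> complex) \<Rightarrow> nat \<Rightarrow> complex" where
  "trunc m v = (\<lambda>t. if t < m then v t else 0)"

definition unit_vec :: "nat \<Rightarrow> nat \<Rightarrow> complex" where
  "unit_vec j = (\<lambda>t. if t = j then 1 else 0)"

lemma clique_space_simps [simp]:
  "carrier (clique_space R) = clique_vectors R"
  "zero (clique_space R) = (\<lambda>t. 0)"
  "add (clique_space R) = (\<lambda>v w t. v t + w t)"
  "smult (clique_space R) = (\<lambda>c v t. c * v t)"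
  "vnorm (clique_space R) = clique_norm R"
  by (simp_all add: clique_space_def)

lemma mass_nonneg: "0 \<le> mass C v"
  by (auto simp: mass_def intro: sum_nonneg)

lemma mass_add: "mass C (\<lambda>t. v t + w t) \<le> mass C v + mass C w"
  unfolding mass_def sum.distrib[symmetric] by (intro sum_mono norm_triangle_ineq)

lemma mass_diff: "mass C (\<lambda>t. v t - w t) \<le> mass C v + mass C w"
  unfolding mass_def sum.distrib[symmetric] by (intro sum_mono norm_triangle_ineq4)

lemma mass_scale: "mass C (\<lambda>t. c * v t) = cmod c * mass C v"
  by (simp add: mass_def norm_mult sum_distrib_left)

lemma mass_mono: "finite D \<Longrightarrow> C \<subseteq> D \<Longrightarrow> mass C v \<le> mass D v"
  unfolding mass_def by (intro sum_mono2) auto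

lemma mass_split: "finite C \<Longrightarrow> mass C v = mass (C \<inter> A) v + mass (C - A) v"
  unfolding mass_def by (metis sum.Int_Diff)

lemma clique_subset: "clique R C \<Longrightarrow> D \<subseteq> C \<Longrightarrow> clique R D"
  unfolding clique_def by (meson finite_subset subset_iff)

lemma clique_empty [simp]: "clique R {}" and clique_single [simp]: "clique R {t}"
  by (auto simp: clique_def)

lemma clique_finite: "clique R C \<Longrightarrow> finite C"
  by (simp add: clique_def)

lemma clique_vectorsD:
  "v \<in> clique_vectors R \<Longrightarrow> e > 0 \<Longrightarrow> \<exists>m. \<forall>C. clique R C \<longrightarrow> mass (C - {..<m}) v \<le> e"
  unfolding clique_vectors_def using clique_subset[of R _ "_ - {..<_}"] by blast

lemma bdd_mass:
  assumes "v \<in> clique_vectors R"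
  shows "bdd_above ((\<lambda>C. mass C v) ` Collect (clique R))"
proof -
  obtain m where m: "\<And>C. clique R C \<Longrightarrow> mass (C - {..<m}) v \<le> 1"
    using clique_vectorsD[OF assms, of 1] by auto
  have "mass C v \<le> mass {..<m} v + 1" if "clique R C" for C
  proof -
    have "mass (C \<inter> {..<m}) v \<le> mass {..<m} v" by (rule mass_mono) auto
    then show ?thesis using m[OF that] mass_split[OF clique_finite[OF that], of v "{..<m}"] by linarith
  qed
  then show ?thesis by (intro bdd_aboveI2) auto
qed

lemma mass_le_norm: "v \<in> clique_vectors R \<Longrightarrow> clique R C \<Longrightarrow> mass C v \<le> clique_norm R v"
  unfolding clique_norm_def using bdd_mass by (intro cSUP_upper) auto

lemma clique_norm_le: "(\<And>C. clique R C \<Longrightarrow> mass C v \<le> b) \<Longrightarrow> clique_norm R v \<le> b"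
  unfolding clique_norm_def by (intro cSUP_least) (auto intro: exI[of _ "{}"])

lemma clique_norm_le_iff:
  "v \<in> clique_vectors R \<Longrightarrow> clique_norm R v \<le> b \<longleftrightarrow> (\<forall>C. clique R C \<longrightarrow> mass C v \<le> b)"
  using mass_le_norm clique_norm_le by (meson order_trans)

lemma clique_norm_nonneg: "v \<in> clique_vectors R \<Longrightarrow> 0 \<le> clique_norm R v"
  using mass_le_norm[of v R "{}"] by (simp add: mass_def)

lemma coord_le_norm: "v \<in> clique_vectors R \<Longrightarrow> cmod (v t) \<le> clique_norm R v"
  using mass_le_norm[of v R "{t}"] by (simp add: mass_def)

lemma clique_vectorsI:
  assumes "\<And>e. e > 0 \<Longrightarrow> \<exists>m. \<forall>C. clique R C \<longrightarrow> mass (C - {..<m}) v \<le> e"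
  shows "v \<in> clique_vectors R"
  unfolding clique_vectors_def
proof (intro CollectI allI impI)
  fix e :: real assume "e > 0"
  then obtain m where m: "\<And>C. clique R C \<Longrightarrow> mass (C - {..<m}) v \<le> e" using assms by meson
  have "mass C v \<le> e" if "clique R C \<and> C \<inter> {..<m} = {}" for C
    using m[of C] that by (simp add: Diff_triv)
  then show "\<exists>m. \<forall>C. clique R C \<and> C \<inter> {..<m} = {} \<longrightarrow> mass C v \<le> e" by blast
qed

lemma clique_vectors_comb:
  assumes v: "v \<in> clique_vectors R" and w: "w \<in> clique_vectors R"
  shows "(\<lambda>t. v t + w t) \<in> clique_vectors R" "(\<lambda>t. v t - w t) \<in> clique_vectors R"
proof -
  have "\<exists>m. \<forall>C. clique R C \<longrightarrow> mass (C - {..<m}) v + mass (C - {..<m}) w \<le> e" if "e > 0" for e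
  proof -
    obtain m where m: "\<And>C. clique R C \<Longrightarrow> mass (C - {..<m}) v \<le> e / 2"
      using clique_vectorsD[OF v, of "e/2"] \<open>e > 0\<close> by auto
    obtain n where n: "\<And>C. clique R C \<Longrightarrow> mass (C - {..<n}) w \<le> e / 2"
      using clique_vectorsD[OF w, of "e/2"] \<open>e > 0\<close> by auto
    have "mass (C - {..<max m n}) v + mass (C - {..<max m n}) w \<le> e" if C: "clique R C" for C
    proof -
      have "mass (C - {..<max m n}) v \<le> mass (C - {..<m}) v" "mass (C - {..<max m n}) w \<le> mass (C - {..<n}) w"
        using clique_finite[OF C] by (auto intro!: mass_mono)
      then show ?thesis using m[OF C] n[OF C] by linarith
    qed
    then show ?thesis by blast
  qed
  note tail = this
  show "(\<lambda>t. v t + w t) \<in> clique_vectors R"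
  proof (rule clique_vectorsI)
    fix e :: real assume "e > 0"
    then obtain m where "\<And>C. clique R C \<Longrightarrow> mass (C - {..<m}) v + mass (C - {..<m}) w \<le> e" using tail by meson
    then show "\<exists>m. \<forall>C. clique R C \<longrightarrow> mass (C - {..<m}) (\<lambda>t. v t + w t) \<le> e"
      using order_trans[OF mass_add] by blast
  qed
  show "(\<lambda>t. v t - w t) \<in> clique_vectors R"
  proof (rule clique_vectorsI)
    fix e :: real assume "e > 0"
    then obtain m where "\<And>C. clique R C \<Longrightarrow> mass (C - {..<m}) v + mass (C - {..<m}) w \<le> e" using tail by meson
    then show "\<exists>m. \<forall>C. clique R C \<longrightarrow> mass (C - {..<m}) (\<lambda>t. v t - w t) \<le> e"
      using order_trans[OF mass_diff] by blast
  qed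
qed

lemma clique_vectors_scale:
  assumes "v \<in> clique_vectors R"
  shows "(\<lambda>t. c * v t) \<in> clique_vectors R"
proof (rule clique_vectorsI)
  fix e :: real assume e: "e > 0"
  have "e / (cmod c + 1) > 0" using e by (auto intro!: divide_pos_pos add_nonneg_pos)
  then obtain m where m: "\<And>C. clique R C \<Longrightarrow> mass (C - {..<m}) v \<le> e / (cmod c + 1)"
    using clique_vectorsD[OF assms] by meson
  have "mass (C - {..<m}) (\<lambda>t. c * v t) \<le> e" if C: "clique R C" for C
  proof -
    have "cmod c * mass (C - {..<m}) v \<le> (cmod c + 1) * mass (C - {..<m}) v"
      by (intro mult_right_mono mass_nonneg) auto
    also have "\<dots> \<le> (cmod c + 1) * (e / (cmod c + 1))"
      by (intro mult_left_mono m C) auto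
    also have "\<dots> = e" by (simp add: add_nonneg_eq_0_iff)
    finally show ?thesis by (simp add: mass_scale)
  qed
  then show "\<exists>m. \<forall>C. clique R C \<longrightarrow> mass (C - {..<m}) (\<lambda>t. c * v t) \<le> e" by blast
qed

lemma clique_vectors_finite:
  assumes "\<And>t. t \<ge> m \<Longrightarrow> v t = 0"
  shows "v \<in> clique_vectors R"
  by (rule clique_vectorsI) (auto intro!: exI[of _ m] simp: mass_def assms sum.neutral less_imp_le)

lemma trunc_clique [simp]: "trunc m v \<in> clique_vectors R"
  by (rule clique_vectors_finite[of m]) (simp add: trunc_def)

lemma unit_clique [simp]: "unit_vec j \<in> clique_vectors R"
  by (rule clique_vectors_finite[of "Suc j"]) (simp add: unit_vec_def)

lemma zero_clique [simp]: "(\<lambda>t. 0) \<in> clique_vectors R"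
  by (rule clique_vectors_finite[of 0]) simp

lemma clique_norm_add:
  "v \<in> clique_vectors R \<Longrightarrow> w \<in> clique_vectors R \<Longrightarrow>
    clique_norm R (\<lambda>t. v t + w t) \<le> clique_norm R v + clique_norm R w"
  by (rule clique_norm_le, rule order_trans[OF mass_add]) (intro add_mono mass_le_norm)

lemma clique_norm_scale:
  assumes v: "v \<in> clique_vectors R"
  shows "clique_norm R (\<lambda>t. c * v t) = cmod c * clique_norm R v"
proof (rule antisym)
  show "clique_norm R (\<lambda>t. c * v t) \<le> cmod c * clique_norm R v"
    by (rule clique_norm_le) (simp add: mass_scale mult_left_mono mass_le_norm[OF v])
  show "cmod c * clique_norm R v \<le> clique_norm R (\<lambda>t. c * v t)"
  proof (cases "c = 0")
    case True
    then show ?thesis using clique_norm_nonneg[OF clique_vectors_scale[OF v, of c]] by simp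
  next
    case False
    have "clique_norm R v \<le> clique_norm R (\<lambda>t. c * v t) / cmod c"
    proof (rule clique_norm_le)
      fix C assume "clique R C"
      from mass_le_norm[OF clique_vectors_scale[OF v] this, of c]
      show "mass C v \<le> clique_norm R (\<lambda>t. c * v t) / cmod c"
        using False by (simp add: mass_scale field_simps)
    qed
    then show ?thesis using False by (simp add: field_simps)
  qed
qed

lemma clique_norm_diff_commute: "clique_norm R (\<lambda>t. v t - w t) = clique_norm R (\<lambda>t. w t - v t)"
  unfolding clique_norm_def mass_def by (simp add: norm_minus_commute)

lemma clique_norm_mono_coord:
  assumes "w \<in> clique_vectors R" "\<And>t. cmod (v t) \<le> cmod (w t)"
  shows "clique_norm R v \<le> clique_norm R w"
proof (rule clique_norm_le)
  fix C assume "clique R C"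
  have "mass C v \<le> mass C w" unfolding mass_def by (intro sum_mono assms)
  also have "\<dots> \<le> clique_norm R w" by (rule mass_le_norm) fact+
  finally show "mass C v \<le> clique_norm R w" .
qed

lemma trunc_norm_le: "v \<in> clique_vectors R \<Longrightarrow> clique_norm R (trunc n v) \<le> clique_norm R v"
  by (rule clique_norm_mono_coord) (auto simp: trunc_def)

lemma trunc_tendsto:
  assumes "v \<in> clique_vectors R" "e > 0"
  shows "\<exists>m. \<forall>n\<ge>m. clique_norm R (\<lambda>t. v t - trunc n v t) \<le> e"
proof -
  obtain m where m: "\<And>C. clique R C \<Longrightarrow> mass (C - {..<m}) v \<le> e"
    using clique_vectorsD[OF assms] by blast
  have "clique_norm R (\<lambda>t. v t - trunc n v t) \<le> e" if "n \<ge> m" for n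
  proof (rule clique_norm_le)
    fix C assume C: "clique R C"
    have "mass C (\<lambda>t. v t - trunc n v t) = mass (C - {..<n}) v"
      unfolding mass_def using clique_finite[OF C]
      by (intro sum.mono_neutral_cong_right) (auto simp: trunc_def)
    also have "\<dots> \<le> mass (C - {..<m}) v" using that clique_finite[OF C] by (intro mass_mono) auto
    finally show "mass C (\<lambda>t. v t - trunc n v t) \<le> e" using m[OF C] by linarith
  qed
  then show ?thesis by blast
qed

lemma tendsto_mass: "(\<And>t. (\<lambda>k. f k t) \<longlonglongrightarrow> g t) \<Longrightarrow> (\<lambda>k. mass C (f k)) \<longlonglongrightarrow> mass C g"
  unfolding mass_def by (intro tendsto_sum tendsto_norm)

text \<open>The limit is taken in each coordinate. The mass on a finite clique passes to this limit,
  and the resulting estimate is uniform over all cliques. Coordinatewise convergence is part of the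
  result because operators will be constructed by coordinates.\<close>

lemma clique_complete:
  assumes f: "\<And>k. f k \<in> clique_vectors R"
    and Cau: "\<And>e. e > 0 \<Longrightarrow> \<exists>N. \<forall>m\<ge>N. \<forall>n\<ge>N. clique_norm R (\<lambda>t. f m t - f n t) \<le> e"
  shows "\<exists>g\<in>clique_vectors R. (\<forall>t. (\<lambda>k. f k t) \<longlonglongrightarrow> g t) \<and>
    (\<forall>e>0. \<exists>N. \<forall>n\<ge>N. clique_norm R (\<lambda>t. f n t - g t) \<le> e)"
proof -
  have "Cauchy (\<lambda>k. f k t)" for t
  proof (rule CauchyI)
    fix e :: real assume "e > 0"
    then obtain N where N: "\<And>m n. m \<ge> N \<Longrightarrow> n \<ge> N \<Longrightarrow> clique_norm R (\<lambda>t. f m t - f n t) \<le> e / 2"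
      using Cau[of "e/2"] by auto
    have "cmod (f m t - f n t) < e" if "m \<ge> N" "n \<ge> N" for m n
      using N[OF that] coord_le_norm[OF clique_vectors_comb(2)[OF f[of m] f[of n]], of t] \<open>e > 0\<close> by simp
    then show "\<exists>N. \<forall>m\<ge>N. \<forall>n\<ge>N. norm (f m t - f n t) < e" by blast
  qed
  then have "\<forall>t. \<exists>l. (\<lambda>k. f k t) \<longlonglongrightarrow> l" by (simp add: Cauchy_convergent_iff convergent_def)
  then obtain g where g: "\<And>t. (\<lambda>k. f k t) \<longlonglongrightarrow> g t" by metis
  have lim: "\<exists>N. \<forall>n\<ge>N. \<forall>C. clique R C \<longrightarrow> mass C (\<lambda>t. f n t - g t) \<le> e" if e: "e > 0" for e
  proof -
    obtain N where N: "\<And>m n. m \<ge> N \<Longrightarrow> n \<ge> N \<Longrightarrow> clique_norm R (\<lambda>t. f m t - f n t) \<le> e"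
      using Cau[OF e] by auto
    have "mass C (\<lambda>t. f n t - g t) \<le> e" if n: "n \<ge> N" and C: "clique R C" for n C
    proof (rule LIMSEQ_le_const2)
      show "(\<lambda>m. mass C (\<lambda>t. f n t - f m t)) \<longlonglongrightarrow> mass C (\<lambda>t. f n t - g t)"
        by (intro tendsto_mass tendsto_diff tendsto_const g)
      show "\<exists>N. \<forall>m\<ge>N. mass C (\<lambda>t. f n t - f m t) \<le> e"
        using N n mass_le_norm[OF clique_vectors_comb(2)[OF f f] C] by (meson order_trans)
    qed
    then show ?thesis by blast
  qed
  have "g \<in> clique_vectors R"
  proof (rule clique_vectorsI)
    fix e :: real assume e: "e > 0"
    obtain n where n: "\<And>C. clique R C \<Longrightarrow> mass C (\<lambda>t. f n t - g t) \<le> e / 2"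
      using lim[of "e/2"] e by auto
    obtain m where m: "\<And>C. clique R C \<Longrightarrow> mass (C - {..<m}) (f n) \<le> e / 2"
      using clique_vectorsD[OF f, of "e/2" n] e by auto
    have "mass (C - {..<m}) g \<le> e" if C: "clique R C" for C
    proof -
      have "mass (C - {..<m}) g = mass (C - {..<m}) (\<lambda>t. f n t - (f n t - g t))" by simp
      also have "\<dots> \<le> mass (C - {..<m}) (f n) + mass (C - {..<m}) (\<lambda>t. f n t - g t)" by (rule mass_diff)
      also have "\<dots> \<le> e / 2 + e / 2"
        using C by (intro add_mono m n clique_subset[OF C]) auto
      finally show ?thesis by simp
    qed
    then show "\<exists>m. \<forall>C. clique R C \<longrightarrow> mass (C - {..<m}) g \<le> e" by blast
  qed
  moreover have "\<exists>N. \<forall>n\<ge>N. clique_norm R (\<lambda>t. f n t - g t) \<le> e" if "e > 0" for e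
    using lim[OF that] clique_norm_le by meson
  ultimately show ?thesis using g by blast
qed

section \<open>Clique spaces as separable Banach spaces\<close>

lemma module_clique_space: "Module.module (ring_of_type_algebra :: complex ring) (clique_space R)"
proof (rule moduleI)
  show "cring (ring_of_type_algebra :: complex ring)" by (rule cring_from_type_algebra)
  show "abelian_group (clique_space R)"
  proof (rule abelian_groupI)
    fix v assume v: "v \<in> carrier (clique_space R)"
    show "\<exists>w\<in>carrier (clique_space R). w \<oplus>\<^bsub>clique_space R\<^esub> v = \<zero>\<^bsub>clique_space R\<^esub>"
      using clique_vectors_scale[of v R "-1"] v by (intro bexI[of _ "\<lambda>t. - 1 * v t"]) auto
  qed (auto simp: clique_vectors_comb add.assoc add.commute)
qed (auto simp: ring_of_type_algebra_def clique_vectors_scale algebra_simps)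

lemma minus_clique_space:
  assumes v: "v \<in> clique_vectors R" and w: "w \<in> clique_vectors R"
  shows "v \<ominus>\<^bsub>clique_space R\<^esub> w = (\<lambda>t. v t - w t)"
proof -
  interpret Module.module "ring_of_type_algebra :: complex ring" "clique_space R" by (rule module_clique_space)
  have "\<ominus>\<^bsub>clique_space R\<^esub> w = (\<lambda>t. - 1 * w t)"
    using clique_vectors_scale[OF w, of "-1"] w by (intro M.minus_equality) auto
  then show ?thesis by (simp add: a_minus_def)
qed

lemma dist_clique_space:
  "norm_dist (clique_space R) = restrict_dist (clique_vectors R) (\<lambda>v w. clique_norm R (\<lambda>t. v t - w t))"
  by (auto simp: norm_dist_def restrict_dist_def minus_clique_space fun_eq_iff)

lemma dist_clique_space':
  "v \<in> clique_vectors R \<Longrightarrow> w \<in> clique_vectors R \<Longrightarrow>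
    norm_dist (clique_space R) v w = clique_norm R (\<lambda>t. v t - w t)"
  by (simp add: dist_clique_space restrict_dist_def)

lemma clique_norm_eq_0: 
  assumes "v \<in> clique_vectors R"
  shows "clique_norm R v = 0 \<longleftrightarrow> v = (\<lambda>t. 0)"
proof
  assume "clique_norm R v = 0"
  then have "cmod (v t) \<le> 0" for t using coord_le_norm[OF assms, of t] by simp
  then show "v = (\<lambda>t. 0)" by auto
next
  assume "v = (\<lambda>t. 0)"
  then have "clique_norm R v \<le> 0" by (intro clique_norm_le) (simp add: mass_def)
  then show "clique_norm R v = 0" using clique_norm_nonneg[OF assms] by simp
qed

lemma metric_clique_space: "Metric_space (clique_vectors R) (norm_dist (clique_space R))"
proof
  fix x y z
  show "0 \<le> norm_dist (clique_space R) x y"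
    by (auto simp: dist_clique_space restrict_dist_def intro!: clique_norm_nonneg clique_vectors_comb)
  show "norm_dist (clique_space R) x y = norm_dist (clique_space R) y x"
    using clique_norm_diff_commute[of R x y] by (simp add: dist_clique_space restrict_dist_def)
  show "norm_dist (clique_space R) x y = 0 \<longleftrightarrow> x = y" if "x \<in> clique_vectors R" "y \<in> clique_vectors R"
    using that clique_norm_eq_0[OF clique_vectors_comb(2)[OF that]] by (auto simp: dist_clique_space' fun_eq_iff)
  show "norm_dist (clique_space R) x z \<le> norm_dist (clique_space R) x y + norm_dist (clique_space R) y z"
    if "x \<in> clique_vectors R" "y \<in> clique_vectors R" "z \<in> clique_vectors R"
    using clique_norm_add[OF clique_vectors_comb(2)[OF that(1,2)] clique_vectors_comb(2)[OF that(2,3)]] that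
    by (simp add: dist_clique_space')
qed

text \<open>The finitely supported vectors with entries in Q(i). They do not depend on the graph, so
  they form constant dense sections of every field of clique spaces.\<close>

definition rat_vec :: "nat \<Rightarrow> nat \<Rightarrow> complex" where
  "rat_vec i t = (let l = (from_nat i :: (rat \<times> rat) list) in
    if t < length l then Complex (of_rat (fst (l ! t))) (of_rat (snd (l ! t))) else 0)"

lemma rat_vec_approx:
  assumes "e > 0"
  shows "\<exists>i. (\<forall>t\<ge>n. rat_vec i t = 0) \<and> (\<forall>t<n. cmod (rat_vec i t - w t) < e)"
proof -
  have "\<exists>ab. cmod (Complex (of_rat (fst ab)) (of_rat (snd ab)) - w t) < e" for t
  proof -
    obtain a where a: "Re (w t) - e / 2 < of_rat a" "of_rat a < Re (w t) + e / 2"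
      using of_rat_dense[of "Re (w t) - e / 2" "Re (w t) + e / 2"] assms by auto
    obtain b where b: "Im (w t) - e / 2 < of_rat b" "of_rat b < Im (w t) + e / 2"
      using of_rat_dense[of "Im (w t) - e / 2" "Im (w t) + e / 2"] assms by auto
    have "cmod (Complex (of_rat a) (of_rat b) - w t) \<le> \<bar>of_rat a - Re (w t)\<bar> + \<bar>of_rat b - Im (w t)\<bar>"
      using cmod_le[of "Complex (of_rat a) (of_rat b) - w t"] by simp
    also have "\<dots> < e" using a b by linarith
    finally show ?thesis by (intro exI[of _ "(a, b)"]) simp
  qed
  then obtain ab where ab: "\<And>t. cmod (Complex (of_rat (fst (ab t))) (of_rat (snd (ab t))) - w t) < e" by metis
  show ?thesis
    using ab by (intro exI[of _ "to_nat (map ab [0..<n])"]) (auto simp: rat_vec_def Let_def)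
qed

lemma rat_vec_clique [simp]: "rat_vec i \<in> clique_vectors R"
  by (rule clique_vectors_finite[of "length (from_nat i :: (rat \<times> rat) list)"]) (simp add: rat_vec_def Let_def)

lemma mass_le_card:
  fixes n :: nat and e :: real
  assumes "finite C" "\<And>t. t \<in> C \<Longrightarrow> t < n" "\<And>t. t < n \<Longrightarrow> cmod (v t) \<le> e" "e \<ge> 0"
  shows "mass C v \<le> n * e"
proof -
  have "C \<subseteq> {..<n}" using assms by auto
  then have "card C \<le> n" using card_mono[of "{..<n}" C] by simp
  have "mass C v \<le> (\<Sum>t\<in>C. e)" unfolding mass_def using assms by (intro sum_mono) auto
  also have "\<dots> \<le> n * e" using \<open>card C \<le> n\<close> assms(4) by (simp add: mult_right_mono)
  finally show ?thesis .
qed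

lemma rat_vec_dense:
  assumes v: "v \<in> clique_vectors R" and e: "e > 0"
  shows "\<exists>i. norm_dist (clique_space R) (rat_vec i) v < e"
proof -
  obtain m where m: "\<And>C. clique R C \<Longrightarrow> mass (C - {..<m}) v \<le> e / 3"
    using clique_vectorsD[OF v, of "e/3"] e by auto
  \<comment> \<open>The \<open>m\<close> errors add up to at most \<open>e / 3\<close>;
    \<open>m + 1\<close> in place of \<open>m\<close> keeps the denominator positive.\<close>
  obtain i where i: "\<And>t. t \<ge> m \<Longrightarrow> rat_vec i t = 0" "\<And>t. t < m \<Longrightarrow> cmod (rat_vec i t - v t) < e / (3 * (m + 1))"
    using rat_vec_approx[of "e / (3 * (m + 1))" m v] e by auto
  have "clique_norm R (\<lambda>t. rat_vec i t - v t) \<le> e / 3 + e / 3"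
  proof (rule clique_norm_le)
    fix C assume C: "clique R C"
    have "mass (C \<inter> {..<m}) (\<lambda>t. rat_vec i t - v t) \<le> m * (e / (3 * (m + 1)))"
      using clique_finite[OF C] i(2) e by (intro mass_le_card) (auto intro: less_imp_le)
    also have "\<dots> \<le> e / 3" using e by (simp add: field_simps)
    finally have "mass (C \<inter> {..<m}) (\<lambda>t. rat_vec i t - v t) \<le> e / 3" .
    moreover have "mass (C - {..<m}) (\<lambda>t. rat_vec i t - v t) = mass (C - {..<m}) v"
      unfolding mass_def using i(1) by (intro sum.cong) auto
    ultimately show "mass C (\<lambda>t. rat_vec i t - v t) \<le> e / 3 + e / 3"
      using m[OF C] mass_split[OF clique_finite[OF C], of _ "{..<m}"] by (metis add_mono)
  qed
  then show ?thesis using v e by (intro exI[of _ i]) (simp add: dist_clique_space')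
qed

theorem separable_banach_clique_space: "separable_banach_space (clique_space R)"
proof -
  interpret Metric_space "clique_vectors R" "norm_dist (clique_space R)" by (rule metric_clique_space)
  have "mcomplete"
    unfolding mcomplete_def
  proof (intro allI impI)
    fix f assume f: "MCauchy f"
    then have fR: "f k \<in> clique_vectors R" for k by (auto simp: MCauchy_def)
    have "\<exists>N. \<forall>m\<ge>N. \<forall>n\<ge>N. clique_norm R (\<lambda>t. f m t - f n t) \<le> e" if "e > 0" for e
    proof -
      obtain N where "\<forall>m n. N \<le> m \<longrightarrow> N \<le> n \<longrightarrow> norm_dist (clique_space R) (f m) (f n) < e"
        using f \<open>e > 0\<close> unfolding MCauchy_def by blast
      then show ?thesis using fR by (intro exI[of _ N]) (auto simp: dist_clique_space' intro: less_imp_le)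
    qed
    from clique_complete[of f R, OF fR this]
    obtain g where g: "g \<in> clique_vectors R" "\<And>e. e > 0 \<Longrightarrow> \<exists>N. \<forall>n\<ge>N. clique_norm R (\<lambda>t. f n t - g t) \<le> e"
      by blast
    have "limitin mtopology f g sequentially"
      unfolding limit_metric_sequentially
    proof (intro conjI allI impI g(1))
      fix e :: real assume "e > 0"
      then obtain N where N: "\<And>n. n \<ge> N \<Longrightarrow> clique_norm R (\<lambda>t. f n t - g t) \<le> e / 2" using g(2)[of "e/2"] by auto
      have "f n \<in> clique_vectors R \<and> norm_dist (clique_space R) (f n) g < e" if "n \<ge> N" for n
        using N[OF that] \<open>e > 0\<close> fR g(1) by (simp add: dist_clique_space')
      then show "\<exists>N. \<forall>n\<ge>N. f n \<in> clique_vectors R \<and> norm_dist (clique_space R) (f n) g < e" by blast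
    qed
    then show "\<exists>x. limitin mtopology f x sequentially" by blast
  qed
  moreover have "separable_space (norm_topology (clique_space R))"
    unfolding separable_space_def
  proof (intro exI[of _ "range rat_vec"] conjI)
    show "norm_topology (clique_space R) closure_of range rat_vec = topspace (norm_topology (clique_space R))"
      using rat_vec_dense[of _ R]
      unfolding norm_topology_def clique_space_simps metric_closure_of by (auto simp: commute)
  qed (auto simp: norm_topology_def)
  ultimately show ?thesis
    unfolding separable_banach_space_def
    using clique_norm_nonneg clique_norm_eq_0 clique_norm_scale clique_norm_add module_clique_space by auto
qed

lemma banach_fibre_clique: "banach_fibre (clique_space R)"
  by (rule banach_fibre.intro) (rule separable_banach_clique_space)

lemma banach_fibre_dense_clique: "banach_fibre_dense (clique_space R) rat_vec"
  by (intro banach_fibre_dense.intro banach_fibre_clique banach_fibre_dense_axioms.intro)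
     (simp_all add: rat_vec_dense)

lemma borel_coord: "(\<lambda>f :: nat \<Rightarrow> 'a :: topological_space. f i) \<in> borel_measurable borel"
  by (rule measurable_product_coordinates)

lemma pair_borel_coord [measurable]:
  "(\<lambda>p :: (nat \<Rightarrow> nat) \<times> (nat \<Rightarrow> complex). snd p t) \<in> borel_measurable borel"
  "(\<lambda>p :: (nat \<Rightarrow> nat) \<times> (nat \<Rightarrow> nat \<Rightarrow> complex). snd p j t) \<in> borel_measurable borel"
proof -
  have 1: "snd \<in> borel_measurable (borel :: ((nat \<Rightarrow> nat) \<times> (nat \<Rightarrow> complex)) measure)"
    by (intro borel_measurable_continuous_onI continuous_intros)
  show "(\<lambda>p :: (nat \<Rightarrow> nat) \<times> (nat \<Rightarrow> complex). snd p t) \<in> borel_measurable borel"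
    by (rule measurable_compose[OF 1 borel_coord])
  have 2: "snd \<in> borel_measurable (borel :: ((nat \<Rightarrow> nat) \<times> (nat \<Rightarrow> nat \<Rightarrow> complex)) measure)"
    by (intro borel_measurable_continuous_onI continuous_intros)
  show "(\<lambda>p :: (nat \<Rightarrow> nat) \<times> (nat \<Rightarrow> nat \<Rightarrow> complex). snd p j t) \<in> borel_measurable borel"
    by (rule measurable_compose[OF measurable_compose[OF 2 borel_coord] borel_coord])
qed

lemma fst_borel [measurable]:
  "fst \<in> borel_measurable (borel :: ('a :: topological_space \<times> 'b :: topological_space) measure)"
  by (intro borel_measurable_continuous_onI continuous_intros)

section \<open>Bounded operators on clique spaces as matrices\<close>

definition comb :: "nat \<Rightarrow> (nat \<Rightarrow> complex) \<Rightarrow> (nat \<Rightarrow> nat \<Rightarrow> complex) \<Rightarrow> nat \<Rightarrow> complex" where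
  "comb n w a = (\<lambda>t. \<Sum>j<n. w j * a j t)"

lemma comb_0 [simp]: "comb 0 w a = (\<lambda>t. 0)"
  and comb_Suc: "comb (Suc n) w a = (\<lambda>t. comb n w a t + w n * a n t)"
  by (auto simp: comb_def)

lemma comb_clique:
  assumes "\<And>j. a j \<in> clique_vectors R"
  shows "comb n w a \<in> clique_vectors R"
  by (induction n) (auto simp: comb_Suc intro!: clique_vectors_comb clique_vectors_scale assms)

lemma trunc_Suc: "trunc (Suc n) v = (\<lambda>t. trunc n v t + v n * unit_vec n t)"
  by (auto simp: trunc_def unit_vec_def fun_eq_iff less_Suc_eq)

lemma linear_op_trunc:
  assumes T: "T \<in> linear_ops (clique_space R)"
  shows "T (trunc n v) = comb n v (\<lambda>j. T (unit_vec j))"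
proof (induction n)
  case 0
  interpret banach_fibre "clique_space R" by (rule banach_fibre_clique)
  have "trunc 0 v = (\<lambda>t. 0 * unit_vec 0 t)" by (simp add: trunc_def)
  then show ?case using linear_opsD(4)[OF T, of "unit_vec 0" 0] by simp
next
  case (Suc n)
  interpret banach_fibre "clique_space R" by (rule banach_fibre_clique)
  have "T (\<lambda>t. trunc n v t + v n * unit_vec n t) = (\<lambda>t. T (trunc n v) t + T (\<lambda>t. v n * unit_vec n t) t)"
    using linear_opsD(3)[OF T, of "trunc n v" "\<lambda>t. v n * unit_vec n t"] by (simp add: clique_vectors_scale)
  also have "T (\<lambda>t. v n * unit_vec n t) = (\<lambda>t. v n * T (unit_vec n) t)"
    using linear_opsD(4)[OF T, of "unit_vec n" "v n"] by simp
  finally show ?case by (simp add: trunc_Suc comb_Suc Suc)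
qed

text \<open>The truncations of \<open>v\<close> converge in norm and coordinates are continuous. A
  bounded operator is therefore determined by its columns, and its values are limits of finite sums
  of matrix entries.\<close>

lemma bounded_op_sums:
  assumes T: "T \<in> bounded_ops (clique_space R)" and v: "v \<in> clique_vectors R"
  shows "(\<lambda>j. v j * T (unit_vec j) t) sums T v t"
proof -
  interpret banach_fibre "clique_space R" by (rule banach_fibre_clique)
  have lin: "T \<in> linear_ops (clique_space R)" using T by (simp add: bounded_ops_def)
  have TC: "T w \<in> clique_vectors R" if "w \<in> clique_vectors R" for w using linear_opsD(1)[OF lin] that by simp
  obtain K where K: "K \<ge> 0" "\<And>v w. v \<in> clique_vectors R \<Longrightarrow> w \<in> clique_vectors R \<Longrightarrow>
      norm_dist (clique_space R) (T v) (T w) \<le> K * norm_dist (clique_space R) v w"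
    using bounded_opsD[OF T] by auto
  have "(\<lambda>n. comb n v (\<lambda>j. T (unit_vec j)) t) \<longlonglongrightarrow> T v t"
    unfolding LIMSEQ_iff
  proof (intro allI impI)
    fix e :: real assume e: "e > 0"
    have "e / (K + 1) / 2 > 0" using e K by auto
    then obtain m where m: "\<And>n. n \<ge> m \<Longrightarrow> clique_norm R (\<lambda>t. v t - trunc n v t) \<le> e / (K + 1) / 2"
      using trunc_tendsto[OF v] by blast
    have "norm (comb n v (\<lambda>j. T (unit_vec j)) t - T v t) < e" if "n \<ge> m" for n
    proof -
      have "norm (comb n v (\<lambda>j. T (unit_vec j)) t - T v t) = cmod (T v t - T (trunc n v) t)"
        by (simp add: linear_op_trunc[OF lin] norm_minus_commute)
      also have "\<dots> \<le> clique_norm R (\<lambda>t. T v t - T (trunc n v) t)"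
        by (rule coord_le_norm[OF clique_vectors_comb(2)[OF TC TC]]) (simp_all add: v)
      also have "\<dots> = norm_dist (clique_space R) (T v) (T (trunc n v))"
        using TC v by (simp add: dist_clique_space')
      also have "\<dots> \<le> K * norm_dist (clique_space R) v (trunc n v)" by (rule K) (simp_all add: v)
      also have "\<dots> \<le> K * (e / (K + 1) / 2)"
        using m[OF that] K(1) v by (intro mult_left_mono) (simp_all add: dist_clique_space')
      also have "\<dots> < e" using e K(1) mult_nonneg_nonneg[of K e] by (simp add: field_simps add_nonneg_pos)
      finally show ?thesis .
    qed
    then show "\<exists>m. \<forall>n\<ge>m. norm (comb n v (\<lambda>j. T (unit_vec j)) t - T v t) < e" by blast
  qed
  then show ?thesis unfolding sums_def comb_def .
qed

text \<open>Boundedness of the operator with columns \<open>a j\<close>, as a condition with countable quantifiers.\<close>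

definition bounded_columns :: "(nat \<Rightarrow> nat \<Rightarrow> bool) \<Rightarrow> (nat \<Rightarrow> nat \<Rightarrow> complex) \<Rightarrow> bool" where
  "bounded_columns R a \<longleftrightarrow> (\<forall>j. a j \<in> clique_vectors R) \<and>
    (\<exists>K::nat. \<forall>i n C. clique R C \<longrightarrow> mass C (comb n (rat_vec i) a) \<le> K * clique_norm R (trunc n (rat_vec i)))"

lemma comb_diff: "comb n (\<lambda>t. v t - w t) a = (\<lambda>t. comb n v a t - comb n w a t)"
  by (simp add: comb_def sum_subtractf algebra_simps)

text \<open>Both sides depend continuously on the finitely many coefficients \<open>w j\<close> with
  \<open>j < n\<close>, so the bound passes from rational coefficients to arbitrary ones.\<close>

lemma bounded_columns_norm:
  assumes a: "\<And>j. a j \<in> clique_vectors R"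
    and K: "\<And>i n C. clique R C \<Longrightarrow> mass C (comb n (rat_vec i) a) \<le> real K * clique_norm R (trunc n (rat_vec i))"
    and C: "clique R C"
  shows "mass C (comb n w a) \<le> K * clique_norm R (trunc n w)"
proof (rule field_le_epsilon)
  fix e :: real assume e: "e > 0"
  define B where "B = (\<Sum>j<n. mass C (a j))"
  have B: "B \<ge> 0" by (auto simp: B_def intro!: sum_nonneg mass_nonneg)
  \<comment> \<open>An error \<delta> in the coefficients costs at most \<open>\<delta> * B\<close>
    on the left and \<open>\<delta> * K * n\<close> on the right; the summand 1 keeps the
    denominator positive.\<close>
  define \<delta> where "\<delta> = e / (B + K * n + 1)"
  have pos: "B + K * n + 1 > 0" using B by (simp add: add_nonneg_pos)
  have \<delta>: "\<delta> > 0" unfolding \<delta>_def using e pos by simp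
  obtain i where i: "\<And>t. t < n \<Longrightarrow> cmod (rat_vec i t - w t) < \<delta>"
    using rat_vec_approx[OF \<delta>, of n w] by blast
  have "mass C (comb n w a) = mass C (\<lambda>t. comb n (rat_vec i) a t - comb n (\<lambda>t. rat_vec i t - w t) a t)"
    by (simp add: comb_diff)
  also have "\<dots> \<le> mass C (comb n (rat_vec i) a) + mass C (comb n (\<lambda>t. rat_vec i t - w t) a)" by (rule mass_diff)
  also have "mass C (comb n (\<lambda>t. rat_vec i t - w t) a) \<le> \<delta> * B"
  proof -
    have "mass C (comb n (\<lambda>t. rat_vec i t - w t) a) \<le> (\<Sum>t\<in>C. \<Sum>j<n. \<delta> * cmod (a j t))"
      unfolding mass_def comb_def
    proof (rule sum_mono)
      fix t
      have "cmod (\<Sum>j<n. (rat_vec i j - w j) * a j t) \<le> (\<Sum>j<n. cmod ((rat_vec i j - w j) * a j t))" by (rule norm_sum)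
      also have "\<dots> \<le> (\<Sum>j<n. \<delta> * cmod (a j t))"
        using i by (intro sum_mono) (simp add: norm_mult mult_right_mono less_imp_le)
      finally show "cmod (\<Sum>j<n. (rat_vec i j - w j) * a j t) \<le> (\<Sum>j<n. \<delta> * cmod (a j t))" .
    qed
    also have "\<dots> = (\<Sum>j<n. \<Sum>t\<in>C. \<delta> * cmod (a j t))" by (rule sum.swap)
    also have "\<dots> = \<delta> * B" by (simp add: B_def mass_def sum_distrib_left)
    finally show ?thesis .
  qed
  also have "mass C (comb n (rat_vec i) a) \<le> K * clique_norm R (trunc n (rat_vec i))" by (rule K[OF C])
  also have "clique_norm R (trunc n (rat_vec i)) \<le> clique_norm R (trunc n w) + n * \<delta>"
  proof (rule clique_norm_le)
    fix D assume D: "clique R D"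
    have "mass D (trunc n (rat_vec i)) = mass D (\<lambda>t. trunc n w t + (trunc n (rat_vec i) t - trunc n w t))" by simp
    also have "\<dots> \<le> mass D (trunc n w) + mass D (\<lambda>t. trunc n (rat_vec i) t - trunc n w t)" by (rule mass_add)
    also have "mass D (\<lambda>t. trunc n (rat_vec i) t - trunc n w t) = mass (D \<inter> {..<n}) (\<lambda>t. trunc n (rat_vec i) t - trunc n w t)"
      unfolding mass_def using clique_finite[OF D] by (intro sum.mono_neutral_right) (auto simp: trunc_def)
    also have "\<dots> \<le> n * \<delta>"
      using clique_finite[OF D] i \<delta> by (intro mass_le_card) (auto simp: trunc_def intro: less_imp_le)
    also have "mass D (trunc n w) \<le> clique_norm R (trunc n w)" by (rule mass_le_norm) (simp_all add: D)
    finally show "mass D (trunc n (rat_vec i)) \<le> clique_norm R (trunc n w) + n * \<delta>" by simp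
  qed
  finally have "mass C (comb n w a) \<le> K * (clique_norm R (trunc n w) + n * \<delta>) + \<delta> * B"
    by (simp add: mult_left_mono)
  also have "\<dots> = K * clique_norm R (trunc n w) + \<delta> * (B + K * n)" by (simp add: algebra_simps)
  also have "\<delta> * (B + K * n) \<le> \<delta> * (B + K * n + 1)" using \<delta> by (intro mult_left_mono) auto
  also have "\<delta> * (B + K * n + 1) = e" using pos by (simp add: \<delta>_def)
  finally show "mass C (comb n w a) \<le> K * clique_norm R (trunc n w) + e" by simp
qed

text \<open>The finite combinations of the columns form a Cauchy sequence, by the bound applied to
  the tails of \<open>v\<close>. The operator is their limit in each coordinate, and the bound
  passes to the limit.\<close>

lemma bounded_columns_op:
  assumes "bounded_columns R a"
  shows "\<exists>T\<in>bounded_ops (clique_space R). \<forall>j. T (unit_vec j) = a j"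
proof -
  have a: "\<And>j. a j \<in> clique_vectors R" using assms by (simp add: bounded_columns_def)
  obtain K :: nat where K0: "\<And>i n C. clique R C \<Longrightarrow> mass C (comb n (rat_vec i) a) \<le> K * clique_norm R (trunc n (rat_vec i))"
    using assms unfolding bounded_columns_def by blast
  have K: "mass C (comb n w a) \<le> K * clique_norm R (trunc n w)" if "clique R C" for C n w
    by (rule bounded_columns_norm[OF a K0 that])
  have ex: "\<exists>g\<in>clique_vectors R. (\<forall>t. (\<lambda>n. comb n v a t) \<longlonglongrightarrow> g t)" if v: "v \<in> clique_vectors R" for v
  proof -
    have half: "clique_norm R (\<lambda>t. comb m v a t - comb n v a t) \<le> K * clique_norm R (\<lambda>t. v t - trunc n v t)"
      if "n \<le> m" for m n
    proof (rule clique_norm_le)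
      fix C assume C: "clique R C"
      \<comment> \<open>It follows that the difference of two partial sums is a partial sum for the
        tail \<open>v - trunc n v\<close>, to which the bound applies.\<close>
      have "comb m (trunc n v) a = comb n v a"
        using \<open>n \<le> m\<close> unfolding comb_def fun_eq_iff
        by (intro allI sum.mono_neutral_cong_right) (auto simp: trunc_def)
      then have "mass C (\<lambda>t. comb m v a t - comb n v a t) = mass C (comb m (\<lambda>t. v t - trunc n v t) a)"
        by (simp add: comb_diff)
      also have "\<dots> \<le> K * clique_norm R (trunc m (\<lambda>t. v t - trunc n v t))" by (rule K[OF C])
      also have "\<dots> \<le> K * clique_norm R (\<lambda>t. v t - trunc n v t)"
        by (intro mult_left_mono trunc_norm_le clique_vectors_comb v) auto
      finally show "mass C (\<lambda>t. comb m v a t - comb n v a t) \<le> K * clique_norm R (\<lambda>t. v t - trunc n v t)" .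
    qed
    have "\<exists>N. \<forall>m\<ge>N. \<forall>n\<ge>N. clique_norm R (\<lambda>t. comb m v a t - comb n v a t) \<le> e" if e: "e > 0" for e
    proof -
      have "e / (K + 1) > 0" using e by (simp add: add_nonneg_pos)
      then obtain N where N: "\<And>n. n \<ge> N \<Longrightarrow> clique_norm R (\<lambda>t. v t - trunc n v t) \<le> e / (K + 1)"
        using trunc_tendsto[OF v] by blast
      have *: "clique_norm R (\<lambda>t. comb m v a t - comb n v a t) \<le> e" if "n \<ge> N" "n \<le> m" for m n
      proof -
        have "clique_norm R (\<lambda>t. comb m v a t - comb n v a t) \<le> K * clique_norm R (\<lambda>t. v t - trunc n v t)"
          by (rule half) fact
        also have "\<dots> \<le> K * (e / (K + 1))" using N[OF that(1)] by (intro mult_left_mono) auto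
        also have "\<dots> \<le> e" using e by (simp add: field_simps)
        finally show ?thesis .
      qed
      have "clique_norm R (\<lambda>t. comb m v a t - comb n v a t) \<le> e" if "m \<ge> N" "n \<ge> N" for m n
        using *[of n m] *[of m n] that clique_norm_diff_commute[of R "comb m v a" "comb n v a"] by (cases "n \<le> m") auto
      then show ?thesis by blast
    qed
    from clique_complete[of "\<lambda>n. comb n v a" R, OF comb_clique[OF a] this] show ?thesis by blast
  qed
  define T where "T = (\<lambda>v\<in>clique_vectors R. \<lambda>t. lim (\<lambda>n. comb n v a t))"
  have T: "T v \<in> clique_vectors R" "(\<lambda>n. comb n v a t) \<longlonglongrightarrow> T v t" if v: "v \<in> clique_vectors R" for v t
  proof -
    obtain g where g: "g \<in> clique_vectors R" "\<And>t. (\<lambda>n. comb n v a t) \<longlonglongrightarrow> g t" using ex[OF v] by blast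
    have "T v = g" using v limI[OF g(2)] by (simp add: T_def)
    then show "T v \<in> clique_vectors R" "(\<lambda>n. comb n v a t) \<longlonglongrightarrow> T v t" using g by auto
  qed
  have eqI: "T v = g" if "v \<in> clique_vectors R" "\<And>t. (\<lambda>n. comb n v a t) \<longlonglongrightarrow> g t" for v g
    using T(2)[OF that(1)] that(2) LIMSEQ_unique by (intro ext) blast
  have "T \<in> linear_ops (clique_space R)"
    unfolding linear_ops_def
  proof (intro CollectI conjI ballI allI)
    show "T \<in> carrier (clique_space R) \<rightarrow>\<^sub>E carrier (clique_space R)"
    proof (rule PiE_I)
      show "T v \<in> carrier (clique_space R)" if "v \<in> carrier (clique_space R)" for v using T that by simp
      show "T v = undefined" if "v \<notin> carrier (clique_space R)" for v using that by (simp add: T_def)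
    qed
    fix v assume v: "v \<in> carrier (clique_space R)"
    show "T (v \<oplus>\<^bsub>clique_space R\<^esub> w) = T v \<oplus>\<^bsub>clique_space R\<^esub> T w" if w: "w \<in> carrier (clique_space R)" for w
    proof -
      have "T (\<lambda>t. v t + w t) = (\<lambda>t. T v t + T w t)"
      proof (rule eqI)
        show "(\<lambda>n. comb n (\<lambda>t. v t + w t) a t) \<longlonglongrightarrow> T v t + T w t" for t
          using tendsto_add[OF T(2) T(2), of v w t t] v w by (simp add: comb_def sum.distrib algebra_simps)
      qed (use v w in \<open>simp add: clique_vectors_comb\<close>)
      then show ?thesis by simp
    qed
    show "T (c \<odot>\<^bsub>clique_space R\<^esub> v) = c \<odot>\<^bsub>clique_space R\<^esub> T v" for c
    proof -
      have "T (\<lambda>t. c * v t) = (\<lambda>t. c * T v t)"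
      proof (rule eqI)
        show "(\<lambda>n. comb n (\<lambda>t. c * v t) a t) \<longlonglongrightarrow> c * T v t" for t
          using tendsto_mult_left[OF T(2), of v c t] v by (simp add: comb_def sum_distrib_left mult.assoc)
      qed (use v in \<open>simp add: clique_vectors_scale\<close>)
      then show ?thesis by simp
    qed
  qed
  moreover have "clique_norm R (T v) \<le> K * clique_norm R v" if v: "v \<in> clique_vectors R" for v
  proof (rule clique_norm_le)
    fix C assume C: "clique R C"
    show "mass C (T v) \<le> K * clique_norm R v"
    proof (rule LIMSEQ_le_const2)
      show "(\<lambda>n. mass C (comb n v a)) \<longlonglongrightarrow> mass C (T v)" by (intro tendsto_mass T v)
      have "mass C (comb n v a) \<le> K * clique_norm R v" for n
        by (rule order_trans[OF K[OF C]]) (intro mult_left_mono trunc_norm_le v, simp)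
      then show "\<exists>N. \<forall>n\<ge>N. mass C (comb n v a) \<le> K * clique_norm R v" by blast
    qed
  qed
  ultimately have "T \<in> bounded_ops (clique_space R)" unfolding bounded_ops_def by auto
  moreover have "T (unit_vec j) = a j" for j
  proof (rule eqI)
    fix t
    have "comb n (unit_vec j) a t = a j t" if "n > j" for n
    proof -
      have "comb n (unit_vec j) a t = (\<Sum>i\<in>{j}. unit_vec j i * a i t)"
        unfolding comb_def using that by (intro sum.mono_neutral_right) (auto simp: unit_vec_def)
      then show ?thesis by (simp add: unit_vec_def)
    qed
    then have "\<forall>\<^sub>F n in sequentially. comb n (unit_vec j) a t = a j t"
      unfolding eventually_sequentially by (intro exI[of _ "Suc j"]) auto
    then show "(\<lambda>n. comb n (unit_vec j) a t) \<longlonglongrightarrow> a j t" by (rule tendsto_eventually)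
  qed simp
  ultimately show ?thesis by blast
qed

lemma bounded_op_columns:
  assumes T: "T \<in> bounded_ops (clique_space R)"
  shows "bounded_columns R (\<lambda>j. T (unit_vec j))"
proof -
  interpret banach_fibre "clique_space R" by (rule banach_fibre_clique)
  have lin: "T \<in> linear_ops (clique_space R)" using T by (simp add: bounded_ops_def)
  have TC: "T w \<in> clique_vectors R" if "w \<in> clique_vectors R" for w using linear_opsD(1)[OF lin] that by simp
  obtain K where K: "\<And>v. v \<in> clique_vectors R \<Longrightarrow> clique_norm R (T v) \<le> K * clique_norm R v"
    using T unfolding bounded_ops_def by auto
  have "mass C (comb n (rat_vec i) (\<lambda>j. T (unit_vec j))) \<le> real (nat \<lceil>K\<rceil>) * clique_norm R (trunc n (rat_vec i))"
    if C: "clique R C" for C i n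
  proof -
    have "mass C (comb n (rat_vec i) (\<lambda>j. T (unit_vec j))) \<le> clique_norm R (T (trunc n (rat_vec i)))"
      unfolding linear_op_trunc[OF lin, symmetric] by (intro mass_le_norm TC C) simp
    also have "\<dots> \<le> K * clique_norm R (trunc n (rat_vec i))" by (rule K) simp
    also have "\<dots> \<le> real (nat \<lceil>K\<rceil>) * clique_norm R (trunc n (rat_vec i))"
      by (intro mult_right_mono clique_norm_nonneg) (simp_all add: real_nat_ceiling_ge)
    finally show ?thesis .
  qed
  then show ?thesis unfolding bounded_columns_def using TC by (intro conjI exI[of _ "nat \<lceil>K\<rceil>"]) auto
qed

section \<open>The Borel field of clique spaces of a Borel family of graphs\<close>

locale clique_field =
  fixes R :: "(nat \<Rightarrow> nat) \<Rightarrow> nat \<Rightarrow> nat \<Rightarrow> bool"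
  assumes R_meas [measurable]: "\<And>s t. Measurable.pred borel (\<lambda>x. R x s t)"
begin

definition V where "V x = clique_space (R x)"

definition total :: "((nat \<Rightarrow> nat) \<times> (nat \<Rightarrow> complex)) set" where
  "total = Sigma UNIV (\<lambda>x. clique_vectors (R x))"

definition MV :: "((nat \<Rightarrow> nat) \<times> (nat \<Rightarrow> complex)) measure" where
  "MV = restrict_space borel total"

text \<open>\<open>set_decode\<close> enumerates the finite sets of natural numbers; this turns
  quantification over finite cliques into a countable one.\<close>

lemma clique_meas [measurable]: "Measurable.pred borel (\<lambda>x. clique (R x) (set_decode c))"
proof -
  have "Measurable.pred borel (\<lambda>x. \<forall>s\<in>set_decode c. \<forall>t\<in>set_decode c. s \<noteq> t \<longrightarrow> R x s t)"
    by (intro pred_intros_finite(3) finite_set_decode) measurable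
  then show ?thesis by (simp add: clique_def)
qed

lemma clique_meas_fst [measurable]:
  "Measurable.pred borel (\<lambda>p :: (nat \<Rightarrow> nat) \<times> 'b :: topological_space. clique (R (fst p)) (set_decode c))"
  by (rule measurable_compose[OF fst_borel clique_meas])

lemma clique_sets:
  "{p \<in> space borel. clique (R (fst p)) (set_decode c)} \<in>
    sets (borel :: ((nat \<Rightarrow> nat) \<times> 'b :: topological_space) measure)"
  using clique_meas_fst unfolding pred_def .

lemma mass_meas [measurable]: "(\<lambda>p :: (nat \<Rightarrow> nat) \<times> (nat \<Rightarrow> complex). mass C (snd p)) \<in> borel_measurable borel"
  unfolding mass_def by measurable

lemma clique_vectors_iff:
  "v \<in> clique_vectors R' \<longleftrightarrow> (\<forall>k. \<exists>m. \<forall>c. clique R' (set_decode c) \<longrightarrow> set_decode c \<inter> {..<m} = {} \<longrightarrow> mass (set_decode c) v \<le> 1 / Suc k)"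
  (is "_ \<longleftrightarrow> ?rhs")
proof
  assume "v \<in> clique_vectors R'"
  then have "\<exists>m. \<forall>C. clique R' C \<and> C \<inter> {..<m} = {} \<longrightarrow> mass C v \<le> 1 / Suc k" for k
    unfolding clique_vectors_def by (simp del: of_nat_Suc)
  then show ?rhs by meson
next
  assume r: ?rhs
  show "v \<in> clique_vectors R'"
    unfolding clique_vectors_def
  proof (intro CollectI allI impI)
    fix e :: real assume "e > 0"
    then obtain k where k: "1 / Suc k < e" using nat_approx_posE by blast
    obtain m where m: "\<And>c. clique R' (set_decode c) \<Longrightarrow> set_decode c \<inter> {..<m} = {} \<Longrightarrow> mass (set_decode c) v \<le> 1 / Suc k"
      using r by blast
    have "mass C v \<le> e" if "clique R' C \<and> C \<inter> {..<m} = {}" for C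
      using m[of "set_encode C"] that k clique_finite[of R' C] by (simp add: set_encode_inverse)
    then show "\<exists>m. \<forall>C. clique R' C \<and> C \<inter> {..<m} = {} \<longrightarrow> mass C v \<le> e" by blast
  qed
qed

lemma total_sets: "total \<in> sets borel"
proof -
  have "{p \<in> space borel. \<forall>k. \<exists>m. \<forall>c. clique (R (fst p)) (set_decode c) \<longrightarrow> set_decode c \<inter> {..<m} = {} \<longrightarrow>
      mass (set_decode c) (snd p) \<le> 1 / Suc k} \<in> sets (borel :: ((nat \<Rightarrow> nat) \<times> (nat \<Rightarrow> complex)) measure)"
    by (rule sets.sets_Collect_countable_All sets.sets_Collect_countable_Ex sets.sets_Collect_imp
        sets.sets_Collect_const clique_sets borel_measurable_le mass_meas borel_measurable_const)+
  also have "{p \<in> space borel. \<forall>k. \<exists>m. \<forall>c. clique (R (fst p)) (set_decode c) \<longrightarrow> set_decode c \<inter> {..<m} = {} \<longrightarrow>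
      mass (set_decode c) (snd p) \<le> 1 / Suc k} = total"
    by (auto simp: total_def clique_vectors_iff)
  finally show ?thesis .
qed

lemma space_MV: "space MV = Sigma (space borel) (\<lambda>x. carrier (V x))"
  by (auto simp: MV_def space_restrict_space total_def V_def)

lemma standard_MV: "standard_borel MV"
  unfolding MV_def by (intro standard_borel_restrict standard_borel_borel completely_metrizable_intros total_sets)

lemma measurable_to_MV:
  assumes "f \<in> \<Omega> \<rightarrow>\<^sub>M borel" "\<And>t. (\<lambda>\<omega>. g \<omega> t) \<in> borel_measurable \<Omega>"
    "\<And>\<omega>. \<omega> \<in> space \<Omega> \<Longrightarrow> g \<omega> \<in> clique_vectors (R (f \<omega>))"
  shows "(\<lambda>\<omega>. (f \<omega>, g \<omega>)) \<in> \<Omega> \<rightarrow>\<^sub>M MV"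
  unfolding MV_def
proof (rule measurable_restrict_space2)
  show "(\<lambda>\<omega>. (f \<omega>, g \<omega>)) \<in> borel_measurable \<Omega>"
    by (intro borel_measurable_Pair assms measurable_coordinatewise_then_product)
qed (use assms in \<open>auto simp: total_def\<close>)

lemma id_MV: "(\<lambda>p. p) \<in> MV \<rightarrow>\<^sub>M borel"
  unfolding MV_def by (rule measurable_restrict_space1) simp

lemma fst_MV [measurable]: "fst \<in> MV \<rightarrow>\<^sub>M borel"
  using measurable_compose[OF id_MV fst_borel] by simp

lemma coord_MV [measurable]: "(\<lambda>p. snd p t) \<in> MV \<rightarrow>\<^sub>M borel"
  using measurable_compose[OF id_MV pair_borel_coord(1)] by simp

lemma norm_MV: "(\<lambda>p. clique_norm (R (fst p)) (snd p)) \<in> borel_measurable MV"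
proof (rule borel_measurableI_le)
  fix b
  have "Measurable.pred MV (\<lambda>p. clique (R (fst p)) (set_decode c))" for c
    using measurable_compose[OF id_MV clique_meas_fst[of c]] by assumption
  then have "{p \<in> space MV. clique (R (fst p)) (set_decode c)} \<in> sets MV" for c
    by (simp add: pred_def)
  then have "{p \<in> space MV. \<forall>c. clique (R (fst p)) (set_decode c) \<longrightarrow> mass (set_decode c) (snd p) \<le> b} \<in> sets MV"
    using measurable_compose[OF id_MV mass_meas]
    by (intro sets.sets_Collect_countable_All sets.sets_Collect_imp borel_measurable_le borel_measurable_const)
  also have "{p \<in> space MV. \<forall>c. clique (R (fst p)) (set_decode c) \<longrightarrow> mass (set_decode c) (snd p) \<le> b} =
      {p \<in> space MV. clique_norm (R (fst p)) (snd p) \<le> b}"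
  proof (intro Collect_cong conj_cong refl)
    fix p assume "p \<in> space MV"
    then have v: "snd p \<in> clique_vectors (R (fst p))" by (auto simp: space_MV V_def)
    show "(\<forall>c. clique (R (fst p)) (set_decode c) \<longrightarrow> mass (set_decode c) (snd p) \<le> b) \<longleftrightarrow>
        clique_norm (R (fst p)) (snd p) \<le> b"
      unfolding clique_norm_le_iff[OF v] by (metis clique_finite set_encode_inverse)
  qed
  finally show "{p \<in> space MV. clique_norm (R (fst p)) (snd p) \<le> b} \<in> sets MV" .
qed

lemma section_rat: "(\<lambda>x. (x, rat_vec n)) \<in> borel \<rightarrow>\<^sub>M MV"
  by (rule measurable_to_MV) auto

theorem field: "banach_field borel V MV (\<lambda>n x. rat_vec n)"
proof
  have "norm_topology (V x) closure_of range rat_vec = topspace (norm_topology (V x))" for x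
    unfolding V_def by (subst banach_dense_iff[OF banach_fibre_clique]) (simp add: rat_vec_dense)
  then show sect: "dense_borel_sections borel (\<lambda>x. norm_topology (V x)) MV (\<lambda>n x. rat_vec n)"
    unfolding dense_borel_sections_def using section_rat by simp
  show "borel_field_banach borel V MV"
    unfolding borel_field_banach_def
  proof (intro conjI ballI)
    show "separable_banach_space (V x)" for x unfolding V_def by (rule separable_banach_clique_space)
    show "(\<lambda>(x, v). vnorm (V x) v) \<in> borel_measurable MV"
      using norm_MV by (simp add: V_def split_beta')
    have "(\<lambda>p. (fst (fst p), \<lambda>t. snd (fst p) t + snd (snd p) t)) \<in> fiber_prod MV MV \<rightarrow>\<^sub>M MV"
    proof (rule measurable_to_MV)
      note [measurable] = measurable_fst_fiber_prod[of MV MV] measurable_snd_fiber_prod[of MV MV]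
      show "(\<lambda>p. fst (fst p)) \<in> fiber_prod MV MV \<rightarrow>\<^sub>M borel" by measurable
      show "(\<lambda>p. snd (fst p) t + snd (snd p) t) \<in> fiber_prod MV MV \<rightarrow>\<^sub>M borel" for t
        by (intro borel_measurable_add measurable_compose[OF measurable_fst_fiber_prod coord_MV]
            measurable_compose[OF measurable_snd_fiber_prod coord_MV])
      show "(\<lambda>t. snd (fst p) t + snd (snd p) t) \<in> clique_vectors (R (fst (fst p)))" if "p \<in> space (fiber_prod MV MV)" for p
        using that by (intro clique_vectors_comb) (auto simp: space_fiber_prod space_MV V_def)
    qed
    then show "(\<lambda>((x, v), y, w). (x, v \<oplus>\<^bsub>V x\<^esub> w)) \<in> fiber_prod MV MV \<rightarrow>\<^sub>M MV"
      by (simp add: V_def split_beta')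
    have "(\<lambda>p. (fst (snd p), \<lambda>t. fst p * snd (snd p) t)) \<in> (borel :: complex measure) \<Otimes>\<^sub>M MV \<rightarrow>\<^sub>M MV"
    proof (rule measurable_to_MV)
      show "(\<lambda>t. fst p * snd (snd p) t) \<in> clique_vectors (R (fst (snd p)))"
        if "p \<in> space ((borel :: complex measure) \<Otimes>\<^sub>M MV)" for p
        using that by (intro clique_vectors_scale) (auto simp: space_pair_measure space_MV V_def)
    qed measurable
    then show "(\<lambda>(c, x, v). (x, c \<odot>\<^bsub>V x\<^esub> v)) \<in> (borel :: complex measure) \<Otimes>\<^sub>M MV \<rightarrow>\<^sub>M MV"
      by (simp add: V_def split_beta')
    show "\<exists>\<phi>. dense_borel_sections borel (\<lambda>x. norm_topology (V x)) MV \<phi>" using sect by blast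
  qed (simp_all add: standard_borel_borel completely_metrizable_intros standard_MV space_MV)
qed

definition columns :: "(nat \<Rightarrow> nat) \<times> ((nat \<Rightarrow> complex) \<Rightarrow> nat \<Rightarrow> complex) \<Rightarrow> (nat \<Rightarrow> nat) \<times> (nat \<Rightarrow> nat \<Rightarrow> complex)" where
  "columns p = (fst p, \<lambda>j. snd p (unit_vec j))"

text \<open>An operator is identified with the matrix of its columns, and the structure is induced
  from the Polish space of matrices. It is standard because \<open>bounded_columns\<close> is a
  Borel condition there.\<close>

definition MB :: "((nat \<Rightarrow> nat) \<times> ((nat \<Rightarrow> complex) \<Rightarrow> nat \<Rightarrow> complex)) measure" where
  "MB = vimage_algebra (Sigma UNIV (\<lambda>x. bounded_ops (V x))) columns borel"

lemma columns_image:
  "columns ` Sigma UNIV (\<lambda>x. bounded_ops (V x)) = {p. bounded_columns (R (fst p)) (snd p)}"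
proof (intro equalityI subsetI)
  fix p assume "p \<in> columns ` Sigma UNIV (\<lambda>x. bounded_ops (V x))"
  then show "p \<in> {p. bounded_columns (R (fst p)) (snd p)}"
    using bounded_op_columns by (auto simp: columns_def V_def)
next
  fix p assume "p \<in> {p. bounded_columns (R (fst p)) (snd p)}"
  then obtain T where T: "T \<in> bounded_ops (V (fst p))" "\<And>j. T (unit_vec j) = snd p j"
    using bounded_columns_op unfolding V_def by blast
  then show "p \<in> columns ` Sigma UNIV (\<lambda>x. bounded_ops (V x))"
    by (intro image_eqI[of _ _ "(fst p, T)"]) (auto simp: columns_def)
qed

lemma columns_inj: "inj_on columns (Sigma UNIV (\<lambda>x. bounded_ops (V x)))"
proof (rule inj_onI)
  fix p q assume p: "p \<in> Sigma UNIV (\<lambda>x. bounded_ops (V x))" and q: "q \<in> Sigma UNIV (\<lambda>x. bounded_ops (V x))"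
    and eq: "columns p = columns q"
  obtain x S T where pq: "p = (x, S)" "q = (x, T)" using eq by (cases p, cases q) (auto simp: columns_def)
  have ST: "S \<in> bounded_ops (clique_space (R x))" "T \<in> bounded_ops (clique_space (R x))"
    using p q unfolding pq V_def by auto
  have units: "S (unit_vec j) = T (unit_vec j)" for j using eq by (simp add: columns_def pq fun_eq_iff)
  have "S = T"
  proof (rule banach_fibre_dense.bounded_ops_eqI[OF banach_fibre_dense_clique ST])
    show "S (rat_vec n) = T (rat_vec n)" for n
    proof
      fix t
      show "S (rat_vec n) t = T (rat_vec n) t"
        using bounded_op_sums[OF ST(1) rat_vec_clique, of n t] bounded_op_sums[OF ST(2) rat_vec_clique, of n t]
        by (simp add: units sums_iff)
    qed
  qed
  then show "p = q" by (simp add: pq)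
qed

lemma norm_const_meas [measurable]:
  assumes "\<And>x. w \<in> clique_vectors (R x)"
  shows "(\<lambda>p :: (nat \<Rightarrow> nat) \<times> 'b :: topological_space. clique_norm (R (fst p)) w) \<in> borel_measurable borel"
proof -
  have "(\<lambda>x. (x, w)) \<in> borel \<rightarrow>\<^sub>M MV" by (rule measurable_to_MV) (auto simp: assms)
  from measurable_compose[OF fst_borel measurable_compose[OF this norm_MV]] show ?thesis by simp
qed

lemma columns_image_sets: "columns ` Sigma UNIV (\<lambda>x. bounded_ops (V x)) \<in> sets borel"
proof -
  let ?B = "borel :: ((nat \<Rightarrow> nat) \<times> (nat \<Rightarrow> nat \<Rightarrow> complex)) measure"
  have norm_m: "(\<lambda>p. clique_norm (R (fst p)) (trunc n (rat_vec i))) \<in> borel_measurable ?B" for n i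
    by (rule norm_const_meas) simp
  have comb_m: "(\<lambda>p. mass C (comb n w (snd p))) \<in> borel_measurable ?B" for C n w
    unfolding mass_def comb_def by measurable
  have col_m: "(\<lambda>p. mass C (snd p j)) \<in> borel_measurable ?B" for C j
    unfolding mass_def by measurable
  have "{p \<in> space ?B. (\<forall>j k. \<exists>m. \<forall>c. clique (R (fst p)) (set_decode c) \<longrightarrow> set_decode c \<inter> {..<m} = {} \<longrightarrow>
          mass (set_decode c) (snd p j) \<le> 1 / Suc k) \<and>
      (\<exists>K::nat. \<forall>i n c. clique (R (fst p)) (set_decode c) \<longrightarrow>
        mass (set_decode c) (comb n (rat_vec i) (snd p)) \<le> K * clique_norm (R (fst p)) (trunc n (rat_vec i)))} \<in> sets ?B"
    by (rule sets.sets_Collect_countable_All sets.sets_Collect_countable_Ex sets.sets_Collect_imp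
        sets.sets_Collect_conj sets.sets_Collect_const clique_sets borel_measurable_le borel_measurable_times
        norm_m comb_m col_m borel_measurable_const)+
  also have "{p \<in> space ?B. (\<forall>j k. \<exists>m. \<forall>c. clique (R (fst p)) (set_decode c) \<longrightarrow> set_decode c \<inter> {..<m} = {} \<longrightarrow>
          mass (set_decode c) (snd p j) \<le> 1 / Suc k) \<and>
      (\<exists>K::nat. \<forall>i n c. clique (R (fst p)) (set_decode c) \<longrightarrow>
        mass (set_decode c) (comb n (rat_vec i) (snd p)) \<le> K * clique_norm (R (fst p)) (trunc n (rat_vec i)))}
      = {p. bounded_columns (R (fst p)) (snd p)}"
  proof -
    have all: "(\<forall>C. clique R' C \<longrightarrow> P C) \<longleftrightarrow> (\<forall>c. clique R' (set_decode c) \<longrightarrow> P (set_decode c))" for R' P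
      by (metis clique_finite set_encode_inverse)
    show ?thesis unfolding bounded_columns_def clique_vectors_iff all by simp
  qed
  finally show ?thesis unfolding columns_image .
qed

theorem operators: "operator_field borel V MV (\<lambda>n x. rat_vec n) (\<lambda>x. bounded_ops (V x)) MB"
proof (intro operator_field.intro field operator_field_axioms.intro subset_refl)
  show "operator_borel_structure borel MV (\<lambda>x. bounded_ops (V x)) MB"
    unfolding operator_borel_structure_def
  proof (intro conjI)
    show "standard_borel MB"
      unfolding MB_def by (intro standard_borel_vimage standard_borel_borel completely_metrizable_intros columns_inj columns_image_sets)
    show sp: "space MB = Sigma (space borel) (\<lambda>x. bounded_ops (V x))" by (simp add: MB_def)
    have col: "columns \<in> MB \<rightarrow>\<^sub>M borel" unfolding MB_def by (rule measurable_vimage_algebra1) auto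
    show fst: "fst \<in> MB \<rightarrow>\<^sub>M borel"
      using measurable_compose[OF col fst_borel] by (simp add: columns_def)
    have entry: "(\<lambda>p. snd p (unit_vec j) t) \<in> MB \<rightarrow>\<^sub>M borel" for j t
      using measurable_compose[OF col pair_borel_coord(2)[of j t]] by (simp add: columns_def)
    have "(\<lambda>p. (fst (fst p), snd (fst p) (snd (snd p)))) \<in> fiber_prod MB MV \<rightarrow>\<^sub>M MV"
    proof (rule measurable_to_MV)
      let ?F = "fiber_prod MB MV"
      show "(\<lambda>p. fst (fst p)) \<in> ?F \<rightarrow>\<^sub>M borel" by (rule measurable_compose[OF measurable_fst_fiber_prod fst])
      have p: "snd (fst p) \<in> bounded_ops (clique_space (R (fst (fst p))))" "snd (snd p) \<in> clique_vectors (R (fst (fst p)))"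
        if "p \<in> space ?F" for p
        using that by (auto simp: space_fiber_prod sp space_MV V_def)
      show "snd (fst p) (snd (snd p)) \<in> clique_vectors (R (fst (fst p)))" if "p \<in> space ?F" for p
        using p[OF that] banach_fibre.linear_opsD(1)[OF banach_fibre_clique] unfolding bounded_ops_def by fastforce
      fix t
      \<comment> \<open>By \<open>bounded_op_sums\<close>, evaluation is a pointwise limit of these
        finite sums of matrix entries times coordinates.\<close>
      have "(\<lambda>p. \<Sum>j<n. snd (snd p) j * snd (fst p) (unit_vec j) t) \<in> borel_measurable ?F" for n
        by (intro borel_measurable_sum borel_measurable_times measurable_compose[OF measurable_fst_fiber_prod entry]
            measurable_compose[OF measurable_snd_fiber_prod coord_MV])
      then show "(\<lambda>p. snd (fst p) (snd (snd p)) t) \<in> borel_measurable ?F"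
        by (rule borel_measurable_LIMSEQ_metric) (use bounded_op_sums[OF p] in \<open>simp add: sums_def\<close>)
    qed
    then show "(\<lambda>((x, T), y, v). (x, T v)) \<in> fiber_prod MB MV \<rightarrow>\<^sub>M MV"
      by (simp add: split_beta')
  qed
qed

end

section \<open>Isometries of clique spaces and infinite cliques\<close>

definition infinite_clique :: "(nat \<Rightarrow> nat \<Rightarrow> bool) \<Rightarrow> nat set \<Rightarrow> bool" where
  "infinite_clique R B \<longleftrightarrow> infinite B \<and> (\<forall>s\<in>B. \<forall>t\<in>B. s \<noteq> t \<longrightarrow> R s t)"

text \<open>Such a map permutes the finite cliques, and composition with it only moves masses from
  one clique to another.\<close>

lemma involution_isometry:
  assumes inv: "\<And>t. \<theta> (\<theta> t) = t" and R: "\<And>s t. R s t \<Longrightarrow> R (\<theta> s) (\<theta> t)"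
  shows "(\<lambda>v\<in>clique_vectors R. \<lambda>t. v (\<theta> t)) \<in> isometries (clique_space R)" (is "?\<alpha> \<in> _")
proof -
  have inj: "inj_on \<theta> C" for C by (metis inj_onI inv)
  have clique: "clique R (\<theta> ` C)" if "clique R C" for C
    using that R unfolding clique_def by (auto) metis
  have mass: "mass C (\<lambda>t. v (\<theta> t)) = mass (\<theta> ` C) v" for C v
    unfolding mass_def by (simp add: sum.reindex[OF inj])
  have closed: "(\<lambda>t. v (\<theta> t)) \<in> clique_vectors R" if v: "v \<in> clique_vectors R" for v
  proof (rule clique_vectorsI)
    fix e :: real assume "e > 0"
    then obtain m where m: "\<And>C. clique R C \<Longrightarrow> mass (C - {..<m}) v \<le> e" using clique_vectorsD[OF v] by meson
    obtain m' where m': "\<forall>t\<in>\<theta> ` {..<m}. t < m'" using finite_nat_set_iff_bounded[of "\<theta> ` {..<m}"] by blast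
    have "mass (C - {..<m'}) (\<lambda>t. v (\<theta> t)) \<le> e" if C: "clique R C" for C
    proof -
      have "\<theta> t \<ge> m" if "t \<ge> m'" for t
      proof (rule ccontr)
        assume "\<not> \<theta> t \<ge> m"
        then have "\<theta> (\<theta> t) \<in> \<theta> ` {..<m}" by (intro imageI) simp
        then have "t < m'" using m' unfolding inv by blast
        then show False using \<open>t \<ge> m'\<close> by simp
      qed
      then have "\<theta> ` (C - {..<m'}) \<subseteq> \<theta> ` C - {..<m}"
        by (intro image_subsetI) (simp add: not_less)
      then have "mass (\<theta> ` (C - {..<m'})) v \<le> mass (\<theta> ` C - {..<m}) v"
        using clique_finite[OF C] by (intro mass_mono) auto
      also have "\<dots> \<le> e" by (rule m[OF clique[OF C]])
      finally show ?thesis by (simp add: mass)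
    qed
    then show "\<exists>m. \<forall>C. clique R C \<longrightarrow> mass (C - {..<m}) (\<lambda>t. v (\<theta> t)) \<le> e" by blast
  qed
  interpret banach_fibre "clique_space R" by (rule banach_fibre_clique)
  show ?thesis
  proof (rule isometriesI)
    show "?\<alpha> \<in> linear_ops (clique_space R)"
      unfolding linear_ops_def by (auto simp: closed clique_vectors_comb clique_vectors_scale)
    show "vnorm (clique_space R) (?\<alpha> v) = vnorm (clique_space R) v" if "v \<in> carrier (clique_space R)" for v
    proof -
      have v: "v \<in> clique_vectors R" using that by simp
      have le: "clique_norm R (\<lambda>t. w (\<theta> t)) \<le> clique_norm R w" if "w \<in> clique_vectors R" for w
        by (rule clique_norm_le) (simp add: mass mass_le_norm[OF that] clique)
      have "clique_norm R v \<le> clique_norm R (\<lambda>t. v (\<theta> t))" using le[OF closed[OF v]] by (simp add: inv)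
      then show ?thesis using le[OF v] v by simp
    qed
    show "\<exists>w\<in>carrier (clique_space R). ?\<alpha> w = v" if "v \<in> carrier (clique_space R)" for v
      using that closed by (intro bexI[of _ "\<lambda>t. v (\<theta> t)"]) (auto simp: inv)
  qed
qed

lemma linear_op_comb:
  assumes T: "T \<in> linear_ops (clique_space R)" and a: "\<And>j. a j \<in> clique_vectors R"
  shows "T (comb n w a) = comb n w (\<lambda>j. T (a j))"
proof (induction n)
  case 0
  interpret banach_fibre "clique_space R" by (rule banach_fibre_clique)
  show ?case using linear_opsD(4)[OF T, of "unit_vec 0" 0] by simp
next
  case (Suc n)
  interpret banach_fibre "clique_space R" by (rule banach_fibre_clique)
  have "T (\<lambda>t. comb n w a t + w n * a n t) = (\<lambda>t. T (comb n w a) t + T (\<lambda>t. w n * a n t) t)"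
    using linear_opsD(3)[OF T, of "comb n w a" "\<lambda>t. w n * a n t"] a by (simp add: clique_vectors_scale comb_clique)
  moreover have "T (\<lambda>t. w n * a n t) = (\<lambda>t. w n * T (a n) t)"
    using linear_opsD(4)[OF T, of "a n" "w n"] a by simp
  ultimately show ?case by (simp add: comb_Suc Suc)
qed

lemma norm_unit_vec: "clique_norm R (unit_vec j) \<le> 1"
proof (rule clique_norm_le)
  fix C assume "clique R C"
  then have "finite C" by (rule clique_finite)
  have "mass C (unit_vec j) = (\<Sum>t\<in>C. if t = j then 1 else 0)"
    unfolding mass_def unit_vec_def by (intro sum.cong) auto
  also have "\<dots> \<le> 1" using \<open>finite C\<close> by simp
  finally show "mass C (unit_vec j) \<le> 1" .
qed

text \<open>The unit vectors on an infinite clique are isometric to the basis of \<open>\<ell>\<^sup>1\<close>. Along a subsequence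
  the differences \<open>y\<close> of their images tend to \<open>0\<close> coordinatewise, so the finite cliques \<open>C N\<close> that
  almost norm \<open>U 0 + y 0 + \<dots> + y (N - 1)\<close> cannot accumulate at a finite set.\<close>

theorem isometry_infinite_clique:
  fixes a :: "nat \<Rightarrow> nat"
  assumes \<alpha>: "\<alpha> \<in> isometries (clique_space R)" and a: "inj a" "\<And>i j. i \<noteq> j \<Longrightarrow> R (a i) (a j)"
    and r: "norm_dist (clique_space R) (\<alpha> (unit_vec (a 0))) (unit_vec r) < 1 / 10"
  shows "\<exists>B. infinite_clique R B \<and> r \<in> B"
proof -
  interpret banach_fibre "clique_space R" by (rule banach_fibre_clique)
  have lin: "\<alpha> \<in> linear_ops (clique_space R)" by (rule isometries_linear[OF \<alpha>])
  have \<alpha>C: "\<alpha> v \<in> clique_vectors R" if "v \<in> clique_vectors R" for v using linear_opsD(1)[OF lin] that by simp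
  have \<alpha>N: "clique_norm R (\<alpha> v) = clique_norm R v" if "v \<in> clique_vectors R" for v
    using \<alpha> that by (simp add: isometries_def)
  have u1: "cmod (\<alpha> (unit_vec j) t) \<le> 1" for j t
    using coord_le_norm[OF \<alpha>C[OF unit_clique], of j t] \<alpha>N[OF unit_clique, of j] norm_unit_vec[of R j] by linarith
  \<comment> \<open>All entries of the images are bounded by 1, so a diagonal subsequence converges
    in every coordinate.\<close>
  obtain k where k: "strict_mono (k :: nat \<Rightarrow> nat)" "\<And>t. \<exists>l. (\<lambda>n. \<alpha> (unit_vec (a (k n))) t) \<longlonglongrightarrow> l"
    using function_convergent_subsequence[of "UNIV :: nat set" "\<lambda>n. \<alpha> (unit_vec (a n))" 1] u1 by auto
  \<comment> \<open>The vertex \<open>a 0\<close> stays at index 0, since \<open>r\<close> is tied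
    to its image. For \<open>i > 0\<close>, \<open>k i \<ge> i\<close> ensures that it does not
    occur again.\<close>
  define b where "b i = a (if i = 0 then 0 else k i)" for i
  have k0: "k i \<ge> i" for i using seq_suble[OF k(1)] .
  have b_eq: "b i = b j \<longleftrightarrow> i = j" for i j
    using inj_eq[OF a(1)] strict_mono_eq[OF k(1)] k0[of i] k0[of j] by (auto simp: b_def)
  have bR: "R (b i) (b j)" if "i \<noteq> j" for i j
  proof -
    have "b i \<noteq> b j" using that by (simp add: b_eq)
    then show ?thesis unfolding b_def using a(2) by metis
  qed
  define U where "U i = \<alpha> (unit_vec (b i))" for i
  \<comment> \<open>Halved differences of consecutive terms have mass at most 1 on each clique, and
    they tend to 0 in every coordinate because the images converge there.\<close>
  define y where "y j = (\<lambda>t. (U (2 * j + 1) t - U (2 * j + 2) t) / 2)" for j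
  have UC: "U i \<in> clique_vectors R" for i unfolding U_def by (rule \<alpha>C) simp
  have yC: "y j \<in> clique_vectors R" for j
    using clique_vectors_scale[OF clique_vectors_comb(2)[OF UC UC], of "1/2"] by (simp add: y_def)
  have U1: "mass C (U i) \<le> 1" if "clique R C" for C i
    using mass_le_norm[OF UC that, of i] norm_unit_vec[of R "b i"] by (simp add: U_def \<alpha>N)
  have y1: "mass C (y j) \<le> 1" if "clique R C" for C j
  proof -
    have "mass C (y j) = mass C (\<lambda>t. (1/2) * (U (2 * j + 1) t - U (2 * j + 2) t))" by (simp add: y_def)
    also have "\<dots> = mass C (\<lambda>t. U (2 * j + 1) t - U (2 * j + 2) t) / 2" by (subst mass_scale) (simp add: norm_divide)
    finally show ?thesis using mass_diff[of C "U (2 * j + 1)" "U (2 * j + 2)"] U1[OF that, of "2 * j + 1"] U1[OF that, of "2 * j + 2"]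
      by linarith
  qed
  have y0: "(\<lambda>j. y j t) \<longlonglongrightarrow> 0" for t
  proof -
    obtain l where l: "(\<lambda>n. \<alpha> (unit_vec (a (k n))) t) \<longlonglongrightarrow> l" using k(2) by blast
    have m: "strict_mono (\<lambda>j::nat. 2 * j + 1)" "strict_mono (\<lambda>j::nat. 2 * j + 2)" by (auto simp: strict_mono_def)
    have "(\<lambda>j. U (2 * j + 1) t) \<longlonglongrightarrow> l" "(\<lambda>j. U (2 * j + 2) t) \<longlonglongrightarrow> l"
      using LIMSEQ_subseq_LIMSEQ[OF l m(1)] LIMSEQ_subseq_LIMSEQ[OF l m(2)] by (simp_all add: U_def b_def o_def)
    from tendsto_diff[OF this] have "(\<lambda>j. (U (2 * j + 1) t - U (2 * j + 2) t) / 2) \<longlonglongrightarrow> 0"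
      by (intro tendsto_divide_zero) simp
    then show ?thesis by (simp add: y_def)
  qed
  \<comment> \<open>The coefficients of \<open>U 0 + y 0 + ... + y (N - 1)\<close> in the images
    \<open>U i\<close>. Their absolute values add up to \<open>1 + N\<close>; as the
    \<open>b i\<close> form a clique, this is the norm of the combination of unit vectors, and the
    isometry preserves it.\<close>
  define c :: "nat \<Rightarrow> complex" where "c i = (if i = 0 then 1 else if odd i then 1 / 2 else - 1 / 2)" for i
  have comb_y: "comb (Suc (2 * N)) c U = (\<lambda>t. U 0 t + (\<Sum>j<N. y j t))" for N
  proof (induction N)
    case 0
    show ?case by (simp add: comb_Suc c_def)
  next
    case (Suc N)
    have "comb (Suc (2 * Suc N)) c U = (\<lambda>t. comb (Suc (2 * N)) c U t + c (2 * N + 1) * U (2 * N + 1) t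
        + c (2 * N + 2) * U (2 * N + 2) t)"
      by (simp add: comb_Suc)
    also have "\<dots> = (\<lambda>t. comb (Suc (2 * N)) c U t + y N t)"
      by (simp add: c_def y_def diff_divide_distrib add_diff_eq)
    finally show ?case unfolding Suc by (simp add: add.assoc)
  qed
  have sum_c: "(\<Sum>i<Suc (2 * N). cmod (c i)) = 1 + N" for N
    by (induction N) (auto simp: c_def norm_divide)
  \<comment> \<open>A finite clique on which the image comes within \<open>1 / 10\<close> of its
    norm \<open>N + 1\<close>.\<close>
  have "\<exists>C. clique R C \<and> mass C (\<lambda>t. U 0 t + (\<Sum>j<N. y j t)) > N + 9 / 10" for N
  proof (rule ccontr)
    assume no: "\<not> ?thesis"
    let ?w = "comb (Suc (2 * N)) c (\<lambda>i. unit_vec (b i))"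
    have w: "?w \<in> clique_vectors R" by (rule comb_clique) simp
    have "\<alpha> ?w = (\<lambda>t. U 0 t + (\<Sum>j<N. y j t))"
      unfolding linear_op_comb[OF lin unit_clique] by (simp add: comb_y flip: U_def)
    then have "clique_norm R ?w \<le> N + 9 / 10"
      using no \<alpha>N[OF w] clique_norm_le[of R "\<alpha> ?w" "N + 9/10"] by (simp add: not_less)
    moreover have "clique R (b ` {..<Suc (2 * N)})" using bR unfolding clique_def by (auto simp: b_eq)
    ultimately have "mass (b ` {..<Suc (2 * N)}) ?w \<le> N + 9 / 10" using mass_le_norm[OF w] by (meson order_trans)
    moreover have "mass (b ` {..<Suc (2 * N)}) ?w = 1 + N"
    proof -
      have "?w (b m) = c m" if "m < Suc (2 * N)" for m
      proof -
        have "?w (b m) = (\<Sum>j<Suc (2 * N). if j = m then c j else 0)"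
          unfolding comb_def unit_vec_def by (intro sum.cong) (auto simp: b_eq)
        then show ?thesis using that by (auto simp del: sum.lessThan_Suc)
      qed
      moreover have "inj_on b {..<Suc (2 * N)}" by (auto simp: inj_on_def b_eq)
      ultimately have "mass (b ` {..<Suc (2 * N)}) ?w = (\<Sum>i<Suc (2 * N). cmod (c i))"
        unfolding mass_def by (subst sum.reindex) (auto intro!: sum.cong simp del: sum.lessThan_Suc)
      then show ?thesis by (simp only: sum_c)
    qed
    ultimately show False by simp
  qed
  then obtain C where C: "\<And>N. clique R (C N)" "\<And>N. mass (C N) (\<lambda>t. U 0 t + (\<Sum>j<N. y j t)) > real N + 9 / 10"
    by metis
  have split: "real N + 9 / 10 < mass (C N) (U 0) + (\<Sum>j<N. mass (C N) (y j))" for N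
  proof -
    have le: "mass D (\<lambda>t. \<Sum>j<n. y j t) \<le> (\<Sum>j<n. mass D (y j))" for D n
    proof (induction n)
      case (Suc n)
      then show ?case using mass_add[of D "\<lambda>t. \<Sum>j<n. y j t" "y n"] by simp
    qed (simp add: mass_def)
    then show ?thesis using C(2)[of N] mass_add[of "C N" "U 0" "\<lambda>t. \<Sum>j<N. y j t"] le[of "C N" N] by linarith
  qed
  have sum_le: "(\<Sum>j\<in>J. mass (C N) (y j)) \<le> card J" for J N
    using sum_bounded_above[of J "\<lambda>j. mass (C N) (y j)" 1] y1[OF C(1)] by simp
  \<comment> \<open>A clique without \<open>r\<close> has mass below \<open>1 / 10\<close> in
    \<open>U 0\<close>, and the \<open>N\<close> other terms contribute at most 1 each: too little
    for \<open>N + 9 / 10\<close>.\<close>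
  have rC: "r \<in> C N" for N
  proof (rule ccontr)
    assume "r \<notin> C N"
    then have "mass (C N) (unit_vec r) = 0" unfolding mass_def unit_vec_def by (intro sum.neutral) auto
    moreover have "mass (C N) (\<lambda>t. U 0 t - unit_vec r t) < 1 / 10"
      using r mass_le_norm[OF clique_vectors_comb(2)[OF UC[of 0] unit_clique[of r]] C(1)[of N]]
      by (simp add: dist_clique_space' \<alpha>C U_def b_def)
    moreover have "mass (C N) (U 0) \<le> mass (C N) (\<lambda>t. U 0 t - unit_vec r t) + mass (C N) (unit_vec r)"
      using mass_add[of "C N" "\<lambda>t. U 0 t - unit_vec r t" "unit_vec r"] by simp
    ultimately show False using split[of N] sum_le[of N "{..<N}"] by simp
  qed
  \<comment> \<open>\<open>U 0\<close> and the other \<open>N - 1\<close> terms contribute at most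
    \<open>N\<close> altogether, so \<open>9 / 10\<close> must come from \<open>y j\<close>.\<close>
  have Cy: "mass (C N) (y j) \<ge> 9 / 10" if j: "j < N" for N j
  proof -
    have "(\<Sum>i<N. mass (C N) (y i)) = mass (C N) (y j) + (\<Sum>i\<in>{..<N} - {j}. mass (C N) (y i))"
      using j by (intro sum.remove) auto
    also have "\<dots> \<le> mass (C N) (y j) + (N - 1)" using sum_le[of N "{..<N} - {j}"] j by simp
    finally show ?thesis using split[of N] U1[OF C(1), of N 0] j by simp
  qed
  \<comment> \<open>Compactness of the power set: along a subsequence, each vertex belongs to almost
    all of the cliques or to almost none.\<close>
  obtain k' where k': "strict_mono (k' :: nat \<Rightarrow> nat)" "\<And>t. \<exists>l. (\<lambda>n. of_bool (t \<in> C (k' n)) :: real) \<longlonglongrightarrow> l"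
    using function_convergent_subsequence[of "UNIV :: nat set" "\<lambda>n t. of_bool (t \<in> C n) :: real" 1] by auto
  have const: "\<exists>M. \<forall>m\<ge>M. \<forall>n\<ge>M. t \<in> C (k' m) \<longleftrightarrow> t \<in> C (k' n)" for t
  proof -
    have "Cauchy (\<lambda>n. of_bool (t \<in> C (k' n)) :: real)" using k'(2) by (meson LIMSEQ_imp_Cauchy)
    then obtain M where M: "\<forall>m\<ge>M. \<forall>n\<ge>M. norm (of_bool (t \<in> C (k' m)) - of_bool (t \<in> C (k' n)) :: real) < 1"
      using CauchyD[of _ 1] by (metis zero_less_one)
    have "t \<in> C (k' m) \<longleftrightarrow> t \<in> C (k' n)" if "m \<ge> M" "n \<ge> M" for m n
      using M that by (auto simp: of_bool_def split: if_splits)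
    then show ?thesis by blast
  qed
  define B where "B = {t. \<exists>M. \<forall>n\<ge>M. t \<in> C (k' n)}"
  have ev: "\<exists>M. \<forall>n\<ge>M. t \<in> C (k' n) \<longleftrightarrow> t \<in> B" for t
  proof -
    obtain M where M: "\<And>m n. m \<ge> M \<Longrightarrow> n \<ge> M \<Longrightarrow> t \<in> C (k' m) \<longleftrightarrow> t \<in> C (k' n)" using const[of t] by blast
    have "t \<in> C (k' n) \<longleftrightarrow> t \<in> B" if "n \<ge> M" for n
    proof
      assume "t \<in> C (k' n)"
      then show "t \<in> B" unfolding B_def using M[OF _ that] by blast
    next
      assume "t \<in> B"
      then obtain M' where "\<forall>n\<ge>M'. t \<in> C (k' n)" unfolding B_def by blast
      then have "t \<in> C (k' (max M M'))" by simp
      then show "t \<in> C (k' n)" using M[of "max M M'" n] that by simp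
    qed
    then show ?thesis by blast
  qed
  have BR: "R s t" if st: "s \<in> B" "t \<in> B" "s \<noteq> t" for s t
  proof -
    obtain M1 where "\<forall>n\<ge>M1. s \<in> C (k' n)" using st(1) unfolding B_def by blast
    moreover obtain M2 where "\<forall>n\<ge>M2. t \<in> C (k' n)" using st(2) unfolding B_def by blast
    ultimately have "s \<in> C (k' (max M1 M2))" "t \<in> C (k' (max M1 M2))" by simp_all
    then show ?thesis using C(1) st(3) unfolding clique_def by blast
  qed
  have "r \<in> B" using rC by (simp add: B_def)
  moreover have "infinite B"
  proof
    assume fin: "finite B"
    have yB: "mass B (y j) \<ge> 8 / 10" for j
    proof -
      \<comment> \<open>Beyond \<open>m\<close>, a clique carries at most \<open>1 / 10\<close> of
        the mass of \<open>y j\<close>; below \<open>m\<close>, the cliques eventually coincide with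
        \<open>B\<close>. This leaves \<open>8 / 10\<close> for \<open>B\<close>.\<close>
      obtain m where m: "\<And>D. clique R D \<Longrightarrow> mass (D - {..<m}) (y j) \<le> 1 / 10"
        using clique_vectorsD[OF yC, of "1/10" j] by auto
      have "\<forall>\<^sub>F n in sequentially. \<forall>t\<in>{..<m}. t \<in> C (k' n) \<longleftrightarrow> t \<in> B"
        using ev by (intro eventually_ball_finite) (auto simp: eventually_sequentially)
      then obtain M where M: "\<And>n t. n \<ge> M \<Longrightarrow> t < m \<Longrightarrow> t \<in> C (k' n) \<longleftrightarrow> t \<in> B"
        unfolding eventually_sequentially by auto
      define n where "n = max M (Suc j)"
      have "j < k' n" using seq_suble[OF k'(1), of n] by (simp add: n_def)
      then have "9 / 10 \<le> mass (C (k' n)) (y j)" by (rule Cy)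
      also have "\<dots> = mass (C (k' n) \<inter> {..<m}) (y j) + mass (C (k' n) - {..<m}) (y j)"
        by (rule mass_split[OF clique_finite[OF C(1)]])
      also have "C (k' n) \<inter> {..<m} = B \<inter> {..<m}" using M[of n] by (auto simp: n_def)
      also have "mass (B \<inter> {..<m}) (y j) \<le> mass B (y j)" by (rule mass_mono[OF fin]) auto
      also have "mass (C (k' n) - {..<m}) (y j) \<le> 1 / 10" by (rule m[OF C(1)])
      finally show ?thesis by simp
    qed
    \<comment> \<open>On a finite set, convergence in each coordinate is enough for the masses to
      converge.\<close>
    have "(\<lambda>j. mass B (y j)) \<longlonglongrightarrow> mass B (\<lambda>t. 0)" by (rule tendsto_mass[OF y0])
    then have "(\<lambda>j. mass B (y j)) \<longlonglongrightarrow> 0" by (simp add: mass_def)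
    from LIMSEQ_le_const[OF this] yB have "8 / 10 \<le> (0::real)" by blast
    then show False by simp
  qed
  ultimately show ?thesis using BR unfolding infinite_clique_def by blast
qed

section \<open>The graph of a tree\<close>

text \<open>The search tree for a witness of membership of \<open>x\<close> in
  \<open>diag_analytic\<close>. Imposing the condition on all initial segments makes it closed under
  them, and its infinite branches are the witnesses.\<close>

definition in_tree :: "(nat \<Rightarrow> nat) \<Rightarrow> nat list \<Rightarrow> bool" where
  "in_tree x u \<longleftrightarrow> (\<forall>n\<le>length u. x (pair_code (take n u) (map x [0..<n])) = 0)"

lemma in_tree_take: "in_tree x u \<Longrightarrow> in_tree x (take n u)"
  unfolding in_tree_def by (auto simp: min_def split: if_splits)

lemma take_map_upt: "k \<le> n \<Longrightarrow> take k (map z [0..<n]) = map z [0..<k]"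
  by (simp add: take_map)

lemma diag_analytic_iff: "x \<in> diag_analytic \<longleftrightarrow> (\<exists>z. \<forall>n. in_tree x (map z [0..<n]))"
proof
  assume "x \<in> diag_analytic"
  then obtain z where z: "\<And>n. x (pair_code (map z [0..<n]) (map x [0..<n])) = 0" unfolding diag_analytic_def by blast
  then show "\<exists>z. \<forall>n. in_tree x (map z [0..<n])"
    unfolding in_tree_def by (intro exI[of _ z]) (simp add: take_map_upt)
next
  assume "\<exists>z. \<forall>n. in_tree x (map z [0..<n])"
  then obtain z where z: "\<And>n. in_tree x (map z [0..<n])" by blast
  have "x (pair_code (map z [0..<n]) (map x [0..<n])) = 0" for n
    using z[of n] unfolding in_tree_def by (auto dest: spec[of _ n])
  then show "x \<in> diag_analytic" unfolding diag_analytic_def by blast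
qed

text \<open>A vertex is a level together with a finite set of nodes of the tree of that level, i.e. an
  element of the vector space over \<open>\<int>/2\<close> that is spanned by these nodes.\<close>

definition vertex :: "nat \<Rightarrow> nat list set \<Rightarrow> nat" where
  "vertex n H = prod_encode (n, set_encode (list_encode ` H))"

definition level :: "nat \<Rightarrow> nat" where
  "level t = fst (prod_decode t)"

definition nodes :: "nat \<Rightarrow> nat list set" where
  "nodes t = list_decode ` set_decode (snd (prod_decode t))"

lemma level_vertex [simp]: "level (vertex n H) = n"
  by (simp add: level_def vertex_def)

lemma nodes_vertex [simp]: "finite H \<Longrightarrow> nodes (vertex n H) = H"
  by (simp add: nodes_def vertex_def set_encode_inverse image_image)

lemma finite_nodes [simp]: "finite (nodes t)"
  by (simp add: nodes_def)

lemma vertex_nodes [simp]: "vertex (level t) (nodes t) = t"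
  by (simp add: level_def nodes_def vertex_def image_image)

text \<open>Numbers without this property remain as isolated vertices of the graph, since
  \<open>below\<close> requires it on both sides.\<close>

definition admissible :: "(nat \<Rightarrow> nat) \<Rightarrow> nat \<Rightarrow> bool" where
  "admissible x t \<longleftrightarrow> (\<forall>u\<in>nodes t. in_tree x u \<and> length u = level t)"

text \<open>The linear map over Z/2 that is induced by cutting nodes to length \<open>n\<close>: the
  coefficient at \<open>u\<close> is the parity of the number of nodes in \<open>H\<close> that are
  cut to \<open>u\<close>.\<close>

definition project :: "nat \<Rightarrow> nat list set \<Rightarrow> nat list set" where
  "project n H = {u. odd (card {s\<in>H. take n s = u})}"

definition below :: "(nat \<Rightarrow> nat) \<Rightarrow> nat \<Rightarrow> nat \<Rightarrow> bool" where
  "below x s t \<longleftrightarrow> level s < level t \<and> admissible x s \<and> admissible x t \<and> nodes s = project (level s) (nodes t)"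

definition tree_graph :: "(nat \<Rightarrow> nat) \<Rightarrow> nat \<Rightarrow> nat \<Rightarrow> bool" where
  "tree_graph x s t \<longleftrightarrow> below x s t \<or> below x t s"

lemma in_tree_meas: "Measurable.pred borel (\<lambda>x. in_tree x u)"
proof -
  let ?B = "borel :: (nat \<Rightarrow> nat) measure"
  have coord: "{x \<in> space ?B. x i = j} \<in> sets ?B" for i j
    using measurable_sets[OF borel_coord, of "{j}" i] by (simp add: vimage_def)
  \<comment> \<open>The position at which \<open>x\<close> is read depends on \<open>x\<close>
    itself. Quantification over the countably many possible initial segments \<open>w\<close> makes
    the position constant.\<close>
  have "in_tree x u \<longleftrightarrow> (\<forall>n. n \<le> length u \<longrightarrow> (\<exists>w. length w = n \<and> (\<forall>i. i < n \<longrightarrow> x i = w ! i) \<and>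
      x (pair_code (take n u) w) = 0))" for x
  proof -
    have "(\<exists>w. length w = n \<and> (\<forall>i. i < n \<longrightarrow> x i = w ! i) \<and> x (pair_code (take n u) w) = 0) \<longleftrightarrow>
        x (pair_code (take n u) (map x [0..<n])) = 0" for n
    proof
      assume "\<exists>w. length w = n \<and> (\<forall>i. i < n \<longrightarrow> x i = w ! i) \<and> x (pair_code (take n u) w) = 0"
      then obtain w where w: "length w = n" "\<forall>i. i < n \<longrightarrow> x i = w ! i" "x (pair_code (take n u) w) = 0" by blast
      then have "map x [0..<n] = w" by (intro nth_equalityI) auto
      then show "x (pair_code (take n u) (map x [0..<n])) = 0" using w by simp
    qed (auto intro!: exI[of _ "map x [0..<n]"])
    then show ?thesis unfolding in_tree_def by simp
  qed
  moreover have "{x \<in> space ?B. \<forall>n. n \<le> length u \<longrightarrow> (\<exists>w. length w = n \<and> (\<forall>i. i < n \<longrightarrow> x i = w ! i) \<and>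
      x (pair_code (take n u) w) = 0)} \<in> sets ?B"
    by (rule sets.sets_Collect_countable_All sets.sets_Collect_countable_Ex sets.sets_Collect_imp
        sets.sets_Collect_conj sets.sets_Collect_const coord)+
  ultimately show ?thesis unfolding pred_def by simp
qed

lemma tree_graph_meas: "Measurable.pred borel (\<lambda>x. tree_graph x s t)"
proof -
  have [measurable]: "Measurable.pred borel (\<lambda>x. in_tree x u)" for u by (rule in_tree_meas)
  have [measurable]: "Measurable.pred borel (\<lambda>x. admissible x t)" for t
    unfolding admissible_def by (intro pred_intros_finite(3) finite_nodes) measurable
  show ?thesis unfolding tree_graph_def below_def by measurable
qed

interpretation tree_field: clique_field tree_graph
  by (rule clique_field.intro) (rule tree_graph_meas)

text \<open>Addition of the basis vector \<open>u\<close> over Z/2.\<close>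

definition toggle :: "nat list \<Rightarrow> nat list set \<Rightarrow> nat list set" where
  "toggle u H = (if u \<in> H then H - {u} else insert u H)"

lemma toggle_toggle [simp]: "toggle u (toggle u H) = H"
  by (auto simp: toggle_def)

lemma finite_toggle [simp]: "finite H \<Longrightarrow> finite (toggle u H)"
  by (simp add: toggle_def)

lemma odd_card_toggle: "finite H \<Longrightarrow> odd (card (toggle u H)) \<longleftrightarrow> even (card H)"
  by (auto simp: toggle_def card_Diff_singleton_if card_gt_0_iff)

text \<open>This is linearity of the projection over Z/2: the basis vector of \<open>s\<close> is
  sent to that of its truncation.\<close>

lemma project_toggle:
  assumes "finite H"
  shows "project n (toggle s H) = toggle (take n s) (project n H)"
proof -
  have "{s'\<in>toggle s H. take n s' = u} = (if take n s = u then toggle s {s'\<in>H. take n s' = u} else {s'\<in>H. take n s' = u})" for u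
    by (auto simp: toggle_def)
  then have "u \<in> project n (toggle s H) \<longleftrightarrow> (if take n s = u then u \<notin> project n H else u \<in> project n H)" for u
    using assms by (simp add: project_def odd_card_toggle)
  then show ?thesis by (auto simp: toggle_def split: if_splits)
qed

text \<open>On each level the basis vector of the branch is added. Truncation sends these vectors to
  one another, so edges are preserved, and over Z/2 a translation is its own inverse. On level 0 the
  branch is the root \<open>[]\<close>, which turns the zero vector into
  \<open>{[]}\<close>.\<close>

lemma branch_involution:
  assumes z: "\<And>n. in_tree x (map z [0..<n])"
  shows "\<exists>\<theta>. (\<forall>t. \<theta> (\<theta> t) = t) \<and> (\<forall>s t. tree_graph x s t \<longrightarrow> tree_graph x (\<theta> s) (\<theta> t)) \<and>
    \<theta> (vertex 0 {}) = vertex 0 {[]}"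
proof -
  define \<theta> where "\<theta> t = (if admissible x t then vertex (level t) (toggle (map z [0..<level t]) (nodes t)) else t)" for t
  have adm: "admissible x (\<theta> t) \<longleftrightarrow> admissible x t" for t
  proof (cases "admissible x t")
    case True
    then show ?thesis using z by (auto simp: \<theta>_def admissible_def toggle_def split: if_splits)
  qed (simp add: \<theta>_def)
  have lev: "level (\<theta> t) = level t" for t by (simp add: \<theta>_def)
  have nod: "nodes (\<theta> t) = toggle (map z [0..<level t]) (nodes t)" if "admissible x t" for t
    using that by (simp add: \<theta>_def)
  have "\<theta> (\<theta> t) = t" for t
  proof (cases "admissible x t")
    case True
    then have "\<theta> (\<theta> t) = vertex (level t) (nodes t)"
      using adm[of t] lev[of t] nod[OF True] by (simp add: \<theta>_def[of "\<theta> t"])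
    then show ?thesis by simp
  qed (simp add: \<theta>_def)
  moreover have "below x (\<theta> s) (\<theta> t)" if "below x s t" for s t
    using that unfolding below_def
    by (simp add: adm lev nod project_toggle take_map_upt)
  moreover have "\<theta> (vertex 0 {}) = vertex 0 {[]}"
    by (simp add: \<theta>_def admissible_def toggle_def)
  ultimately show ?thesis unfolding tree_graph_def by blast
qed

text \<open>Members of a clique have distinct levels, so an infinite one reaches arbitrarily high
  levels. A node with coefficient 1 has an odd number of extensions among the nodes of any higher
  member, hence at least one. Starting from the root this can be repeated indefinitely.\<close>

lemma infinite_clique_branch:
  assumes B: "infinite_clique (tree_graph x) B" and r: "vertex 0 {[]} \<in> B"
  shows "x \<in> diag_analytic"
proof -
  have comp: "below x s t \<or> below x t s" if "s \<in> B" "t \<in> B" "s \<noteq> t" for s t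
    using B that unfolding infinite_clique_def tree_graph_def by blast
  have "inj_on level B"
    using comp unfolding below_def by (intro inj_onI) (metis less_irrefl)
  then have "infinite (level ` B)" using B unfolding infinite_clique_def by (simp add: finite_image_iff)
  then have unb: "\<exists>t\<in>B. level t > n" for n
    by (metis (no_types, lifting) finite_nat_set_iff_bounded_le image_iff linorder_not_le)
  have step: "\<exists>t'\<in>B. \<exists>u'\<in>nodes t'. level t' > level t \<and> take (level t) u' = u" if t: "t \<in> B" "u \<in> nodes t" for t u
  proof -
    obtain t' where t': "t' \<in> B" "level t' > level t" using unb by blast
    then have "below x t t'" using comp[OF t(1) t'(1)] unfolding below_def by auto
    then have "odd (card {s\<in>nodes t'. take (level t) s = u})" using t(2) unfolding below_def project_def by auto
    then have "{s\<in>nodes t'. take (level t) s = u} \<noteq> {}" by (rule odd_card_imp_not_empty)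
    then show ?thesis using t' by blast
  qed
  have "\<exists>f. \<forall>n. (fst (f n) \<in> B \<and> snd (f n) \<in> nodes (fst (f n))) \<and>
      (level (fst (f (Suc n))) > level (fst (f n)) \<and> take (level (fst (f n))) (snd (f (Suc n))) = snd (f n))"
  proof (rule dependent_nat_choice)
    show "\<exists>p. fst p \<in> B \<and> snd p \<in> nodes (fst p)"
      using r by (intro exI[of _ "(vertex 0 {[]}, [])"]) simp
    show "\<exists>p'. (fst p' \<in> B \<and> snd p' \<in> nodes (fst p')) \<and>
        (level (fst p') > level (fst p) \<and> take (level (fst p)) (snd p') = snd p)"
      if "fst p \<in> B \<and> snd p \<in> nodes (fst p)" for p and n :: nat
      using step[of "fst p" "snd p"] that by (metis fst_conv snd_conv)
  qed
  then obtain f where f: "\<And>n. fst (f n) \<in> B" "\<And>n. snd (f n) \<in> nodes (fst (f n))"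
      "\<And>n. level (fst (f (Suc n))) > level (fst (f n))"
      "\<And>n. take (level (fst (f n))) (snd (f (Suc n))) = snd (f n)" by metis
  define u where "u n = snd (f n)" for n
  have adm: "admissible x t" if "t \<in> B" for t
  proof -
    obtain t' where "t' \<in> B" "level t' > level t" using unb by blast
    then show ?thesis using comp[OF that, of t'] unfolding below_def by auto
  qed
  have tree: "in_tree x (u n)" and len: "length (u n) = level (fst (f n))" for n
    using adm[OF f(1)] f(2) unfolding admissible_def u_def by blast+
  have inc: "length (u n) < length (u (Suc n))" and ext: "take (length (u n)) (u (Suc n)) = u n" for n
    using f(3,4) by (simp_all add: len) (simp add: u_def)
  have ge: "n \<le> length (u n)" for n
  proof (induction n)
    case (Suc n)
    then show ?case using inc[of n] by linarith
  qed simp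
  have len_mono: "length (u m) \<le> length (u (m + k))" for m k
  proof (induction k)
    case (Suc k)
    then show ?case using inc[of "m + k"] by simp
  qed simp
  have ext': "take (length (u m)) (u (m + k)) = u m" for m k
  proof (induction k)
    case (Suc k)
    have "length (u m) \<le> length (u (m + k))"
      by (rule len_mono)
    then have "take (length (u m)) (u (m + Suc k)) = take (length (u m)) (take (length (u (m + k))) (u (Suc (m + k))))"
      by (simp add: min_def)
    then show ?case using Suc ext[of "m + k"] by simp
  qed simp
  \<comment> \<open>\<open>u (Suc n)\<close> has length at least \<open>n + 1\<close>, so its entry
    \<open>n\<close> exists, and it is shared by all later nodes.\<close>
  define z where "z n = u (Suc n) ! n" for n
  have "map z [0..<n] = take n (u n)" for n
  proof (rule nth_equalityI)
    show "length (map z [0..<n]) = length (take n (u n))" using ge[of n] by simp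
    fix i assume i: "i < length (map z [0..<n])"
    then have "u n = u (Suc i + (n - Suc i))" by simp
    then have "take (length (u (Suc i))) (u n) = u (Suc i)" using ext'[of "Suc i" "n - Suc i"] by simp
    then have "u n ! i = u (Suc i) ! i" using ge[of "Suc i"] by (metis Suc_le_lessD nth_take)
    then show "map z [0..<n] ! i = take n (u n) ! i" using i by (simp add: z_def)
  qed
  then have "in_tree x (map z [0..<n])" for n using in_tree_take[OF tree[of n], of n] by simp
  then show ?thesis unfolding diag_analytic_iff by blast
qed

text \<open>A branch yields an exact exchange of the two unit vectors, whereas an approximate one is
  enough to recover a branch. The set is thus characterised by an open condition on isometries,
  tested on the clique of the zero vectors \<open>vertex n {}\<close>.\<close>

theorem swap_isometry_iff:
  "(\<exists>\<alpha>\<in>isometries (clique_space (tree_graph x)).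
      norm_dist (clique_space (tree_graph x)) (\<alpha> (unit_vec (vertex 0 {}))) (unit_vec (vertex 0 {[]})) < 1 / 10)
    \<longleftrightarrow> x \<in> diag_analytic"
proof
  assume "\<exists>\<alpha>\<in>isometries (clique_space (tree_graph x)).
      norm_dist (clique_space (tree_graph x)) (\<alpha> (unit_vec (vertex 0 {}))) (unit_vec (vertex 0 {[]})) < 1 / 10"
  then obtain \<alpha> where \<alpha>: "\<alpha> \<in> isometries (clique_space (tree_graph x))"
      "norm_dist (clique_space (tree_graph x)) (\<alpha> (unit_vec (vertex 0 {}))) (unit_vec (vertex 0 {[]})) < 1 / 10" by blast
  have below: "below x (vertex i {}) (vertex j {})" if "i < j" for i j
    using that by (simp add: below_def admissible_def project_def)
  have "\<exists>B. infinite_clique (tree_graph x) B \<and> vertex 0 {[]} \<in> B"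
  proof (rule isometry_infinite_clique[OF \<alpha>(1), of "\<lambda>n. vertex n {}"])
    show "inj (\<lambda>n. vertex n {})" by (rule injI) (metis level_vertex)
    show "tree_graph x (vertex i {}) (vertex j {})" if "i \<noteq> j" for i j
      using below[of i j] below[of j i] that unfolding tree_graph_def by (cases "i < j") auto
  qed (rule \<alpha>(2))
  then show "x \<in> diag_analytic" using infinite_clique_branch by blast
next
  assume "x \<in> diag_analytic"
  then obtain z where "\<And>n. in_tree x (map z [0..<n])" unfolding diag_analytic_iff by blast
  from branch_involution[of x z, OF this] obtain \<theta> where \<theta>: "\<And>t. \<theta> (\<theta> t) = t"
      "\<And>s t. tree_graph x s t \<Longrightarrow> tree_graph x (\<theta> s) (\<theta> t)" "\<theta> (vertex 0 {}) = vertex 0 {[]}" by blast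
  define \<alpha> where "\<alpha> = (\<lambda>v\<in>clique_vectors (tree_graph x). \<lambda>t. v (\<theta> t))"
  have "\<alpha> \<in> isometries (clique_space (tree_graph x))"
    unfolding \<alpha>_def by (rule involution_isometry[where \<theta>=\<theta>]) (simp_all add: \<theta>(1,2))
  moreover have "\<alpha> (unit_vec (vertex 0 {})) = unit_vec (vertex 0 {[]})"
  proof -
    have "\<theta> t = vertex 0 {} \<longleftrightarrow> t = vertex 0 {[]}" for t using \<theta>(1,3) by metis
    then have "(\<lambda>t. unit_vec (vertex 0 {}) (\<theta> t)) = unit_vec (vertex 0 {[]})"
      by (simp add: unit_vec_def fun_eq_iff)
    then show ?thesis by (simp add: \<alpha>_def)
  qed
  moreover have "norm_dist (clique_space (tree_graph x)) (unit_vec r) (unit_vec r) = 0" for r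
    using Metric_space.mdist_zero[OF metric_clique_space unit_clique] .
  ultimately show "\<exists>\<alpha>\<in>isometries (clique_space (tree_graph x)).
      norm_dist (clique_space (tree_graph x)) (\<alpha> (unit_vec (vertex 0 {}))) (unit_vec (vertex 0 {[]})) < 1 / 10"
    by (intro bexI[of _ \<alpha>]) auto
qed

section \<open>Absence of dense sections, and the three claims\<close>

lemma (in bounded_field) isom_field_MI: "isom_field X V MV \<phi> MI"
  by (intro isom_field.intro operator_field.intro operator_field_axioms.intro banach_field_axioms
      isom_sub isom_structure)

lemma tree_bounded_field:
  "bounded_field borel tree_field.V tree_field.MV (\<lambda>n x. rat_vec n) tree_field.MB"
  by (rule bounded_field.intro) (rule tree_field.operators)

text \<open>The bound \<open>< 1 / 10\<close> is open in the strong operator topology, so it is met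
  by some dense section as soon as it is met by an isometry. As a condition on countably many Borel
  sections it would make \<open>diag_analytic\<close> Borel.\<close>

theorem no_dense_sections:
  "\<not> dense_borel_sections borel (\<lambda>x. isom_topology (tree_field.V x))
      (restrict_space tree_field.MB (isom_total borel tree_field.V)) \<psi>"
proof
  let ?V = "tree_field.V"
  assume \<psi>: "dense_borel_sections borel (\<lambda>x. isom_topology (?V x))
      (restrict_space tree_field.MB (isom_total borel ?V)) \<psi>"
  interpret bounded_field borel ?V tree_field.MV "\<lambda>n x. rat_vec n" tree_field.MB by (rule tree_bounded_field)
  interpret I: isom_field borel ?V tree_field.MV "\<lambda>n x. rat_vec n" MI by (rule isom_field_MI)
  let ?r0 = "unit_vec (vertex 0 {})" and ?r1 = "unit_vec (vertex 0 {[]})"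
  have unit: "(\<lambda>x. (x, unit_vec j)) \<in> borel \<rightarrow>\<^sub>M tree_field.MV" for j
    by (rule tree_field.measurable_to_MV) auto
  have sect: "(\<lambda>x. (x, \<psi> n x)) \<in> borel \<rightarrow>\<^sub>M MI" for n
    using \<psi> unfolding dense_borel_sections_def by blast
  have "(\<lambda>x. norm_dist (?V x) (\<psi> n x ?r0) ?r1) \<in> borel_measurable borel" for n
    using measurable_dist[OF I.measurable_eval[OF sect unit] unit] by simp
  then have "{x \<in> space borel. \<exists>n. norm_dist (?V x) (\<psi> n x ?r0) ?r1 < 1 / 10} \<in> sets borel"
    by measurable
  moreover have "(\<exists>n. norm_dist (?V x) (\<psi> n x ?r0) ?r1 < 1 / 10) \<longleftrightarrow> x \<in> diag_analytic" for x
  proof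
    assume "\<exists>n. norm_dist (?V x) (\<psi> n x ?r0) ?r1 < 1 / 10"
    moreover have "\<psi> n x \<in> isometries (?V x)" for n
      using measurable_space[OF sect, of x n] by (simp add: I.space_M)
    ultimately show "x \<in> diag_analytic" unfolding swap_isometry_iff[symmetric] tree_field.V_def by blast
  next
    assume "x \<in> diag_analytic"
    then obtain \<alpha> where \<alpha>: "\<alpha> \<in> isometries (?V x)" "norm_dist (?V x) (\<alpha> ?r0) ?r1 < 1 / 10"
      unfolding swap_isometry_iff[symmetric] tree_field.V_def by blast
    interpret banach_fibre_dense "?V x" rat_vec unfolding tree_field.V_def by (rule banach_fibre_dense_clique)
    let ?W = "{\<alpha>\<in>isometries (?V x). norm_dist (?V x) ?r1 (\<alpha> ?r0) < 1 / 10}"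
    have W: "openin (isom_topology (?V x)) ?W"
      by (rule openin_evaluation) (simp_all add: tree_field.V_def)
    have "\<alpha> \<in> ?W" using \<alpha> by (simp add: V.commute)
    moreover have "isom_topology (?V x) closure_of range (\<lambda>n. \<psi> n x) = isometries (?V x)"
      using \<psi> unfolding dense_borel_sections_def by simp
    ultimately have "\<alpha> \<in> isom_topology (?V x) closure_of range (\<lambda>n. \<psi> n x)" using \<alpha>(1) by simp
    from in_closure_of[THEN iffD1, OF this, THEN conjunct2, rule_format, of ?W]
    have "\<exists>\<beta>. \<beta> \<in> range (\<lambda>n. \<psi> n x) \<and> \<beta> \<in> ?W"
      using W \<open>\<alpha> \<in> ?W\<close> by simp
    then show "\<exists>n. norm_dist (?V x) (\<psi> n x ?r0) ?r1 < 1 / 10" by (auto simp: V.commute)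
  qed
  ultimately have "diag_analytic \<in> sets borel" by simp
  then show False
    using diag_analytic_not_borel[OF standard_borel_borel[OF completely_metrizable_fun[OF completely_metrizable_nat]]] by blast
qed

lemma bounded_fieldE:
  assumes "borel_field_banach X V MV" "operator_borel_structure X MV (\<lambda>x. bounded_ops (V x)) MB"
  obtains \<phi> where "bounded_field X V MV \<phi> MB"
proof -
  obtain \<phi> where "dense_borel_sections X (\<lambda>x. norm_topology (V x)) MV \<phi>"
    using assms(1) unfolding borel_field_banach_def by blast
  then show ?thesis
    using assms that by (intro that[of \<phi>] bounded_field.intro operator_field.intro banach_field.intro
      operator_field_axioms.intro subset_refl)
qed

text \<open>The two notions see the base only through its \<sigma>-algebra. A measure \<mu> on the
  base can therefore take the place of \<open>X\<close>, which is the form in which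
  \<open>measured_field\<close> is stated.\<close>

lemma borel_field_banach_cong:
  assumes "sets \<mu> = sets X"
  shows "borel_field_banach \<mu> V MV \<longleftrightarrow> borel_field_banach X V MV"
    and "operator_borel_structure \<mu> MV S M \<longleftrightarrow> operator_borel_structure X MV S M"
  unfolding borel_field_banach_def operator_borel_structure_def dense_borel_sections_def
  by (simp_all add: standard_borel_cong[OF assms] sets_eq_imp_space_eq[OF assms]
      measurable_cong_sets[OF assms refl] measurable_cong_sets[OF refl assms])

lemma isom_structure_properties:
  assumes "borel_field_banach X V MV" "operator_borel_structure X MV (\<lambda>x. bounded_ops (V x)) MB"
    and MI: "MI = restrict_space MB (isom_total X V)"
  shows "isom_total X V \<in> sets MB"
    and "operator_borel_structure X MV (\<lambda>x. isometries (V x)) MI"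
    and "operator_borel_structure X MV (\<lambda>x. isometries (V x)) N \<Longrightarrow> sets N = sets MI"
    and "(\<lambda>((x, \<alpha>), (y, \<beta>)). (x, \<alpha> \<otimes>\<^bsub>isom_group (V x)\<^esub> \<beta>)) \<in> fiber_prod MI MI \<rightarrow>\<^sub>M MI"
    and "(\<lambda>(x, \<alpha>). (x, inv\<^bsub>isom_group (V x)\<^esub> \<alpha>)) \<in> MI \<rightarrow>\<^sub>M MI"
proof -
  obtain \<phi> where "bounded_field X V MV \<phi> MB" using bounded_fieldE[OF assms(1,2)] .
  then interpret bounded_field X V MV \<phi> MB .
  interpret I: isom_field X V MV \<phi> MI unfolding MI by (rule isom_field_MI)
  show "sets N = sets MI" if "operator_borel_structure X MV (\<lambda>x. isometries (V x)) N"
    by (rule operator_structure_unique[OF _ I.operator_field_axioms])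
       (intro operator_field.intro operator_field_axioms.intro banach_field_axioms isom_sub that)
  show "isom_total X V \<in> sets MB" by (rule isom_total_sets)
  show "operator_borel_structure X MV (\<lambda>x. isometries (V x)) MI" by (rule I.struct)
  show "(\<lambda>((x, \<alpha>), (y, \<beta>)). (x, \<alpha> \<otimes>\<^bsub>isom_group (V x)\<^esub> \<beta>)) \<in> fiber_prod MI MI \<rightarrow>\<^sub>M MI"
    by (rule I.measurable_mult)
  show "(\<lambda>(x, \<alpha>). (x, inv\<^bsub>isom_group (V x)\<^esub> \<alpha>)) \<in> MI \<rightarrow>\<^sub>M MI" by (rule I.measurable_inv)
qed

lemma isom_measured_field:
  assumes "borel_field_banach X V MV" "operator_borel_structure X MV (\<lambda>x. bounded_ops (V x)) MB"
    and \<mu>: "sets \<mu> = sets X" "sigma_finite_measure \<mu>"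
  shows "measured_field_polish_groups \<mu> (\<lambda>x. isom_group (V x)) (\<lambda>x. isom_topology (V x))
    (restrict_space MB (isom_total X V))"
proof -
  obtain \<phi> where "bounded_field \<mu> V MV \<phi> MB"
    using bounded_fieldE[of \<mu> V MV MB] assms(1,2) borel_field_banach_cong[OF \<mu>(1)] by blast
  then interpret bounded_field \<mu> V MV \<phi> MB .
  have "isom_total X V = isom_total \<mu> V"
    using sets_eq_imp_space_eq[OF \<mu>(1)] by (simp add: isom_total_def)
  then show ?thesis using isom_field.measured_field[OF isom_field_MI \<mu>(2)] by simp
qed

theorem proposition7p4:
  shows
    "(\<forall>(X :: 'x measure) (V :: 'x \<Rightarrow> 'v cnormed_space) MV MB MI.
        borel_field_banach X V MV \<and>
        operator_borel_structure X MV (\<lambda>x. bounded_ops (V x)) MB \<and>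
        MI = restrict_space MB (isom_total X V) \<longrightarrow>
          isom_total X V \<in> sets MB \<and>
          operator_borel_structure X MV (\<lambda>x. isometries (V x)) MI \<and>
          (\<forall>N. operator_borel_structure X MV (\<lambda>x. isometries (V x)) N \<longrightarrow> sets N = sets MI) \<and>
          (\<lambda>((x, \<alpha>), (y, \<beta>)). (x, \<alpha> \<otimes>\<^bsub>isom_group (V x)\<^esub> \<beta>)) \<in> fiber_prod MI MI \<rightarrow>\<^sub>M MI \<and>
          (\<lambda>(x, \<alpha>). (x, inv\<^bsub>isom_group (V x)\<^esub> \<alpha>)) \<in> MI \<rightarrow>\<^sub>M MI)
     \<and>
     (\<forall>(X :: 'x measure) (V :: 'x \<Rightarrow> 'v cnormed_space) MV MB \<mu>.
        borel_field_banach X V MV \<and>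
        operator_borel_structure X MV (\<lambda>x. bounded_ops (V x)) MB \<and>
        sets \<mu> = sets X \<and> sigma_finite_measure \<mu> \<longrightarrow>
          measured_field_polish_groups \<mu> (\<lambda>x. isom_group (V x)) (\<lambda>x. isom_topology (V x))
            (restrict_space MB (isom_total X V)))
     \<and>
     (\<exists>(X :: (nat \<Rightarrow> nat) measure) (V :: (nat \<Rightarrow> nat) \<Rightarrow> (nat \<Rightarrow> complex) cnormed_space) MV MB MI.
        borel_field_banach X V MV \<and>
        operator_borel_structure X MV (\<lambda>x. bounded_ops (V x)) MB \<and>
        MI = restrict_space MB (isom_total X V) \<and>
        \<not> borel_field_polish_groups X (\<lambda>x. isom_group (V x)) (\<lambda>x. isom_topology (V x)) MI \<and>
        \<not> (\<exists>\<phi>. dense_borel_sections X (\<lambda>x. isom_topology (V x)) MI \<phi>))"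
proof (intro conjI allI impI, goal_cases)
  case (1 X V MV MB MI)
  then show ?case using isom_structure_properties(1) by blast
next
  case (2 X V MV MB MI)
  then show ?case using isom_structure_properties(2) by blast
next
  case (3 X V MV MB MI N)
  then show ?case using isom_structure_properties(3) by blast
next
  case (4 X V MV MB MI)
  then show ?case by (intro isom_structure_properties(4)) auto
next
  case (5 X V MV MB MI)
  then show ?case by (intro isom_structure_properties(5)) auto
next
  case (6 X V MV MB \<mu>)
  then show ?case using isom_measured_field by blast
next
  case 7
  show ?case
  proof (intro exI conjI)
    show "borel_field_banach borel tree_field.V tree_field.MV"
      using tree_field.field by (rule banach_field.field)
    show "operator_borel_structure borel tree_field.MV (\<lambda>x. bounded_ops (tree_field.V x)) tree_field.MB"
      using tree_field.operators by (rule operator_field.struct)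
    show "\<not> borel_field_polish_groups borel (\<lambda>x. isom_group (tree_field.V x)) (\<lambda>x. isom_topology (tree_field.V x))
        (restrict_space tree_field.MB (isom_total borel tree_field.V))"
      using no_dense_sections unfolding borel_field_polish_groups_def borel_field_polish_def by blast
    show "\<not> (\<exists>\<phi>. dense_borel_sections borel (\<lambda>x. isom_topology (tree_field.V x))
        (restrict_space tree_field.MB (isom_total borel tree_field.V)) \<phi>)"
      using no_dense_sections by blast
  qed (rule refl)
qed

end
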